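(* Let $R>0$ and $\alpha,\gamma\in\mathbb{R}$. Let $\phi:(0,\infty)\to(0,\infty)$ be a twice differentiable $C^1$ function satisfying $(\phi_1)$–$(\phi_3)$ with constants $\gamma_1,\gamma_2>1$ (see context). Let $f\in C(\mathbb{R})\cap C^1(\mathbb{R}\setminus\{0\})$ satisfy $(f_1)$–$(f_3)$ (see context), with $d_\infty>0$ the constant of $(f_2)$. Assume $\gamma\ge\max\{\alpha,\frac{-\alpha}{\gamma_1-1}\}$. Then there exists a positive number $\Lambda=\Lambda(d_\infty)$ such that for each $\lambda\in(0,\Lambda]$ and each $d\in(0,d_\infty]$ the initial value problem $$-(r^\alpha\phi(|u'(r)|)u'(r))'=\lambda r^\gamma f(u(r)),\quad r>0,\qquad u(0)=d,\quad u'(0)=0,$$ has a unique solution $u(\cdot,d)=u(\cdot,d,\lambda)\in C^1([0,\infty))$. In addition, for each $\lambda\in(0,\Lambda]$ and each $d\in(0,d_\infty]$ there is a sequence $\{z_\ell\}_{\ell=1}^\infty$, $z_\ell=z_\ell(d)$, of zeroes of $u(\cdot,d)$ such that: (1) $z_1(d_\infty)\ge R$; $u(r,d)>0$ if $0<r<z_1(d)$; $z_1(d)<z_2(d)<\cdots<z_\ell(d)<\cdots$; $u'(r,d)<0$ if $0<r\le z_1(d)$; and, for every $\ell\ge 1$, $u(r,d)\ne0$ if $z_\ell<r<z_{\ell+1}$, and $u'(z_\ell,d)\neq0$. (2) For every $\ell\ge1$: $z_\ell(d)\to0$ as $d\to0$, and $z_\ell(d)\to z_\ell(\underline{d})$ as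 $d\to\underline{d}$, for each $\underline{d}\in(0,d_\infty]$. (3) If $\underline{d}\in(0,d_\infty]$ and $u(\cdot,\underline{d})$ has $k$ zeroes in $(0,R)$, then $u(\cdot,d)$ has at most $k+1$ zeroes in $(0,R)$ whenever $d<\underline{d}$ and $d$ is close enough to $\underline{d}$.
   Context: Conditions on $\phi$: $(\phi_1)$ $t\phi(t)\to0$ as $t\to0$ and $t\phi(t)\to\infty$ as $t\to\infty$; $(\phi_2)$ $t\mapsto t\phi(t)$ is strictly increasing in $(0,\infty)$; $(\phi_3)$ there are constants $\gamma_1,\gamma_2>1$ such that $\gamma_1-1\le \frac{(t\phi(t))'}{\phi(t)}\le\gamma_2-1$ for all $t>0$. These constants are fixed. Conditions on $f$: $(f_1)$ $tf(t)>0$ for $t\ne0$; $(f_2)$ there exists $d_\infty>0$ such that $f$ is nondecreasing in $(-\infty,d_\infty]$ (this $d_\infty$ is fixed); $(f_3)$ $\liminf_{\nu\to0^{\pm}}\int_0^\nu|f(t)|^{\frac{-1}{\gamma_1-1}}\operatorname{sgn}(f(t))\,dt<\infty$, a condition the authors state to be equivalent to $\max\{\int_{-x}^0[-f(t)]^{\frac{-1}{\gamma_1-1}}dt,\ \int_0^y[f(t)]^{\frac{-1}{\gamma_1-1}}dt\}<\infty$ for each $x,y>0$. Conventions: $\phi(|s|)s$ is read as $0$ when $s=0$. A solution of the initial value problem is a function $u\in C^1([0,\infty))$ such that $r^\alpha\phi(|u'(r)|)u'(r)$ is differentiable, the equation holds for $r>0$, and $u(0)=d$, $u'(0)=0$.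 Primes on $u(r,d)$ denote derivatives in $r$. All values of $d$ are taken in $(0,d_\infty]$.
   Formalization: A solution is also required to have r^α φ(|u'|)u', given the value 0 at r=0, differentiable (one-sidedly) at r=0; this is automatic for α≥0, but for α<0 uniqueness fails if differentiability is asked only for r>0. *)

theory Defs
  imports "HOL-Analysis.Analysis"
begin

text \<open>
  Oriented Lebesgue integral \<open>\<integral>\<^sub>a\<^sup>b h\<close> with values in the extended reals. Unlike the library's
  interval integral, a divergent integral of a function of constant sign has the value
  \<open>\<plusminus>\<infinity>\<close> here instead of the default value \<open>0\<close>, so its finiteness is a genuine condition.
\<close>

definition ext_integral :: "real \<Rightarrow> real \<Rightarrow> (real \<Rightarrow> real) \<Rightarrow> ereal" where
  "ext_integral a b h =
     (let I = (\<lambda>c d. enn2ereal (\<integral>\<^sup>+t\<in>{c..d}. ennreal (h t) \<partial>lborel)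
                   - enn2ereal (\<integral>\<^sup>+t\<in>{c..d}. ennreal (- h t) \<partial>lborel))
      in if a \<le> b then I a b else - I b a)"

text \<open>
  Functions on \<open>[0, \<infinity>)\<close> are total functions of which only the values on \<open>{0..}\<close> matter; their
  derivative is taken within \<open>{0..}\<close>, i.e. it is one-sided at \<open>0\<close> and the usual one elsewhere.
\<close>

definition deriv_ge0 :: "(real \<Rightarrow> real) \<Rightarrow> real \<Rightarrow> real" where
  "deriv_ge0 u r = vector_derivative u (at r within {0..})"

text \<open>
  The flux \<open>r\<^sup>\<alpha> \<phi>(|u'(r)|) u'(r)\<close> is required to be differentiable on all of \<open>[0, \<infinity>)\<close>, one-sidedly
  at \<open>0\<close>, where its value is \<open>0\<close> (because \<open>u'(0) = 0\<close>, and \<open>0 powr \<alpha> = 0\<close> also if \<open>\<alpha> < 0\<close>).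
  If \<open>\<alpha> < 0\<close>, differentiability on \<open>(0, \<infinity>)\<close> alone would allow the flux to tend to an
  arbitrary constant at \<open>0\<close> while \<open>u'(0) = 0\<close>, and uniqueness would fail.
  The term \<open>\<phi>(|s|) s\<close> is \<open>0\<close> at \<open>s = 0\<close>, whatever the value of \<open>\<phi>\<close> at \<open>0\<close>.
\<close>

definition ivp_solution ::
  "(real \<Rightarrow> real) \<Rightarrow> (real \<Rightarrow> real) \<Rightarrow> real \<Rightarrow> real \<Rightarrow> real \<Rightarrow> real \<Rightarrow> (real \<Rightarrow> real) \<Rightarrow> bool" where
  "ivp_solution \<phi> f \<alpha> \<gamma> lam d u \<longleftrightarrow>
     u differentiable_on {0..} \<and> continuous_on {0..} (deriv_ge0 u) \<and>
     (\<lambda>r. r powr \<alpha> * (\<phi> \<bar>deriv_ge0 u r\<bar> * deriv_ge0 u r)) differentiable_on {0..} \<and>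
     (\<forall>r>0. - deriv (\<lambda>r. r powr \<alpha> * (\<phi> \<bar>deriv_ge0 u r\<bar> * deriv_ge0 u r)) r
              = lam * r powr \<gamma> * f (u r)) \<and>
     u 0 = d \<and> deriv_ge0 u 0 = 0"

end

theory Submission
  imports Defs "HOL-Complex_Analysis.Great_Picard"
begin

text \<open>
  Let \<open>\<psi>\<close> be the inverse of \<open>s \<mapsto> \<phi>(\<bar>s\<bar>) s\<close> and \<open>p = 1 / (\<gamma>\<^sub>1 - 1)\<close>; condition \<open>(\<phi>\<^sub>3)\<close> says that
  \<open>y \<psi>'(y) \<le> p \<psi>(y)\<close>. The problem becomes the system \<open>u' = \<psi>(y)\<close>, \<open>w' = - \<lambda> r\<^sup>\<gamma> f(u)\<close> with
  \<open>y = r\<^sup>-\<^sup>\<alpha> w\<close> (below \<open>rflux w\<close>). With primitives \<open>F\<close> of \<open>f\<close> and \<open>G\<close> of \<open>\<psi>\<close>, the energy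
  \<open>\<lambda> F(u) + r\<^sup>\<alpha>\<^sup>-\<^sup>\<gamma> G(y)\<close> has the derivative \<open>r\<^sup>\<alpha>\<^sup>-\<^sup>\<gamma>\<^sup>-\<^sup>1 ((\<alpha> - \<gamma>) G(y) - \<alpha> y \<psi>(y))\<close>, which is
  nonpositive by the assumption on \<open>\<gamma>\<close> and at least \<open>- K / r\<close> times the energy. Hence
  \<open>F(u) \<le> F(d)\<close>, which allows \<open>f\<close> to be truncated to a bounded nondecreasing function, and \<open>u\<close> and
  \<open>w\<close> never vanish together, so that all zeros are simple. Existence and continuous dependence on
  \<open>d\<close> come from Tonelli's delayed equation and the theorem of Arzela and Ascoli. The solution
  oscillates because \<open>\<bar>f\<bar> powr -p\<close> has a finite primitive \<open>\<Psi>\<close> by \<open>(f\<^sub>3)\<close>: if \<open>u\<close> has one sign on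
  \<open>[a, 2a]\<close>, then \<open>\<Psi> \<circ> u\<close> changes there by at least a constant multiple of \<open>a\<close>, which is impossible
  for large \<open>a\<close>, and for fixed \<open>a\<close> when \<open>d\<close> is small.
\<close>

section \<open>Calculus and the inverse of the flux\<close>

text \<open>Existence therefore comes from compactness, uniqueness is proved on its own, and both
  together give continuous dependence on d. The obstacles never meet at one point: after the start u
  and w do not vanish simultaneously, and at the start u = d > 0 keeps the forcing away from 0, so
  that the flux has an exact order in r. The weight of G in the energy is the one for which the
  terms with \<open>lam * f u * \<psi> y\<close> cancel in the derivative; the two halves of the
  assumption on \<open>\<gamma>\<close> give the derivative its sign for
  \<open>\<alpha> \<ge> 0\<close> and \<open>\<alpha> < 0\<close> respectively. The bound F(u) \<le>
  F(d) does not contain \<open>lam\<close>. Hence the truncation of f and its bound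
  \<open>f_max\<close> can be fixed before \<open>lam\<close>, and \<open>\<Lambda>\<close> is then
  taken so small that the modulus of u' is at most \<open>d_inf / (2 * R)\<close> on [0, R].\<close>

lemma diff_le_diff_of_deriv_le:
  fixes f g :: "real \<Rightarrow> real"
  assumes "a \<le> b" "continuous_on {a..b} f" "continuous_on {a..b} g"
    and "\<And>x. a < x \<Longrightarrow> x < b \<Longrightarrow> (f has_real_derivative f' x) (at x)"
    and "\<And>x. a < x \<Longrightarrow> x < b \<Longrightarrow> (g has_real_derivative g' x) (at x)"
    and "\<And>x. a < x \<Longrightarrow> x < b \<Longrightarrow> f' x \<le> g' x"
  shows "f b - f a \<le> g b - g a"
proof -
  have "(\<lambda>x. g x - f x) a \<le> (\<lambda>x. g x - f x) b"
  proof (rule DERIV_nonneg_imp_increasing_open[OF assms(1)])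
    fix x assume x: "a < x" "x < b"
    show "\<exists>y. ((\<lambda>x. g x - f x) has_real_derivative y) (at x) \<and> 0 \<le> y"
      by (rule exI[of _ "g' x - f' x"]) (use assms(4-6)[OF x] in \<open>auto intro!: derivative_eq_intros\<close>)
  qed (intro continuous_intros assms)
  then show ?thesis by simp
qed

text \<open>A comparison function in place of a constant bound: fluxes will be compared with
  multiples of \<open>r powr (\<gamma> + 1)\<close>, whose order at r = 0 must not be lost.\<close>

lemma abs_diff_le_diff_of_deriv_le:
  fixes f g :: "real \<Rightarrow> real"
  assumes "a \<le> b" "continuous_on {a..b} f" "continuous_on {a..b} g"
    and "\<And>x. a < x \<Longrightarrow> x < b \<Longrightarrow> (f has_real_derivative f' x) (at x)"
    and "\<And>x. a < x \<Longrightarrow> x < b \<Longrightarrow> (g has_real_derivative g' x) (at x)"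
    and "\<And>x. a < x \<Longrightarrow> x < b \<Longrightarrow> \<bar>f' x\<bar> \<le> g' x"
  shows "\<bar>f b - f a\<bar> \<le> g b - g a"
proof -
  have "f b - f a \<le> g b - g a"
    by (rule diff_le_diff_of_deriv_le[OF assms(1-5)]) (use assms(6) in force)+
  moreover have "(\<lambda>x. - f x) b - (\<lambda>x. - f x) a \<le> g b - g a"
    by (rule diff_le_diff_of_deriv_le[where f' = "\<lambda>x. - f' x" and g' = g'])
      (use assms in \<open>force intro!: continuous_intros derivative_eq_intros\<close>)+
  ultimately show ?thesis by auto
qed

lemma abs_diff_le_of_deriv_le:
  fixes f :: "real \<Rightarrow> real"
  assumes "a \<le> b" "continuous_on {a..b} f"
    and "\<And>x. a < x \<Longrightarrow> x < b \<Longrightarrow> (f has_real_derivative f' x) (at x)"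
    and "\<And>x. a < x \<Longrightarrow> x < b \<Longrightarrow> \<bar>f' x\<bar> \<le> C"
  shows "\<bar>f b - f a\<bar> \<le> C * (b - a)"
proof -
  have "\<bar>f b - f a\<bar> \<le> C * b - C * a"
    by (rule abs_diff_le_diff_of_deriv_le[where g = "\<lambda>x. C * x" and g' = "\<lambda>x. C", OF assms(1,2) _ assms(3)])
      (use assms(4) in \<open>auto intro!: continuous_intros derivative_eq_intros\<close>)
  then show ?thesis by (simp add: algebra_simps)
qed

lemma lipschitz_of_deriv_le:
  fixes f :: "real \<Rightarrow> real"
  assumes "a \<in> {x..y}" "b \<in> {x..y}" "continuous_on {x..y} f"
    and "\<And>t. x < t \<Longrightarrow> t < y \<Longrightarrow> (f has_real_derivative f' t) (at t)"
    and "\<And>t. x < t \<Longrightarrow> t < y \<Longrightarrow> \<bar>f' t\<bar> \<le> C"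
  shows "\<bar>f a - f b\<bar> \<le> C * \<bar>a - b\<bar>"
proof -
  have *: "\<bar>f b - f a\<bar> \<le> C * (b - a)" if "a \<le> b" "a \<in> {x..y}" "b \<in> {x..y}" for a b
    by (rule abs_diff_le_of_deriv_le[where f' = f', OF that(1) continuous_on_subset[OF assms(3)]])
      (use that assms(4,5) in auto)
  show ?thesis using *[of a b] *[of b a] assms(1,2) by (cases "a \<le> b") (auto simp: abs_minus_commute)
qed

lemma le_diff_of_deriv_ge:
  fixes f :: "real \<Rightarrow> real"
  assumes "a \<le> b" "continuous_on {a..b} f"
    and "\<And>x. a < x \<Longrightarrow> x < b \<Longrightarrow> (f has_real_derivative f' x) (at x)"
    and "\<And>x. a < x \<Longrightarrow> x < b \<Longrightarrow> C \<le> f' x"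
  shows "C * (b - a) \<le> f b - f a"
proof -
  have "C * b - C * a \<le> f b - f a"
    by (rule diff_le_diff_of_deriv_le[where f = "\<lambda>x. C * x" and f' = "\<lambda>x. C", OF assms(1) _ assms(2) _ assms(3)])
      (use assms(4) in \<open>auto intro!: continuous_intros derivative_eq_intros\<close>)
  then show ?thesis by (simp add: algebra_simps)
qed

lemma powr_Suc_div_deriv:
  fixes b r :: real
  assumes "r > 0" "b \<ge> 0"
  shows "((\<lambda>r. r powr (b + 1) / (b + 1)) has_real_derivative r powr b) (at r)"
  using assms by (auto intro!: derivative_eq_intros)

lemma continuous_on_powr_nonneg:
  fixes b :: real
  assumes "b > 0" "S \<subseteq> {0..}"
  shows "continuous_on S (\<lambda>r::real. r powr b)"
  by (rule continuous_on_powr') (use assms in \<open>auto intro!: continuous_intros\<close>)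

lemma powr_bounded_above:
  fixes a b :: real
  assumes "0 < a"
  obtains C where "C > 0" "\<And>r. r \<in> {a..b} \<Longrightarrow> r powr s \<le> C"
proof
  show "0 < max (a powr s) (max (b powr s) 1)" by simp
  fix r assume r: "r \<in> {a..b}"
  show "r powr s \<le> max (a powr s) (max (b powr s) 1)"
  proof (cases "s \<ge> 0")
    case True
    then have "r powr s \<le> b powr s" using r assms by (intro powr_mono2) auto
    then show ?thesis by simp
  next
    case False
    then have "r powr s \<le> a powr s" using r assms by (intro powr_mono2') auto
    then show ?thesis by simp
  qed
qed

text \<open>The derivative of x^2 + y^2 is at most 2 C (|x| + |y|)^2, hence at most 4 C (x^2 + y^2),
  so the factor exp(- 4 C r) makes it nonincreasing.\<close>

lemma gronwall_pair_zero:
  fixes x y :: "real \<Rightarrow> real"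
  assumes ab: "a \<le> b" and cont: "continuous_on {a..b} x" "continuous_on {a..b} y"
    and dx: "\<And>r. a < r \<Longrightarrow> r < b \<Longrightarrow> (x has_real_derivative x' r) (at r)"
    and dy: "\<And>r. a < r \<Longrightarrow> r < b \<Longrightarrow> (y has_real_derivative y' r) (at r)"
    and bx: "\<And>r. a < r \<Longrightarrow> r < b \<Longrightarrow> \<bar>x' r\<bar> \<le> C * (\<bar>x r\<bar> + \<bar>y r\<bar>)"
    and byy: "\<And>r. a < r \<Longrightarrow> r < b \<Longrightarrow> \<bar>y' r\<bar> \<le> C * (\<bar>x r\<bar> + \<bar>y r\<bar>)"
    and "x a = 0" "y a = 0"
  shows "x b = 0 \<and> y b = 0"
proof -
  let ?z = "\<lambda>r. exp (- (4 * C * r)) * ((x r)\<^sup>2 + (y r)\<^sup>2)"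
  let ?z' = "\<lambda>r. exp (- (4 * C * r)) * (2 * x r * x' r + 2 * y r * y' r - 4 * C * ((x r)\<^sup>2 + (y r)\<^sup>2))"
  have "?z b - ?z a \<le> 0 - 0"
  proof (rule diff_le_diff_of_deriv_le[where f' = ?z' and g' = "\<lambda>_. 0", OF ab])
    fix r assume r: "a < r" "r < b"
    show "(?z has_real_derivative ?z' r) (at r)"
      using dx[OF r] dy[OF r]
      by (auto intro!: derivative_eq_intros simp: power2_eq_square algebra_simps)
    let ?s = "\<bar>x r\<bar> + \<bar>y r\<bar>"
    have 1: "2 * x r * x' r \<le> 2 * (\<bar>x r\<bar> * (C * ?s))"
      using mult_left_mono[OF bx[OF r], of "\<bar>x r\<bar>"] abs_ge_self[of "x r * x' r"] by (simp add: abs_mult)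
    have 2: "2 * y r * y' r \<le> 2 * (\<bar>y r\<bar> * (C * ?s))"
      using mult_left_mono[OF byy[OF r], of "\<bar>y r\<bar>"] abs_ge_self[of "y r * y' r"] by (simp add: abs_mult)
    have C: "0 \<le> C * ?s" using bx[OF r] by linarith
    have "?s\<^sup>2 \<le> 2 * ((x r)\<^sup>2 + (y r)\<^sup>2)"
      using sum_squares_ge_zero[of "\<bar>x r\<bar> - \<bar>y r\<bar>" 0] by (simp add: power2_eq_square algebra_simps)
    moreover have "2 * (\<bar>x r\<bar> * (C * ?s)) + 2 * (\<bar>y r\<bar> * (C * ?s)) = 2 * C * ?s\<^sup>2"
      by (simp add: power2_eq_square algebra_simps)
    moreover have "2 * C * ?s\<^sup>2 \<le> 2 * C * (2 * ((x r)\<^sup>2 + (y r)\<^sup>2))"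
    \<comment> \<open>The sign of \<open>C\<close> is not given; the hypotheses force it to be
      nonnegative wherever \<open>?s\<close> is positive.\<close>
    proof (cases "?s = 0")
      case True then show ?thesis by (auto simp: add_nonneg_eq_0_iff)
    next
      case False
      then have "?s > 0" by linarith
      then have "C \<ge> 0" using C by (metis zero_le_mult_iff not_le)
      then show ?thesis using calculation(1) by (intro mult_left_mono) auto
    qed
    moreover have "2 * C * (2 * ((x r)\<^sup>2 + (y r)\<^sup>2)) = 4 * C * ((x r)\<^sup>2 + (y r)\<^sup>2)" by simp
    ultimately have "2 * x r * x' r + 2 * y r * y' r - 4 * C * ((x r)\<^sup>2 + (y r)\<^sup>2) \<le> 0"
      using 1 2 by linarith
    then show "?z' r \<le> 0" by (simp add: mult_nonneg_nonpos)
  qed (auto intro!: continuous_intros cont)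
  then have "exp (- (4 * C * b)) * ((x b)\<^sup>2 + (y b)\<^sup>2) \<le> 0" using assms by simp
  then have "(x b)\<^sup>2 + (y b)\<^sup>2 \<le> 0" by (simp add: mult_le_0_iff)
  then show ?thesis by (metis sum_power2_le_zero_iff)
qed

section \<open>Oriented integrals from 0\<close>

definition primitive :: "(real \<Rightarrow> real) \<Rightarrow> real \<Rightarrow> real" where
  "primitive f x = integral {0..x} f - integral {x..0} f"

lemma primitive_0 [simp]: "primitive f 0 = 0"
  by (simp add: primitive_def)

lemma primitive_eq_integral:
  assumes int: "f integrable_on {a..b}" and a: "a \<le> 0" and b: "0 \<le> b" and y: "y \<in> {a..b}"
  shows "primitive f y = integral {a..y} f - integral {a..0} f"
proof (cases "0 \<le> y")
  case True
  have "integral {a..0} f + integral {0..y} f = integral {a..y} f"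
    by (rule Henstock_Kurzweil_Integration.integral_combine)
      (use a True y in \<open>auto intro: integrable_subinterval_real[OF int]\<close>)
  moreover have "integral {y..0} f = 0" using True by (cases "y = 0") auto
  ultimately show ?thesis by (simp add: primitive_def)
next
  case False
  have "integral {a..y} f + integral {y..0} f = integral {a..0} f"
    by (rule Henstock_Kurzweil_Integration.integral_combine)
      (use b False y in \<open>auto intro: integrable_subinterval_real[OF int]\<close>)
  then show ?thesis using False by (simp add: primitive_def)
qed

text \<open>Continuity is required at the single point x, so that integrands which are singular at
  0, such as \<open>\<bar>f x\<bar> powr - p\<close>, are covered.\<close>

lemma primitive_deriv_within:
  assumes int: "f integrable_on {a..b}" and a: "a \<le> 0" and b: "0 \<le> b" and x: "x \<in> {a..b}"
    and c: "continuous (at x within {a..b}) f"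
  shows "(primitive f has_real_derivative f x) (at x within {a..b})"
proof -
  have "((\<lambda>u. integral {a..u} f) has_vector_derivative f x) (at x within ({a..b} - {}))"
    by (rule integral_has_vector_derivative_continuous_at) (use assms in auto)
  then have "((\<lambda>u. integral {a..u} f - integral {a..0} f) has_real_derivative f x) (at x within {a..b})"
    by (auto simp: has_real_derivative_iff_has_vector_derivative[symmetric] intro!: derivative_eq_intros)
  then show ?thesis
    by (rule has_field_derivative_transform_within[where d = 1])
      (use primitive_eq_integral[OF int a b] x in auto)
qed

lemma primitive_continuous_on_Icc:
  assumes "f integrable_on {a..b}" "a \<le> 0" "0 \<le> b"
  shows "continuous_on {a..b} (primitive f)"
proof -
  have "continuous_on {a..b} (\<lambda>y. integral {a..y} f - integral {a..0} f)"
    by (intro continuous_intros indefinite_integral_continuous_1 assms)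
  then show ?thesis by (rule continuous_on_eq) (simp add: primitive_eq_integral[OF assms])
qed

lemma primitive_deriv:
  assumes "continuous_on UNIV f"
  shows "(primitive f has_real_derivative f x) (at x)"
proof -
  let ?a = "- \<bar>x\<bar> - 1" and ?b = "\<bar>x\<bar> + 1"
  have "(primitive f has_real_derivative f x) (at x within {?a..?b})"
    by (rule primitive_deriv_within)
      (use assms in \<open>auto intro: integrable_continuous_real[OF continuous_on_subset[OF assms]]
         continuous_at_imp_continuous_within simp: continuous_on_eq_continuous_at\<close>)
  moreover have "at x within {?a..?b} = at x"
    by (rule at_within_interior) auto
  ultimately show ?thesis by simp
qed

lemma primitive_continuous_on:
  assumes "continuous_on UNIV f"
  shows "continuous_on S (primitive f)"
  using primitive_deriv[OF assms] by (meson DERIV_continuous continuous_at_imp_continuous_on)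

text \<open>Left of -1 the slope of the primitive is at most \<open>f (- 1) < 0\<close>, so it grows
  at least linearly towards minus infinity. \<open>M\<close> is the point where this linear gain
  equals \<open>\<bar>x\<bar> + \<bar>primitive f (- 1)\<bar>\<close>.\<close>

lemma primitive_unbounded_below:
  assumes f: "continuous_on UNIV f" and neg: "f (- 1) < 0" and le: "\<And>x. x \<le> - 1 \<Longrightarrow> f x \<le> f (- 1)"
  obtains M where "M > 0" "x \<le> primitive f (- M)"
proof -
  let ?c = "- f (- 1)" and ?F = "primitive f"
  have c: "?c > 0" using neg by simp
  define M where "M = 1 + (\<bar>x\<bar> + \<bar>?F (- 1)\<bar>) / ?c"
  have "0 \<le> (\<bar>x\<bar> + \<bar>?F (- 1)\<bar>) / ?c" using c by (intro divide_nonneg_pos) auto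
  then have M1: "1 \<le> M" unfolding M_def by linarith
  have "?c * (- 1 - (- M)) \<le> (\<lambda>x. - ?F x) (- 1) - (\<lambda>x. - ?F x) (- M)"
  proof (rule le_diff_of_deriv_ge[where f = "\<lambda>x. - ?F x" and f' = "\<lambda>x. - f x"])
    fix y assume "- M < y" "y < - 1"
    then have "f y \<le> f (- 1)" by (intro le) simp
    then show "?c \<le> - f y" by simp
  qed (use M1 in \<open>auto intro!: continuous_intros DERIV_minus primitive_deriv[OF f] primitive_continuous_on[OF f]\<close>)
  moreover have "?c * (- 1 - (- M)) = \<bar>x\<bar> + \<bar>?F (- 1)\<bar>" using c by (simp add: M_def)
  ultimately have "x \<le> ?F (- M)" by linarith
  moreover have "M > 0" using M1 by simp
  ultimately show thesis using that by blast
qed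

text \<open>The mean value inequality for \<open>f x - L * x\<close>. It supplies the one-sided
  derivatives of u and of the flux at r = 0, where the system itself says nothing.\<close>

lemma has_real_derivative_at_0_of_limit:
  fixes f :: "real \<Rightarrow> real"
  assumes cont: "continuous_on {0..T} f" and T: "T > 0"
    and deriv: "\<And>x. 0 < x \<Longrightarrow> x < T \<Longrightarrow> (f has_real_derivative f' x) (at x)"
    and lim: "(f' \<longlongrightarrow> L) (at_right 0)"
  shows "(f has_real_derivative L) (at 0 within {0..})"
  unfolding has_field_derivative_iff
proof (rule tendstoI)
  fix e :: real assume e: "e > 0"
  have "\<forall>\<^sub>F x in at_right 0. \<bar>f' x - L\<bar> < e / 2"
    using tendstoD[OF lim, of "e / 2"] e by (simp add: dist_real_def)
  then obtain b where b: "b > 0" "\<And>x. 0 < x \<Longrightarrow> x < b \<Longrightarrow> \<bar>f' x - L\<bar> < e / 2"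
    unfolding eventually_at_right_field by auto
  have "\<bar>(f y - f 0) / (y - 0) - L\<bar> < e" if y: "0 < y" "y < min b T" for y
  proof -
    have "\<bar>(\<lambda>x. f x - L * x) y - (\<lambda>x. f x - L * x) 0\<bar> \<le> e / 2 * (y - 0)"
    proof (rule abs_diff_le_of_deriv_le[where f' = "\<lambda>x. f' x - L"])
      fix x assume x: "0 < x" "x < y"
      show "((\<lambda>x. f x - L * x) has_real_derivative f' x - L) (at x)"
        using x y by (auto intro!: derivative_eq_intros deriv)
      show "\<bar>f' x - L\<bar> \<le> e / 2" using b(2)[of x] x y by simp
    qed (use y in \<open>auto intro!: continuous_intros continuous_on_subset[OF cont]\<close>)
    then have "\<bar>f y - L * y - f 0\<bar> \<le> e / 2 * y" by simp
    moreover have "(f y - f 0) / (y - 0) - L = (f y - L * y - f 0) / y" using y by (simp add: field_simps)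
    ultimately have "\<bar>(f y - f 0) / (y - 0) - L\<bar> \<le> e / 2" using y by (simp add: abs_divide field_simps)
    then show ?thesis using e by simp
  qed
  then show "\<forall>\<^sub>F y in at 0 within {0..}. dist ((f y - f 0) / (y - 0)) L < e"
    unfolding eventually_at dist_real_def using b(1) T by (intro exI[of _ "min b T"]) auto
qed

text \<open>Derivatives are taken only at y > 0. In the model case \<phi>(t) = t^(\<gamma>1 - 2) the
  function \<open>\<psi>\<close> is |y|^(p - 1) y, which is not differentiable at 0 for p < 1;
  negative arguments are reached by oddness.\<close>

locale flux_inverse =
  fixes \<psi> \<psi>' :: "real \<Rightarrow> real" and p :: real
  assumes psi_cont: "continuous_on UNIV \<psi>"
    and psi_odd: "\<psi> (- y) = - \<psi> y"
    and psi_strict_mono: "strict_mono \<psi>"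
    and psi_deriv: "y > 0 \<Longrightarrow> (\<psi> has_real_derivative \<psi>' y) (at y)"
    and psi'_le: "y > 0 \<Longrightarrow> y * \<psi>' y \<le> p * \<psi> y"
    and p_pos: "p > 0"
begin

abbreviation "G \<equiv> primitive \<psi>"

lemma psi_continuous_on [continuous_intros]:
  "continuous_on S g \<Longrightarrow> continuous_on S (\<lambda>x. \<psi> (g x))"
  using continuous_on_compose2[OF psi_cont] by blast

lemma psi_0 [simp]: "\<psi> 0 = 0"
  using psi_odd[of 0] by simp

lemma psi_less_iff [simp]: "\<psi> x < \<psi> y \<longleftrightarrow> x < y"
  by (rule strict_mono_less[OF psi_strict_mono])

lemma psi_le_iff [simp]: "\<psi> x \<le> \<psi> y \<longleftrightarrow> x \<le> y"
  by (rule strict_mono_less_eq[OF psi_strict_mono])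

lemma psi_pos_iff [simp]: "0 < \<psi> y \<longleftrightarrow> 0 < y"
  using psi_less_iff[of 0 y] by simp

lemma psi_neg_iff [simp]: "\<psi> y < 0 \<longleftrightarrow> y < 0"
  using psi_less_iff[of y 0] by simp

lemma psi_nonneg_iff [simp]: "0 \<le> \<psi> y \<longleftrightarrow> 0 \<le> y"
  using psi_le_iff[of 0 y] by simp

lemma psi_nonpos_iff [simp]: "\<psi> y \<le> 0 \<longleftrightarrow> y \<le> 0"
  using psi_le_iff[of y 0] by simp

lemma abs_psi: "\<bar>\<psi> y\<bar> = \<psi> \<bar>y\<bar>"
  using psi_odd[of y] by (cases "y \<ge> 0") (auto simp: not_le abs_of_nonneg abs_of_neg)

lemma abs_psi_le: "\<bar>y\<bar> \<le> Y \<Longrightarrow> \<bar>\<psi> y\<bar> \<le> \<psi> Y"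
  by (simp add: abs_psi)

lemma psi'_nonneg: "y > 0 \<Longrightarrow> \<psi>' y \<ge> 0"
proof -
  assume "y > 0"
  show ?thesis
  proof (rule ccontr)
    assume "\<not> 0 \<le> \<psi>' y"
    then obtain d where d: "d > 0" "\<And>h. 0 < h \<Longrightarrow> h < d \<Longrightarrow> \<psi> (y + h) < \<psi> y"
      using DERIV_neg_dec_right[OF psi_deriv[OF \<open>y > 0\<close>]] by force
    show False using d(2)[of "d/2"] d(1) by simp
  qed
qed

text \<open>The derivative at x is at most \<open>p * \<psi> x / x\<close>. The explicit factor
  \<open>1 / y0\<close> matters: near r = 0 it is balanced by a flux difference of the same order in
  r.\<close>

lemma psi_lipschitz:
  assumes "0 < y0" "y0 \<le> a" "y0 \<le> b" "a \<le> Y" "b \<le> Y"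
  shows "\<bar>\<psi> a - \<psi> b\<bar> \<le> p * \<psi> Y / y0 * \<bar>a - b\<bar>"
proof (rule lipschitz_of_deriv_le[where x = y0 and y = Y and f' = \<psi>'])
  fix x assume x: "y0 < x" "x < Y"
  then have x0: "x > 0" using assms by simp
  then show "(\<psi> has_real_derivative \<psi>' x) (at x)" by (rule psi_deriv)
  have "y0 * \<psi>' x \<le> x * \<psi>' x" using psi'_nonneg[OF x0] x by (intro mult_right_mono) auto
  also have "\<dots> \<le> p * \<psi> Y"
    using psi'_le[OF x0] mult_left_mono[of "\<psi> x" "\<psi> Y" p] p_pos x
    by (meson less_eq_real_def order_trans psi_le_iff)
  finally have "\<psi>' x \<le> p * \<psi> Y / y0" using assms by (simp add: field_simps)
  then show "\<bar>\<psi>' x\<bar> \<le> p * \<psi> Y / y0" using psi'_nonneg[OF x0] by simp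
qed (use assms in \<open>auto intro!: continuous_intros\<close>)

text \<open>By \<open>psi'_le\<close> the function \<open>x powr - p * \<psi> x\<close> is
  nonincreasing. This turns a lower bound of the flux by a multiple of f(u) into a lower bound of u'
  by a multiple of f(u)^p, the power that the primitive \<open>\<Psi>\<close> compensates.\<close>

lemma psi_lower:
  assumes "0 < y" "y \<le> Y"
  shows "\<psi> Y * (y / Y) powr p \<le> \<psi> y"
proof -
  let ?g = "\<lambda>x. x powr (-p) * \<psi> x"
  have "?g Y - ?g y \<le> 0 - 0"
  proof (rule diff_le_diff_of_deriv_le[where g' = "\<lambda>_. 0", OF assms(2)])
    fix x assume x: "y < x" "x < Y"
    then have x0: "x > 0" using assms by simp
    let ?d = "x powr (-p) * \<psi>' x + (-p) * x powr (-p - 1) * \<psi> x"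
    show "(?g has_real_derivative ?d) (at x)"
      using x0 by (auto intro!: derivative_eq_intros psi_deriv)
    have "?d = x powr (-p - 1) * (x * \<psi>' x - p * \<psi> x)"
      using x0 by (simp add: powr_diff field_simps)
    then show "?d \<le> 0" using psi'_le[OF x0] by (simp add: mult_nonneg_nonpos)
  qed (use assms in \<open>auto intro!: continuous_intros\<close>)
  then have "Y powr (-p) * \<psi> Y \<le> y powr (-p) * \<psi> y" by simp
  then have "y powr p * (Y powr (-p) * \<psi> Y) \<le> y powr p * (y powr (-p) * \<psi> y)"
    by (intro mult_left_mono) auto
  moreover have "y powr p * (y powr (-p) * \<psi> y) = \<psi> y"
    using assms by (simp add: powr_minus)
  ultimately show ?thesis using assms by (simp add: powr_divide powr_minus field_simps)
qed

section \<open>The primitive of the inverse flux\<close>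

lemma G_deriv: "(G has_real_derivative \<psi> y) (at y)"
  by (rule primitive_deriv[OF psi_cont])

lemma G_continuous_on [continuous_intros]:
  "continuous_on S g \<Longrightarrow> continuous_on S (\<lambda>x. G (g x))"
  using continuous_on_compose2[OF primitive_continuous_on[OF psi_cont, of UNIV]] by blast

lemma G_even: "G (- y) = G y"
proof -
  have *: "G (- y) = G y" if "y \<ge> 0" for y
  proof -
    have "\<bar>(G y - G (- y)) - (G 0 - G (- 0))\<bar> \<le> 0 * (y - 0)"
      by (rule abs_diff_le_of_deriv_le[where f' = "\<lambda>x. \<psi> x + \<psi> (- x)"])
        (use that in \<open>auto intro!: continuous_intros derivative_eq_intros DERIV_chain2[OF G_deriv] G_deriv simp: psi_odd\<close>)
    then show ?thesis by simp
  qed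
  show ?thesis using *[of y] *[of "- y"] by (cases "y \<ge> 0") auto
qed

lemma G_abs: "G \<bar>y\<bar> = G y"
  by (simp add: abs_if G_even)

lemma G_expanding_aux:
  assumes "0 \<le> y0" "y0 \<le> a" "a \<le> b"
  shows "\<psi> y0 * (b - a) \<le> G b - G a"
  by (rule le_diff_of_deriv_ge[where f' = \<psi>]) (use assms in \<open>auto intro!: continuous_intros G_deriv\<close>)

lemma G_expanding:
  assumes "0 \<le> y0" "y0 \<le> a" "y0 \<le> b"
  shows "\<psi> y0 * \<bar>a - b\<bar> \<le> \<bar>G a - G b\<bar>"
  using G_expanding_aux[of y0 a b] G_expanding_aux[of y0 b a] assms
  by (cases "a \<le> b") auto

lemma psi_lipschitz_same_sign:
  assumes "0 < y0" "y0 \<le> \<bar>a\<bar>" "y0 \<le> \<bar>b\<bar>" "\<bar>a\<bar> \<le> Y" "\<bar>b\<bar> \<le> Y" "0 < a * b"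
  shows "\<bar>\<psi> a - \<psi> b\<bar> \<le> p * \<psi> Y / y0 * \<bar>a - b\<bar>"
proof (cases "a > 0")
  case True
  then have "b > 0" using assms by (simp add: zero_less_mult_iff)
  then show ?thesis using True psi_lipschitz[of y0 a b Y] assms by simp
next
  case False
  then have "a < 0" "b < 0" using assms by (auto simp: zero_less_mult_iff)
  then show ?thesis using psi_lipschitz[of y0 "- a" "- b" Y] assms by (simp add: psi_odd abs_minus_commute)
qed

text \<open>Recovers a difference of fluxes from a difference of their energies. Equal signs are
  essential because \<open>G\<close> is even.\<close>

lemma G_expanding_same_sign:
  assumes "0 \<le> y0" "y0 \<le> \<bar>a\<bar>" "y0 \<le> \<bar>b\<bar>" "0 < a * b"
  shows "\<psi> y0 * \<bar>a - b\<bar> \<le> \<bar>G a - G b\<bar>"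
proof (cases "a > 0")
  case True
  then have "b > 0" using assms by (simp add: zero_less_mult_iff)
  then show ?thesis using True G_expanding[of y0 a b] assms by simp
next
  case False
  then have "a < 0" "b < 0" using assms by (auto simp: zero_less_mult_iff)
  then show ?thesis using G_expanding[of y0 "- a" "- b"] assms by (simp add: G_even abs_minus_commute)
qed

lemma G_pos: "y \<noteq> 0 \<Longrightarrow> 0 < G y"
proof -
  assume "y \<noteq> 0"
  have "G (\<bar>y\<bar>/2) \<ge> 0" using G_expanding_aux[of 0 0 "\<bar>y\<bar>/2"] by simp
  moreover have "\<psi> (\<bar>y\<bar>/2) * (\<bar>y\<bar>/2) \<le> G \<bar>y\<bar> - G (\<bar>y\<bar>/2)"
    using G_expanding_aux[of "\<bar>y\<bar>/2" "\<bar>y\<bar>/2" "\<bar>y\<bar>"] by simp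
  moreover have "0 < \<psi> (\<bar>y\<bar>/2) * (\<bar>y\<bar>/2)" using \<open>y \<noteq> 0\<close> by simp
  ultimately show ?thesis by (simp add: G_abs)
qed

lemma G_nonneg: "0 \<le> G y"
  using G_pos[of y] by (cases "y = 0") auto

lemma G_lipschitz:
  assumes "\<bar>a\<bar> \<le> Y" "\<bar>b\<bar> \<le> Y"
  shows "\<bar>G a - G b\<bar> \<le> \<psi> Y * \<bar>a - b\<bar>"
  by (rule lipschitz_of_deriv_le[where x = "- Y" and y = Y and f' = \<psi>])
    (use assms in \<open>auto intro!: continuous_intros G_deriv abs_psi_le\<close>)

lemma G_le: "G y \<le> \<bar>y\<bar> * \<psi> \<bar>y\<bar>"
  using G_lipschitz[of y "\<bar>y\<bar>" 0] by (simp add: mult.commute)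

lemma mult_psi_nonneg: "0 \<le> y * \<psi> y"
  by (cases "y \<ge> 0") (auto simp: mult_nonpos_nonpos)

lemma mult_psi_abs: "\<bar>y\<bar> * \<psi> \<bar>y\<bar> = y * \<psi> y"
  by (simp add: abs_if psi_odd)

lemma mult_psi_deriv:
  "y > 0 \<Longrightarrow> ((\<lambda>y. y * \<psi> y) has_real_derivative \<psi> y + y * \<psi>' y) (at y)"
  by (auto intro!: derivative_eq_intros psi_deriv)

text \<open>The integrated form of \<open>psi'_le\<close>, with equality when \<open>\<psi>\<close>
  is a pure power on y > 0: the derivative of \<open>y * \<psi> y\<close> is at most
  \<open>(1 + p) * \<psi> y\<close>.\<close>

lemma mult_psi_le_G: "y * \<psi> y \<le> (1 + p) * G y"
proof -
  have "\<bar>y\<bar> * \<psi> \<bar>y\<bar> - 0 * \<psi> 0 \<le> (1 + p) * G \<bar>y\<bar> - (1 + p) * G 0"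
  proof (rule diff_le_diff_of_deriv_le[where f' = "\<lambda>y. \<psi> y + y * \<psi>' y" and g' = "\<lambda>y. (1 + p) * \<psi> y"])
    fix x assume "0 < x" "x < \<bar>y\<bar>"
    then show "\<psi> x + x * \<psi>' x \<le> (1 + p) * \<psi> x" using psi'_le[of x] by (simp add: algebra_simps)
    show "((\<lambda>y. y * \<psi> y) has_real_derivative \<psi> x + x * \<psi>' x) (at x)"
      using \<open>0 < x\<close> by (rule mult_psi_deriv)
  qed (auto intro!: continuous_intros derivative_eq_intros G_deriv)
  then show ?thesis by (simp add: G_abs mult_psi_abs)
qed

text \<open>Unlike \<open>\<psi>\<close> itself, \<open>y * \<psi> y\<close> is Lipschitz up to y =
  0, since \<open>y * \<psi>' y\<close> stays bounded by \<open>p * \<psi> y\<close>.\<close>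

lemma mult_psi_lipschitz:
  assumes "\<bar>a\<bar> \<le> Y" "\<bar>b\<bar> \<le> Y"
  shows "\<bar>a * \<psi> a - b * \<psi> b\<bar> \<le> (1 + p) * \<psi> Y * \<bar>a - b\<bar>"
proof -
  have "\<bar>\<bar>a\<bar> * \<psi> \<bar>a\<bar> - \<bar>b\<bar> * \<psi> \<bar>b\<bar>\<bar> \<le> (1 + p) * \<psi> Y * \<bar>\<bar>a\<bar> - \<bar>b\<bar>\<bar>"
  proof (rule lipschitz_of_deriv_le[where f = "\<lambda>y. y * \<psi> y" and x = 0 and y = Y and f' = "\<lambda>y. \<psi> y + y * \<psi>' y"])
    fix x assume x: "0 < x" "x < Y"
    show "((\<lambda>y. y * \<psi> y) has_real_derivative \<psi> x + x * \<psi>' x) (at x)"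
      using x(1) by (rule mult_psi_deriv)
    have "\<psi> x + x * \<psi>' x \<le> (1 + p) * \<psi> x" using psi'_le[OF x(1)] by (simp add: algebra_simps)
    also have "\<dots> \<le> (1 + p) * \<psi> Y" using x p_pos by (intro mult_left_mono) auto
    finally show "\<bar>\<psi> x + x * \<psi>' x\<bar> \<le> (1 + p) * \<psi> Y"
      using psi'_nonneg[OF x(1)] x by (simp add: abs_of_nonneg)
  qed (use assms in \<open>auto intro!: continuous_intros\<close>)
  also have "\<dots> \<le> (1 + p) * \<psi> Y * \<bar>a - b\<bar>"
  proof (rule mult_left_mono)
    show "0 \<le> (1 + p) * \<psi> Y" using assms p_pos by simp
  qed linarith
  finally show ?thesis by (simp add: mult_psi_abs)
qed

end

section \<open>The energy\<close>

locale ivp_system = flux_inverse \<psi> \<psi>' p for \<psi> \<psi>' :: "real \<Rightarrow> real" and p :: real +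
  fixes f :: "real \<Rightarrow> real" and \<alpha> \<gamma> lam :: real
  assumes f_cont: "continuous_on UNIV f"
    and f_sign: "x \<noteq> 0 \<Longrightarrow> x * f x > 0"
    and f_locally_lipschitz: "x \<noteq> 0 \<Longrightarrow>
      \<exists>L e. e > 0 \<and> (\<forall>y z. \<bar>y - x\<bar> \<le> e \<longrightarrow> \<bar>z - x\<bar> \<le> e \<longrightarrow> \<bar>f y - f z\<bar> \<le> L * \<bar>y - z\<bar>)"
    and lam_pos: "lam > 0"
    and alpha_le: "\<alpha> \<le> \<gamma>"
    and minus_alpha_le: "- \<alpha> * p \<le> \<gamma>"
begin

abbreviation rflux :: "(real \<Rightarrow> real) \<Rightarrow> real \<Rightarrow> real" where
  "rflux w r \<equiv> r powr - \<alpha> * w r"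

text \<open>With the forcing \<open>q\<close> as a parameter, one predicate covers the equation
  itself, Tonelli's delayed equation and the equation driven by a limit function. Derivatives are
  asked only inside (0, T); at the ends continuity takes their place.\<close>

definition forced :: "real \<Rightarrow> real \<Rightarrow> (real \<Rightarrow> real) \<Rightarrow> (real \<Rightarrow> real) \<Rightarrow> (real \<Rightarrow> real) \<Rightarrow> bool" where
  "forced T d q u w \<longleftrightarrow> continuous_on {0..T} u \<and> continuous_on {0..T} w \<and> u 0 = d \<and> w 0 = 0 \<and>
     (\<forall>r. 0 < r \<and> r < T \<longrightarrow>
        (u has_real_derivative \<psi> (rflux w r)) (at r) \<and>
        (w has_real_derivative - (lam * r powr \<gamma> * q r)) (at r))"

abbreviation sol :: "real \<Rightarrow> real \<Rightarrow> (real \<Rightarrow> real) \<Rightarrow> (real \<Rightarrow> real) \<Rightarrow> bool" where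
  "sol T d u w \<equiv> forced T d (\<lambda>r. f (u r)) u w"

abbreviation "F \<equiv> primitive f"

lemma gamma_nonneg: "0 \<le> \<gamma>"
proof (cases "\<alpha> \<ge> 0")
  case True then show ?thesis using alpha_le by simp
next
  case False
  then have "0 \<le> - \<alpha> * p" using p_pos by (simp add: mult_nonpos_nonneg)
  then show ?thesis using minus_alpha_le by simp
qed

lemma f_continuous_on [continuous_intros]:
  "continuous_on S g \<Longrightarrow> continuous_on S (\<lambda>x. f (g x))"
  using continuous_on_compose2[OF f_cont] by blast

lemma F_deriv: "(F has_real_derivative f y) (at y)"
  by (rule primitive_deriv[OF f_cont])

lemma F_continuous_on [continuous_intros]:
  "continuous_on S g \<Longrightarrow> continuous_on S (\<lambda>x. F (g x))"
  using continuous_on_compose2[OF primitive_continuous_on[OF f_cont, of UNIV]] by blast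

lemma f_pos: "x > 0 \<Longrightarrow> f x > 0"
  using f_sign[of x] by (simp add: zero_less_mult_iff)

lemma f_neg: "x < 0 \<Longrightarrow> f x < 0"
  using f_sign[of x] by (simp add: zero_less_mult_iff)

lemma F_strict_mono: "0 \<le> x \<Longrightarrow> x < y \<Longrightarrow> F x < F y"
  by (rule DERIV_pos_imp_increasing_open)
    (auto intro!: continuous_intros exI[of _ "f _"] F_deriv f_pos)

lemma F_strict_antimono: "y \<le> 0 \<Longrightarrow> x < y \<Longrightarrow> F y < F x"
  by (rule DERIV_neg_imp_decreasing_open)
    (auto intro!: continuous_intros exI[of _ "f _"] F_deriv f_neg)

lemma F_pos: "x \<noteq> 0 \<Longrightarrow> F x > 0"
  using F_strict_mono[of 0 x] F_strict_antimono[of 0 x] by (cases "x > 0") auto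

lemma F_nonneg: "F x \<ge> 0"
  using F_pos[of x] by (cases "x = 0") auto

section \<open>The system with a prescribed forcing\<close>

lemma forcedD:
  assumes "forced T d q u w"
  shows "continuous_on {0..T} u" "continuous_on {0..T} w" "u 0 = d" "w 0 = 0"
    "\<And>r. 0 < r \<Longrightarrow> r < T \<Longrightarrow> (u has_real_derivative \<psi> (rflux w r)) (at r)"
    "\<And>r. 0 < r \<Longrightarrow> r < T \<Longrightarrow> (w has_real_derivative - (lam * r powr \<gamma> * q r)) (at r)"
  using assms by (auto simp: forced_def)

lemma forced_cont:
  assumes "forced T d q u w" "0 \<le> a" "b \<le> T"
  shows "continuous_on {a..b} u" "continuous_on {a..b} w"
  using continuous_on_subset[OF forcedD(1)[OF assms(1)], of "{a..b}"]
    continuous_on_subset[OF forcedD(2)[OF assms(1)], of "{a..b}"] assms(2,3) by auto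

lemma forced_subinterval: "forced T d q u w \<Longrightarrow> S \<le> T \<Longrightarrow> forced S d q u w"
  unfolding forced_def by (auto intro: continuous_on_subset)

lemma forced_cong_forcing:
  "forced T d q u w \<Longrightarrow> (\<And>r. 0 < r \<Longrightarrow> r < T \<Longrightarrow> q r = q' r) \<Longrightarrow> forced T d q' u w"
  unfolding forced_def by auto

text \<open>Integrate the equation of w. Since \<open>\<alpha> \<le> \<gamma>\<close>, the exponent
  \<open>\<gamma> + 1 - \<alpha>\<close> is at least 1, so the second bound vanishes at 0 even where
  \<open>r powr - \<alpha>\<close> blows up.\<close>

lemma flux_diff_le:
  assumes w1: "continuous_on {0..T} w1" "w1 0 = 0"
      "\<And>r. 0 < r \<Longrightarrow> r < T \<Longrightarrow> (w1 has_real_derivative - (lam * r powr \<gamma> * q1 r)) (at r)"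
    and w2: "continuous_on {0..T} w2" "w2 0 = 0"
      "\<And>r. 0 < r \<Longrightarrow> r < T \<Longrightarrow> (w2 has_real_derivative - (lam * r powr \<gamma> * q2 r)) (at r)"
    and q: "\<And>r. 0 < r \<Longrightarrow> r < T \<Longrightarrow> \<bar>q1 r - q2 r\<bar> \<le> D"
    and r: "0 \<le> r" "r \<le> T"
  shows "\<bar>w1 r - w2 r\<bar> \<le> lam * D * (r powr (\<gamma> + 1) / (\<gamma> + 1))"
    and "\<bar>rflux w1 r - rflux w2 r\<bar> \<le> lam * D * (r powr (\<gamma> + 1 - \<alpha>) / (\<gamma> + 1))"
proof -
  have "\<bar>(\<lambda>r. w1 r - w2 r) r - (\<lambda>r. w1 r - w2 r) 0\<bar>
     \<le> lam * D * (r powr (\<gamma> + 1) / (\<gamma> + 1)) - lam * D * (0 powr (\<gamma> + 1) / (\<gamma> + 1))"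
  proof (rule abs_diff_le_diff_of_deriv_le[where f' = "\<lambda>r. - (lam * r powr \<gamma> * (q1 r - q2 r))"
        and g' = "\<lambda>r. lam * D * r powr \<gamma>"])
    show "continuous_on {0..r} (\<lambda>x. lam * D * (x powr (\<gamma> + 1) / (\<gamma> + 1)))"
      using gamma_nonneg by (intro continuous_intros continuous_on_powr_nonneg) auto
    show "continuous_on {0..r} (\<lambda>r. w1 r - w2 r)"
      using r by (auto intro!: continuous_intros continuous_on_subset[OF w1(1)] continuous_on_subset[OF w2(1)])
    fix x assume x: "0 < x" "x < r"
    show "((\<lambda>r. w1 r - w2 r) has_real_derivative - (lam * x powr \<gamma> * (q1 x - q2 x))) (at x)"
      using w1(3)[of x] w2(3)[of x] x r by (auto intro!: derivative_eq_intros simp: algebra_simps)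
    show "((\<lambda>x. lam * D * (x powr (\<gamma> + 1) / (\<gamma> + 1))) has_real_derivative lam * D * x powr \<gamma>) (at x)"
      by (rule DERIV_cmult[OF powr_Suc_div_deriv]) (use x gamma_nonneg in auto)
    have "lam * x powr \<gamma> * \<bar>q1 x - q2 x\<bar> \<le> lam * x powr \<gamma> * D"
      using q[of x] x r lam_pos by (intro mult_left_mono) auto
    then show "\<bar>- (lam * x powr \<gamma> * (q1 x - q2 x))\<bar> \<le> lam * D * x powr \<gamma>"
      using lam_pos by (simp add: abs_mult mult.commute mult.left_commute)
  qed (use r in auto)
  then show *: "\<bar>w1 r - w2 r\<bar> \<le> lam * D * (r powr (\<gamma> + 1) / (\<gamma> + 1))"
    using w1 w2 by simp
  have "\<bar>rflux w1 r - rflux w2 r\<bar> = r powr - \<alpha> * \<bar>w1 r - w2 r\<bar>"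
    by (simp add: abs_mult flip: right_diff_distrib)
  also have "\<dots> \<le> r powr - \<alpha> * (lam * D * (r powr (\<gamma> + 1) / (\<gamma> + 1)))"
    by (rule mult_left_mono[OF *]) simp
  also have "\<dots> = lam * D * (r powr (\<gamma> + 1 - \<alpha>) / (\<gamma> + 1))"
    by (simp add: powr_diff powr_minus field_simps)
  finally show "\<bar>rflux w1 r - rflux w2 r\<bar> \<le> lam * D * (r powr (\<gamma> + 1 - \<alpha>) / (\<gamma> + 1))" .
qed

lemma flux_le:
  assumes w1: "continuous_on {0..T} w" "w 0 = 0"
      "\<And>r. 0 < r \<Longrightarrow> r < T \<Longrightarrow> (w has_real_derivative - (lam * r powr \<gamma> * q r)) (at r)"
    and q: "\<And>r. 0 < r \<Longrightarrow> r < T \<Longrightarrow> \<bar>q r\<bar> \<le> B"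
    and r: "0 \<le> r" "r \<le> T"
  shows "\<bar>w r\<bar> \<le> lam * B * (r powr (\<gamma> + 1) / (\<gamma> + 1))"
    and "\<bar>rflux w r\<bar> \<le> lam * B * (r powr (\<gamma> + 1 - \<alpha>) / (\<gamma> + 1))"
  using flux_diff_le[of T w q "\<lambda>_. 0" "\<lambda>_. 0" B r] assms by auto

text \<open>The size of y at time \<open>T\<close> under the constant forcing \<open>B\<close>. It
  serves as an upper bound for a forcing of modulus at most \<open>B\<close>, as a lower bound of -y
  for a forcing at least \<open>B\<close>, and as a bound for differences; linearity in
  \<open>B\<close> makes quotients of two such bounds independent of time.\<close>

definition ymax :: "real \<Rightarrow> real \<Rightarrow> real" where
  "ymax B T = lam * B * (T powr (\<gamma> + 1 - \<alpha>) / (\<gamma> + 1))"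

lemma ymax_mono: "0 \<le> B \<Longrightarrow> 0 \<le> r \<Longrightarrow> r \<le> T \<Longrightarrow> ymax B r \<le> ymax B T"
  unfolding ymax_def using lam_pos gamma_nonneg alpha_le
  by (intro mult_left_mono divide_right_mono powr_mono2) auto

lemma forced_y_le:
  assumes "forced T d q u w" "\<And>r. 0 < r \<Longrightarrow> r < T \<Longrightarrow> \<bar>q r\<bar> \<le> B" "0 \<le> r" "r \<le> T" "0 \<le> B"
  shows "\<bar>rflux w r\<bar> \<le> ymax B r" "\<bar>rflux w r\<bar> \<le> ymax B T"
proof -
  show *: "\<bar>rflux w r\<bar> \<le> ymax B r"
    unfolding ymax_def by (rule flux_le(2)[of T _ q]) (use assms forcedD[OF assms(1)] in auto)
  show "\<bar>rflux w r\<bar> \<le> ymax B T" using * ymax_mono[of B r T] assms by simp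
qed

lemma forced_lipschitz:
  assumes "forced T d q u w" "\<And>r. 0 < r \<Longrightarrow> r < T \<Longrightarrow> \<bar>q r\<bar> \<le> B" "0 \<le> B"
    and "r \<in> {0..T}" "s \<in> {0..T}"
  shows "\<bar>u r - u s\<bar> \<le> \<psi> (ymax B T) * \<bar>r - s\<bar>"
  by (rule lipschitz_of_deriv_le[OF assms(4,5) forcedD(1,5)[OF assms(1)] abs_psi_le])
    (auto intro!: forced_y_le(2)[OF assms(1,2) _ _ assms(3)])

text \<open>With a prescribed forcing the system is triangular: q determines w, and then w
  determines u.\<close>

lemma forced_unique:
  assumes 1: "forced T d q u1 w1" and 2: "forced T d q u2 w2" and r: "0 \<le> r" "r \<le> T"
  shows "w1 r = w2 r" "u1 r = u2 r"
proof -
  have w: "w1 r = w2 r" if "0 \<le> r" "r \<le> T" for r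
  proof -
    have "\<bar>w1 r - w2 r\<bar> \<le> lam * 0 * (r powr (\<gamma> + 1) / (\<gamma> + 1))"
      by (rule flux_diff_le(1)[of T w1 q w2 q]) (use forcedD[OF 1] forcedD[OF 2] that in auto)
    then show ?thesis by simp
  qed
  show "w1 r = w2 r" by (rule w[OF r])
  have "\<bar>(\<lambda>r. u1 r - u2 r) r - (\<lambda>r. u1 r - u2 r) 0\<bar> \<le> 0 * (r - 0)"
  proof (rule abs_diff_le_of_deriv_le[where f' = "\<lambda>_. 0"])
    fix x assume x: "0 < x" "x < r"
    show "((\<lambda>r. u1 r - u2 r) has_real_derivative 0) (at x)"
      using forcedD(5)[OF 1, of x] forcedD(5)[OF 2, of x] w[of x] x r
      by (auto intro!: derivative_eq_intros)
  qed (use r in \<open>auto intro!: continuous_intros forced_cont(1)[OF 1] forced_cont(1)[OF 2]\<close>)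
  then show "u1 r = u2 r" using forcedD(3)[OF 1] forcedD(3)[OF 2] by simp
qed

lemma y_continuous_on:
  assumes w_cont: "continuous_on {0..T} w" and w0: "w 0 = 0"
    and w_deriv: "\<And>r. 0 < r \<Longrightarrow> r < T \<Longrightarrow> (w has_real_derivative - (lam * r powr \<gamma> * q r)) (at r)"
    and B: "\<And>r. 0 < r \<Longrightarrow> r < T \<Longrightarrow> \<bar>q r\<bar> \<le> B" and T: "T > 0"
  shows "continuous_on {0..T} (rflux w)"
  unfolding continuous_on_eq_continuous_within
proof
  let ?y = "rflux w"
  have y_le: "\<bar>?y r\<bar> \<le> lam * B * (r powr (\<gamma> + 1 - \<alpha>) / (\<gamma> + 1))" if "r \<in> {0..T}" for r
    by (rule flux_le(2)[OF w_cont w0 w_deriv]) (use that B in auto)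
  fix r assume r: "r \<in> {0..T}"
  show "continuous (at r within {0..T}) ?y"
  proof (cases "r = 0")
    case True
    have "((\<lambda>r. lam * B * (r powr (\<gamma> + 1 - \<alpha>) / (\<gamma> + 1))) \<longlongrightarrow> lam * B * (0 powr (\<gamma> + 1 - \<alpha>) / (\<gamma> + 1))) (at 0 within {0..T})"
      using continuous_on_powr_nonneg[of "\<gamma> + 1 - \<alpha>" "{0..T}"] alpha_le gamma_nonneg T
      by (intro tendsto_mult tendsto_divide tendsto_const) (force simp: continuous_on_def)+
    then have "((\<lambda>r. lam * B * (r powr (\<gamma> + 1 - \<alpha>) / (\<gamma> + 1))) \<longlongrightarrow> 0) (at 0 within {0..T})" by simp
    then have "(?y \<longlongrightarrow> 0) (at 0 within {0..T})"
      by (rule Lim_null_comparison[rotated]) (use y_le in \<open>auto simp: eventually_at_filter\<close>)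
    then show ?thesis using True by (simp add: continuous_within w0)
  next
    case False
    then show ?thesis
      using r w_cont by (intro continuous_intros) (auto simp: continuous_on_eq_continuous_within)
  qed
qed

lemma forced_exists:
  assumes q: "continuous_on {0..T} q" and T: "T > 0"
  shows "\<exists>u w. forced T d q u w"
proof -
  \<comment> \<open>The value \<open>0 powr 0 = 0\<close> would make the integrand jump at 0 when
    \<open>\<gamma> = 0\<close>; \<open>\<omega>\<close> is the continuous version of the
    power.\<close>
  define \<omega> where "\<omega> = (\<lambda>r::real. if \<gamma> = 0 then 1 else r powr \<gamma>)"
  have om: "\<omega> r = r powr \<gamma>" if "r > 0" for r using that by (auto simp: \<omega>_def)
  have om_cont: "continuous_on {0..T} \<omega>"
    using gamma_nonneg unfolding \<omega>_def
    by (cases "\<gamma> = 0") (auto intro!: continuous_on_powr_nonneg)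
  define w where "w = (\<lambda>r. integral {0..r} (\<lambda>s. - (lam * \<omega> s * q s)))"
  have w: "(w has_real_derivative - (lam * \<omega> r * q r)) (at r within {0..T})" if "r \<in> {0..T}" for r
    unfolding w_def by (rule integral_has_real_derivative) (use that q om_cont in \<open>auto intro!: continuous_intros\<close>)
  have w_cont: "continuous_on {0..T} w"
    by (rule DERIV_continuous_on[OF w])
  have w_deriv: "(w has_real_derivative - (lam * r powr \<gamma> * q r)) (at r)" if "0 < r" "r < T" for r
    using w[of r] that om[of r] by (simp add: at_within_Icc_at)
  have w0: "w 0 = 0" by (simp add: w_def)
  obtain B where B: "B \<ge> 0" "\<And>r. r \<in> {0..T} \<Longrightarrow> \<bar>q r\<bar> \<le> B"
  proof -
    have "bounded (q ` {0..T})" by (rule compact_imp_bounded[OF compact_continuous_image[OF q]]) simp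
    then obtain B where "\<forall>r\<in>{0..T}. \<bar>q r\<bar> \<le> B" by (auto simp: bounded_iff)
    then show thesis using that[of "max B 0"] by force
  qed
  let ?y = "rflux w"
  have y_cont: "continuous_on {0..T} ?y"
    by (rule y_continuous_on[OF w_cont w0 w_deriv, where B = B]) (use B T in auto)
  define u where "u = (\<lambda>r. d + integral {0..r} (\<lambda>s. \<psi> (?y s)))"
  have u: "(u has_real_derivative \<psi> (?y r)) (at r within {0..T})" if "r \<in> {0..T}" for r
    unfolding u_def
    by (auto intro!: derivative_eq_intros integral_has_real_derivative that continuous_intros y_cont)
  have "forced T d q u w"
    unfolding forced_def
  proof (intro conjI allI impI)
    show "continuous_on {0..T} u" by (rule DERIV_continuous_on[OF u])
    show "u 0 = d" by (simp add: u_def)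
    fix r assume r: "0 < r \<and> r < T"
    show "(u has_real_derivative \<psi> (?y r)) (at r)"
      using u[of r] r by (simp add: at_within_Icc_at)
    show "(w has_real_derivative - (lam * r powr \<gamma> * q r)) (at r)" using w_deriv r by blast
  qed (use w_cont w0 in auto)
  then show ?thesis by blast
qed

text \<open>The number \<open>\<delta>\<close> is uniform over all forcings bounded by
  \<open>B\<close>, as needed for sequences of solutions. No rate is available, because
  \<open>\<psi>\<close> is only uniformly continuous near 0.\<close>

lemma forced_close:
  assumes B: "0 \<le> B" and T: "T > 0" and e: "e > 0"
  shows "\<exists>\<delta>>0. \<forall>d1 d2 q1 q2 u1 w1 u2 w2.
    forced T d1 q1 u1 w1 \<longrightarrow> forced T d2 q2 u2 w2 \<longrightarrow>
    (\<forall>r. 0 < r \<and> r < T \<longrightarrow> \<bar>q1 r\<bar> \<le> B \<and> \<bar>q2 r\<bar> \<le> B \<and> \<bar>q1 r - q2 r\<bar> \<le> \<delta>) \<longrightarrow>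
    (\<forall>r\<in>{0..T}. \<bar>u1 r - u2 r\<bar> \<le> \<bar>d1 - d2\<bar> + e \<and> \<bar>w1 r - w2 r\<bar> \<le> e)"
proof -
  let ?Y = "ymax B T"
  have "uniformly_continuous_on {- ?Y .. ?Y} \<psi>"
    by (rule compact_uniformly_continuous) (auto intro: continuous_on_subset[OF psi_cont])
  then obtain \<eta> where eta: "\<eta> > 0"
    "\<And>y z. y \<in> {- ?Y .. ?Y} \<Longrightarrow> z \<in> {- ?Y .. ?Y} \<Longrightarrow> \<bar>z - y\<bar> < \<eta> \<Longrightarrow> \<bar>\<psi> z - \<psi> y\<bar> < e / T"
    using e T unfolding uniformly_continuous_on_def dist_real_def
    by (metis (no_types, lifting) divide_pos_pos)
  define A where "A = T powr (\<gamma> + 1 - \<alpha>) / (\<gamma> + 1) + T powr (\<gamma> + 1) / (\<gamma> + 1) + 1"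
  have A: "A > 0" "T powr (\<gamma> + 1 - \<alpha>) / (\<gamma> + 1) \<le> A" "T powr (\<gamma> + 1) / (\<gamma> + 1) \<le> A"
    using gamma_nonneg unfolding A_def by (auto simp: add_pos_nonneg add_nonneg_pos)
  \<comment> \<open>\<open>A\<close> dominates both powers of T from \<open>flux_diff_le\<close>.
    The fluxes y then differ by less than \<open>\<eta>\<close>, so the slopes of u differ by less
    than \<open>e / T\<close>, and w changes by at most \<open>e\<close>.\<close>
  define \<delta> where "\<delta> = min \<eta> e / (2 * lam * A)"
  have d: "\<delta> > 0" "lam * \<delta> * A < \<eta>" "lam * \<delta> * A \<le> e"
    using eta(1) e A lam_pos by (auto simp: \<delta>_def field_simps)
  show ?thesis
  proof (intro exI[of _ \<delta>] conjI allI impI ballI)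
    fix d1 d2 q1 q2 u1 w1 u2 w2 r
    assume 1: "forced T d1 q1 u1 w1" and 2: "forced T d2 q2 u2 w2"
      and q: "\<forall>r. 0 < r \<and> r < T \<longrightarrow> \<bar>q1 r\<bar> \<le> B \<and> \<bar>q2 r\<bar> \<le> B \<and> \<bar>q1 r - q2 r\<bar> \<le> \<delta>"
      and r: "r \<in> {0..T}"
    have w: "\<bar>w1 r - w2 r\<bar> \<le> lam * \<delta> * (r powr (\<gamma> + 1) / (\<gamma> + 1))"
      and y: "\<bar>rflux w1 r - rflux w2 r\<bar> \<le> lam * \<delta> * (r powr (\<gamma> + 1 - \<alpha>) / (\<gamma> + 1))"
      if "r \<in> {0..T}" for r
      using flux_diff_le[of T w1 q1 w2 q2 \<delta> r] forcedD[OF 1] forcedD[OF 2] q that by auto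
    have mono: "r powr b / (\<gamma> + 1) \<le> T powr b / (\<gamma> + 1)" if "r \<in> {0..T}" "b \<ge> 0" for r b
      using that gamma_nonneg by (intro divide_right_mono powr_mono2) auto
    have "lam * \<delta> * (r powr (\<gamma> + 1) / (\<gamma> + 1)) \<le> lam * \<delta> * A"
      using A mono[OF r, of "\<gamma> + 1"] gamma_nonneg lam_pos d by (intro mult_left_mono) auto
    then show "\<bar>w1 r - w2 r\<bar> \<le> e" using w[OF r] d by simp
    have "\<bar>(\<lambda>r. u1 r - u2 r) r - (\<lambda>r. u1 r - u2 r) 0\<bar> \<le> e / T * (r - 0)"
    proof (rule abs_diff_le_of_deriv_le[where f' = "\<lambda>x. \<psi> (rflux w1 x) - \<psi> (rflux w2 x)"])
      fix x assume x: "0 < x" "x < r"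
      show "((\<lambda>r. u1 r - u2 r) has_real_derivative \<psi> (rflux w1 x) - \<psi> (rflux w2 x)) (at x)"
        using forcedD(5)[OF 1, of x] forcedD(5)[OF 2, of x] x r by (auto intro!: derivative_eq_intros)
      have "lam * \<delta> * (x powr (\<gamma> + 1 - \<alpha>) / (\<gamma> + 1)) \<le> lam * \<delta> * A"
        using A mono[of x "\<gamma> + 1 - \<alpha>"] gamma_nonneg alpha_le lam_pos d x r by (intro mult_left_mono) auto
      then have "\<bar>rflux w1 x - rflux w2 x\<bar> < \<eta>"
        using y[of x] x r d by auto
      moreover have "\<bar>rflux w1 x\<bar> \<le> ?Y" "\<bar>rflux w2 x\<bar> \<le> ?Y"
        using forced_y_le(2)[OF 1, of B x] forced_y_le(2)[OF 2, of B x] q x r B by auto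
      ultimately have "\<bar>\<psi> (rflux w1 x) - \<psi> (rflux w2 x)\<bar> < e / T"
        by (intro eta(2)) (auto simp: abs_le_iff)
      then show "\<bar>\<psi> (rflux w1 x) - \<psi> (rflux w2 x)\<bar> \<le> e / T" by simp
    qed (use r in \<open>auto intro!: continuous_intros forced_cont(1)[OF 1] forced_cont(1)[OF 2]\<close>)
    moreover have "e / T * r \<le> e" using r e T by (simp add: field_simps)
    ultimately show "\<bar>u1 r - u2 r\<bar> \<le> \<bar>d1 - d2\<bar> + e"
      using forcedD(3)[OF 1] forcedD(3)[OF 2] by simp
  qed (fact d(1))
qed

text \<open>The argument \<open>v\<close> stands for the flux w. The power of r is the inverse of
  the factor \<open>r powr (\<gamma> - \<alpha>)\<close> with which f enters the equation of
  y.\<close>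

definition energy :: "real \<Rightarrow> real \<Rightarrow> real \<Rightarrow> real" where
  "energy r x v = lam * F x + r powr (\<alpha> - \<gamma>) * G (r powr - \<alpha> * v)"

text \<open>The derivative of the energy along a solution, stripped of its factor
  \<open>r powr (\<alpha> - \<gamma> - 1)\<close>.\<close>

definition decay :: "real \<Rightarrow> real" where
  "decay y = (\<alpha> - \<gamma>) * G y - \<alpha> * (y * \<psi> y)"

definition "decay_const = \<gamma> - \<alpha> + \<bar>\<alpha>\<bar> * (1 + p)"

lemma decay_const_nonneg: "0 \<le> decay_const"
  unfolding decay_const_def using alpha_le p_pos by simp

text \<open>For \<open>\<alpha> \<ge> 0\<close> both terms have the right sign by
  \<open>\<alpha> \<le> \<gamma>\<close>. For \<open>\<alpha> < 0\<close> the second term is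
  positive; \<open>mult_psi_le_G\<close> bounds the sum by
  \<open>(- \<alpha> * p - \<gamma>) * G y\<close>, which is where the other lower bound on
  \<open>\<gamma>\<close> enters.\<close>

lemma decay_nonpos: "decay y \<le> 0"
proof (cases "\<alpha> \<ge> 0")
  case True
  have "(\<alpha> - \<gamma>) * G y \<le> 0" "0 \<le> \<alpha> * (y * \<psi> y)"
    using alpha_le G_nonneg[of y] mult_psi_nonneg[of y] True by (auto intro: mult_nonpos_nonneg)
  then show ?thesis unfolding decay_def by linarith
next
  case False
  have "- \<alpha> * (y * \<psi> y) \<le> - \<alpha> * ((1 + p) * G y)"
    using False mult_psi_le_G[of y] by (intro mult_left_mono) auto
  moreover have "(- \<alpha> * p - \<gamma>) * G y \<le> 0"
    using minus_alpha_le G_nonneg[of y] by (intro mult_nonpos_nonneg) auto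
  ultimately show ?thesis unfolding decay_def by (simp add: algebra_simps)
qed

lemma decay_ge: "- decay_const * G y \<le> decay y"
proof -
  have "\<alpha> * (y * \<psi> y) \<le> \<bar>\<alpha>\<bar> * (y * \<psi> y)" using mult_psi_nonneg[of y] by (intro mult_right_mono) auto
  also have "\<dots> \<le> \<bar>\<alpha>\<bar> * ((1 + p) * G y)" using mult_psi_le_G[of y] by (intro mult_left_mono) auto
  finally show ?thesis unfolding decay_def decay_const_def by (simp add: algebra_simps)
qed

text \<open>Valid up to y = 0, in contrast to \<open>\<psi>\<close>. This is what allows the energy
  to serve as an unknown in Gronwall's inequality.\<close>

lemma decay_lipschitz:
  assumes "\<bar>a\<bar> \<le> Y" "\<bar>b\<bar> \<le> Y"
  shows "\<bar>decay a - decay b\<bar> \<le> decay_const * \<psi> Y * \<bar>a - b\<bar>"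
proof -
  have "decay a - decay b = (\<alpha> - \<gamma>) * (G a - G b) - \<alpha> * (a * \<psi> a - b * \<psi> b)"
    unfolding decay_def by (simp add: algebra_simps)
  also have "\<bar>\<dots>\<bar> \<le> \<bar>(\<alpha> - \<gamma>) * (G a - G b)\<bar> + \<bar>\<alpha> * (a * \<psi> a - b * \<psi> b)\<bar>" by (rule abs_triangle_ineq4)
  also have "\<dots> = (\<gamma> - \<alpha>) * \<bar>G a - G b\<bar> + \<bar>\<alpha>\<bar> * \<bar>a * \<psi> a - b * \<psi> b\<bar>" using alpha_le by (simp add: abs_mult)
  also have "\<dots> \<le> (\<gamma> - \<alpha>) * (\<psi> Y * \<bar>a - b\<bar>) + \<bar>\<alpha>\<bar> * ((1 + p) * \<psi> Y * \<bar>a - b\<bar>)"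
    using G_lipschitz[OF assms] mult_psi_lipschitz[OF assms] alpha_le by (intro add_mono mult_left_mono) auto
  finally show ?thesis unfolding decay_const_def by (simp add: algebra_simps)
qed

text \<open>The equation of y is y' = - \<alpha> y / r - lam r^(\<gamma> - \<alpha>) f(u). Its
  second term, multiplied by r^(\<alpha> - \<gamma>) \<psi>(y), cancels the derivative of lam
  F(u).\<close>

lemma energy_deriv:
  assumes "sol T d u w" "0 < r" "r < T"
  shows "((\<lambda>r. energy r (u r) (w r)) has_real_derivative
    r powr (\<alpha> - \<gamma> - 1) * decay (rflux w r)) (at r)"
proof -
  let ?y = "rflux w r"
  have y: "((rflux w) has_real_derivative
      - \<alpha> * r powr (- \<alpha> - 1) * w r + r powr - \<alpha> * - (lam * r powr \<gamma> * f (u r))) (at r)"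
    using assms(2) forcedD(6)[OF assms(1), of r] assms by (auto intro!: derivative_eq_intros)
  have u: "((\<lambda>r. lam * F (u r)) has_real_derivative lam * (f (u r) * \<psi> ?y)) (at r)"
    by (rule DERIV_cmult[OF DERIV_chain2[OF F_deriv forcedD(5)[OF assms]]])
  have "((\<lambda>r. r powr (\<alpha> - \<gamma>)) has_real_derivative (\<alpha> - \<gamma>) * r powr (\<alpha> - \<gamma> - 1)) (at r)"
    using assms(2) by (auto intro!: derivative_eq_intros)
  from DERIV_add[OF u DERIV_mult[OF this DERIV_chain2[OF G_deriv y]]]
  show ?thesis
    unfolding energy_def decay_def
    by (rule DERIV_cong) (use assms(2) in \<open>simp add: powr_diff powr_minus powr_add field_simps\<close>)
qed

lemma energy_continuous_on:
  assumes "sol T d u w" "0 < r" "s \<le> T"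
  shows "continuous_on {r..s} (\<lambda>r. energy r (u r) (w r))"
  unfolding energy_def
  by (intro continuous_intros forced_cont(1)[OF assms(1)] forced_cont(2)[OF assms(1)])
    (use assms in auto)

lemma energy_antimono:
  assumes "sol T d u w" "0 < r" "r \<le> s" "s \<le> T"
  shows "energy s (u s) (w s) \<le> energy r (u r) (w r)"
proof -
  have "energy s (u s) (w s) - energy r (u r) (w r) \<le> 0 - 0"
    by (rule diff_le_diff_of_deriv_le[where g' = "\<lambda>_. 0", OF assms(3) energy_continuous_on[OF assms(1)] _ energy_deriv[OF assms(1)]])
      (use assms decay_nonpos in \<open>auto simp: mult_nonneg_nonpos\<close>)
  then show ?thesis by simp
qed

text \<open>Only the term with \<open>G\<close> loses energy, and it is at most the whole energy
  because \<open>F\<close> is nonnegative; the factor \<open>r powr decay_const\<close> absorbs the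
  loss.\<close>

lemma energy_lower:
  assumes "sol T d u w" "0 < r" "r \<le> s" "s \<le> T"
  shows "r powr decay_const * energy r (u r) (w r) \<le> s powr decay_const * energy s (u s) (w s)"
proof -
  let ?K = decay_const
  have "0 * (s - r) \<le> (\<lambda>r. r powr ?K * energy r (u r) (w r)) s - (\<lambda>r. r powr ?K * energy r (u r) (w r)) r"
  proof (rule le_diff_of_deriv_ge)
    fix x assume x: "r < x" "x < s"
    let ?y = "rflux w x"
    let ?d = "?K * x powr (?K - 1) * energy x (u x) (w x) + x powr ?K * (x powr (\<alpha> - \<gamma> - 1) * decay ?y)"
    show "((\<lambda>r. r powr ?K * energy r (u r) (w r)) has_real_derivative ?d) (at x)"
      using x assms by (auto intro!: derivative_eq_intros energy_deriv[OF assms(1)])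
    have "?K * x powr (?K - 1) * (x powr (\<alpha> - \<gamma>) * G ?y) \<le> ?K * x powr (?K - 1) * energy x (u x) (w x)"
      using decay_const_nonneg lam_pos F_nonneg[of "u x"] unfolding energy_def by (intro mult_left_mono) auto
    moreover have "x powr ?K * (x powr (\<alpha> - \<gamma> - 1) * (- ?K * G ?y)) \<le> x powr ?K * (x powr (\<alpha> - \<gamma> - 1) * decay ?y)"
      using decay_ge[of ?y] by (intro mult_left_mono) auto
    moreover have "x powr ?K * (x powr (\<alpha> - \<gamma> - 1) * (- ?K * G ?y)) = - (?K * x powr (?K - 1) * (x powr (\<alpha> - \<gamma>) * G ?y))"
      using x assms by (simp add: powr_diff powr_add field_simps)
    ultimately show "0 \<le> ?d" by linarith
  qed (use assms in \<open>auto intro!: continuous_intros energy_continuous_on[OF assms(1)]\<close>)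
  then show ?thesis by simp
qed

lemma sol_bounded:
  assumes "sol T d u w"
  obtains B where "B \<ge> 0" "\<And>r. r \<in> {0..T} \<Longrightarrow> \<bar>f (u r)\<bar> \<le> B"
proof -
  have "continuous_on {0..T} (\<lambda>r. f (u r))" using forcedD(1)[OF assms] by (rule f_continuous_on)
  then have "bounded ((\<lambda>r. f (u r)) ` {0..T})" by (intro compact_imp_bounded compact_continuous_image) auto
  then obtain B where "\<forall>r\<in>{0..T}. \<bar>f (u r)\<bar> \<le> B" by (auto simp: bounded_iff)
  then show thesis by (intro that[of "max B 0"]) (auto simp: le_max_iff_disj)
qed

text \<open>The energy at r = 0 is not given by its formula, whose weight may be singular there, so
  the bound is a limit s -> 0 of \<open>energy_antimono\<close>. The term with \<open>G\<close> is
  O(s): y is of order s^(\<gamma> + 1 - \<alpha>), \<open>G y\<close> is at most |y| times a bounded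
  factor, and the weight s^(\<alpha> - \<gamma>) leaves one power of s.\<close>

lemma energy_le_initial:
  assumes "sol T d u w" "0 < r" "r \<le> T"
  shows "energy r (u r) (w r) \<le> lam * F d"
proof -
  obtain B where B: "B \<ge> 0" "\<And>r. r \<in> {0..T} \<Longrightarrow> \<bar>f (u r)\<bar> \<le> B" using sol_bounded[OF assms(1)] by blast
  let ?C = "lam * B / (\<gamma> + 1) * \<psi> (ymax B T)"
  have small: "energy s (u s) (w s) \<le> lam * F (u s) + ?C * s" if s: "0 < s" "s \<le> T" for s
  proof -
    let ?y = "rflux w s"
    have y: "\<bar>?y\<bar> \<le> ymax B s" "\<bar>?y\<bar> \<le> ymax B T"
      using forced_y_le[OF assms(1), of B s] B s by auto
    have "G ?y \<le> \<bar>?y\<bar> * \<psi> \<bar>?y\<bar>" by (rule G_le)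
    also have "\<dots> \<le> ymax B s * \<psi> (ymax B T)" using y by (intro mult_mono) auto
    finally have "s powr (\<alpha> - \<gamma>) * G ?y \<le> s powr (\<alpha> - \<gamma>) * (ymax B s * \<psi> (ymax B T))"
      by (intro mult_left_mono) auto
    also have "\<dots> = ?C * (s powr (\<alpha> - \<gamma>) * s powr (\<gamma> + 1 - \<alpha>))" by (simp add: ymax_def[of B s])
    also have "\<dots> = ?C * s" using s by (simp flip: powr_add)
    finally show ?thesis unfolding energy_def by simp
  qed
  have "continuous_on {0..T} (\<lambda>s. lam * F (u s) + ?C * s)"
    by (intro continuous_intros forcedD(1)[OF assms(1)])
  then have lim: "((\<lambda>s. lam * F (u s) + ?C * s) \<longlongrightarrow> lam * F (u 0) + ?C * 0) (at 0 within {0..T})"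
    by (rule continuous_on_def[THEN iffD1, rule_format]) (use assms in auto)
  have "at_right 0 = at 0 within {0<..T}" using assms by (intro at_within_nhd[of _ "{..<T}"]) auto
  also have "\<dots> \<le> at 0 within {0..T}" by (rule at_le) auto
  finally have "((\<lambda>s. lam * F (u s) + ?C * s) \<longlongrightarrow> lam * F d) (at_right 0)"
    using tendsto_mono[OF _ lim] forcedD(3)[OF assms(1)] by simp
  moreover have "\<forall>\<^sub>F s in at_right 0. energy r (u r) (w r) \<le> lam * F (u s) + ?C * s"
    unfolding eventually_at_right_field
  proof (intro exI[of _ r] conjI allI impI)
    fix s assume s: "0 < s" "s < r"
    have "energy r (u r) (w r) \<le> energy s (u s) (w s)"
      by (rule energy_antimono[OF assms(1)]) (use s assms in auto)
    also have "\<dots> \<le> lam * F (u s) + ?C * s" by (rule small) (use s assms in auto)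
    finally show "energy r (u r) (w r) \<le> lam * F (u s) + ?C * s" .
  qed (fact assms(2))
  ultimately show ?thesis by (rule tendsto_lowerbound) simp
qed

lemma F_le_initial:
  assumes "sol T d u w" "0 \<le> r" "r \<le> T"
  shows "F (u r) \<le> F d"
proof (cases "r = 0")
  case True then show ?thesis using forcedD(3)[OF assms(1)] by simp
next
  case False
  have "lam * F (u r) \<le> energy r (u r) (w r)" unfolding energy_def using G_nonneg by simp
  also have "\<dots> \<le> lam * F d" using False assms by (intro energy_le_initial) auto
  finally show ?thesis using lam_pos by simp
qed

text \<open>\<open>F\<close> is strictly monotone on either side of 0, so a sublevel set of
  \<open>F\<close> is an interval. The bounds do not involve \<open>lam\<close>.\<close>

lemma sol_range:
  assumes "sol T d u w" "0 \<le> r" "r \<le> T" "d > 0" "M > 0" "F d \<le> F (- M)"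
  shows "- M \<le> u r" "u r \<le> d"
  using F_le_initial[OF assms(1-3)] F_strict_mono[of d "u r"] F_strict_antimono[of "- M" "u r"] assms
  by force+

text \<open>Just after the start u is still near d > 0, so \<open>F (u s)\<close> is positive there;
  \<open>energy_lower\<close> carries the positivity to the right.\<close>

lemma energy_pos:
  assumes "sol T d u w" "d > 0" "0 < r" "r \<le> T"
  shows "energy r (u r) (w r) > 0"
proof -
  have "((\<lambda>r. u r) \<longlongrightarrow> u 0) (at 0 within {0..T})"
    using forcedD(1)[OF assms(1)] assms unfolding continuous_on_def by auto
  then have "\<forall>\<^sub>F s in at 0 within {0..T}. u s > 0"
    by (rule order_tendstoD(1)) (use assms forcedD(3)[OF assms(1)] in auto)
  then obtain e where e: "e > 0" "\<And>s. s \<in> {0..T} \<Longrightarrow> s \<noteq> 0 \<Longrightarrow> dist s 0 < e \<Longrightarrow> u s > 0"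
    unfolding eventually_at by blast
  define s where "s = min r (e/2)"
  have s: "0 < s" "s \<le> r" "u s > 0" using e assms by (auto simp: s_def intro!: e(2))
  have "energy s (u s) (w s) > 0"
    unfolding energy_def using s lam_pos F_pos[of "u s"] G_nonneg by (simp add: add_pos_nonneg)
  then have "0 < s powr decay_const * energy s (u s) (w s)" using s by simp
  also have "\<dots> \<le> r powr decay_const * energy r (u r) (w r)"
    by (rule energy_lower[OF assms(1)]) (use s assms in auto)
  finally show ?thesis by (simp add: zero_less_mult_iff)
qed

lemma sol_nonvanishing:
  assumes "sol T d u w" "d > 0" "0 < r" "r \<le> T" "u r = 0"
  shows "w r \<noteq> 0"
  using energy_pos[OF assms(1-4)] assms(5) by (auto simp: energy_def)

end

section \<open>Uniqueness\<close>

lemma continuous_on_Icc_eventually_close: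
  fixes g :: "real \<Rightarrow> real"
  assumes "continuous_on {a..b} g" "a \<le> r0" "r0 < b" "e > 0"
  obtains r1 where "r0 < r1" "r1 < b" "\<And>r. r \<in> {r0..r1} \<Longrightarrow> \<bar>g r - g r0\<bar> \<le> e"
proof -
  obtain d where d: "d > 0" "\<And>r. r \<in> {a..b} \<Longrightarrow> dist r r0 < d \<Longrightarrow> dist (g r) (g r0) < e"
    using assms unfolding continuous_on_iff by (metis atLeastAtMost_iff less_eq_real_def)
  show thesis
  proof
    show "r0 < r0 + min d (b - r0) / 2" "r0 + min d (b - r0) / 2 < b" using d assms by (auto simp: min_def field_simps)
    fix r assume "r \<in> {r0..r0 + min d (b - r0) / 2}"
    then have "r \<in> {a..b}" "dist r r0 < d" using d assms by (auto simp: min_def field_simps dist_real_def split: if_splits)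
    then show "\<bar>g r - g r0\<bar> \<le> e" using d(2)[of r] by (simp add: dist_real_def)
  qed
qed

context ivp_system
begin

text \<open>A lower bound of the same order in r as the upper bound in \<open>flux_le\<close>: near
  the start, the flux is known up to a constant factor.\<close>

lemma flux_ge:
  assumes "forced T d q u w" and q: "\<And>r. 0 < r \<Longrightarrow> r < T \<Longrightarrow> m \<le> q r" and r: "0 \<le> r" "r \<le> T"
  shows "lam * m * (r powr (\<gamma> + 1) / (\<gamma> + 1)) \<le> - w r" "ymax m r \<le> - (rflux w r)"
proof -
  have "lam * m * (r powr (\<gamma> + 1) / (\<gamma> + 1)) - lam * m * (0 powr (\<gamma> + 1) / (\<gamma> + 1)) \<le> - w r - (- w 0)"
  proof (rule diff_le_diff_of_deriv_le[where f' = "\<lambda>r. lam * m * r powr \<gamma>" and g' = "\<lambda>r. - (- (lam * r powr \<gamma> * q r))"])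
    show "continuous_on {0..r} (\<lambda>x. lam * m * (x powr (\<gamma> + 1) / (\<gamma> + 1)))"
      using gamma_nonneg by (intro continuous_intros continuous_on_powr_nonneg) auto
    show "continuous_on {0..r} (\<lambda>r. - w r)"
      using r by (auto intro!: continuous_intros forced_cont(2)[OF assms(1)])
    fix x assume x: "0 < x" "x < r"
    show "((\<lambda>x. lam * m * (x powr (\<gamma> + 1) / (\<gamma> + 1))) has_real_derivative lam * m * x powr \<gamma>) (at x)"
      by (rule DERIV_cmult[OF powr_Suc_div_deriv]) (use x gamma_nonneg in auto)
    show "((\<lambda>x. - w x) has_real_derivative - (- (lam * x powr \<gamma> * q x))) (at x)"
      by (rule DERIV_minus[OF forcedD(6)[OF assms(1)]]) (use x r in auto)
    have "lam * x powr \<gamma> * m \<le> lam * x powr \<gamma> * q x"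
      using q[of x] x r lam_pos by (intro mult_left_mono) auto
    then show "lam * m * x powr \<gamma> \<le> - (- (lam * x powr \<gamma> * q x))" by (simp add: mult_ac)
  qed (use r in auto)
  then show *: "lam * m * (r powr (\<gamma> + 1) / (\<gamma> + 1)) \<le> - w r"
    using forcedD[OF assms(1)] by simp
  have "r powr - \<alpha> * (lam * m * (r powr (\<gamma> + 1) / (\<gamma> + 1))) \<le> r powr - \<alpha> * (- w r)"
    by (rule mult_left_mono[OF *]) simp
  moreover have "r powr - \<alpha> * (lam * m * (r powr (\<gamma> + 1) / (\<gamma> + 1))) = ymax m r"
    unfolding ymax_def by (simp add: powr_diff powr_minus field_simps)
  ultimately show "ymax m r \<le> - (rflux w r)" by simp
qed

lemma f_bounds_away_from_0:
  assumes "x \<noteq> 0" "0 \<le> e" "e < \<bar>x\<bar>"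
  obtains m B where "0 < m" "\<And>y. \<bar>y - x\<bar> \<le> e \<Longrightarrow> m \<le> \<bar>f y\<bar> \<and> \<bar>f y\<bar> \<le> B \<and> 0 < x * f y"
proof -
  let ?S = "{x - e..x + e}"
  have S: "compact ?S" "?S \<noteq> {}" "continuous_on ?S (\<lambda>y. \<bar>f y\<bar>)"
    using assms by (auto intro!: continuous_intros)
  obtain y1 where y1: "y1 \<in> ?S" "\<And>y. y \<in> ?S \<Longrightarrow> \<bar>f y1\<bar> \<le> \<bar>f y\<bar>"
    using continuous_attains_inf[OF S] by auto
  obtain y2 where y2: "y2 \<in> ?S" "\<And>y. y \<in> ?S \<Longrightarrow> \<bar>f y\<bar> \<le> \<bar>f y2\<bar>"
    using continuous_attains_sup[OF S] by auto
  have sgn: "0 < x * f y" if "y \<in> ?S" for y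
  proof (cases "x > 0")
    case True
    then show ?thesis using that assms by (simp add: f_pos)
  next
    case False
    then show ?thesis using that assms by (auto intro!: mult_neg_neg f_neg)
  qed
  show thesis
  proof (rule that[of "\<bar>f y1\<bar>" "\<bar>f y2\<bar>"])
    show "0 < \<bar>f y1\<bar>" using sgn[OF y1(1)] by auto
    fix y assume "\<bar>y - x\<bar> \<le> e"
    then have "y \<in> ?S" by auto
    then show "\<bar>f y1\<bar> \<le> \<bar>f y\<bar> \<and> \<bar>f y\<bar> \<le> \<bar>f y2\<bar> \<and> 0 < x * f y" using y1(2) y2(2) sgn by blast
  qed
qed

lemma f_local_bounds:
  assumes "x \<noteq> 0"
  obtains e L m B where "0 < e" "0 \<le> L" "0 < m" "0 < B"
    "\<And>y z. \<bar>y - x\<bar> \<le> e \<Longrightarrow> \<bar>z - x\<bar> \<le> e \<Longrightarrow> \<bar>f y - f z\<bar> \<le> L * \<bar>y - z\<bar>"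
    "\<And>y. \<bar>y - x\<bar> \<le> e \<Longrightarrow> m \<le> \<bar>f y\<bar> \<and> \<bar>f y\<bar> \<le> B \<and> 0 < x * f y"
proof -
  obtain L e0 where L: "e0 > 0" "\<And>y z. \<bar>y - x\<bar> \<le> e0 \<Longrightarrow> \<bar>z - x\<bar> \<le> e0 \<Longrightarrow> \<bar>f y - f z\<bar> \<le> L * \<bar>y - z\<bar>"
    using f_locally_lipschitz[OF assms] by auto
  define e where "e = min e0 (\<bar>x\<bar> / 2)"
  have e: "0 < e" "0 \<le> e" "e \<le> e0" "e < \<bar>x\<bar>" using L(1) assms by (auto simp: e_def)
  obtain m B where mB: "0 < m" "\<And>y. \<bar>y - x\<bar> \<le> e \<Longrightarrow> m \<le> \<bar>f y\<bar> \<and> \<bar>f y\<bar> \<le> B \<and> 0 < x * f y"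
    using f_bounds_away_from_0[OF assms e(2,4)] by blast
  have "\<bar>f y - f z\<bar> \<le> max L 0 * \<bar>y - z\<bar>" if "\<bar>y - x\<bar> \<le> e" "\<bar>z - x\<bar> \<le> e" for y z
    using L(2)[of y z] that e(3) mult_right_mono[of L "max L 0" "\<bar>y - z\<bar>"] by force
  moreover have "0 < B" using mB(1) mB(2)[of x] e(1) by auto
  ultimately show thesis using that[of e "max L 0" m B] e(1) mB by auto
qed

text \<open>Near the start both solutions stay close to d, so f(u) lies between positive constants m
  and B, and both fluxes are at least \<open>ymax m r\<close> in modulus. There the Lipschitz
  constant of \<open>\<psi>\<close> is of order 1 / \<open>ymax m r\<close>, while the fluxes differ
  by at most \<open>ymax (L * D) r\<close>, with \<open>D\<close> the maximal difference of u1 and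
  u2. The powers of r cancel, and a short interval gives D \<le> D / 2.\<close>

lemma sol_agree_near_0:
  assumes 1: "sol T d u1 w1" and 2: "sol T d u2 w2" and d: "d > 0" and T: "T > 0"
  obtains \<rho> where "0 < \<rho>" "\<rho> \<le> T" "\<And>r. r \<in> {0..\<rho>} \<Longrightarrow> u1 r = u2 r"
proof -
  obtain e L m B where L: "0 \<le> L" and e: "0 < e" and mB: "0 < m" "\<And>y. \<bar>y - d\<bar> \<le> e \<Longrightarrow> m \<le> \<bar>f y\<bar> \<and> \<bar>f y\<bar> \<le> B \<and> 0 < d * f y"
    and B: "0 < B" and lip: "\<And>y z. \<bar>y - d\<bar> \<le> e \<Longrightarrow> \<bar>z - d\<bar> \<le> e \<Longrightarrow> \<bar>f y - f z\<bar> \<le> L * \<bar>y - z\<bar>"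
    using f_local_bounds[of d] d by (metis less_irrefl)
  obtain r1 where r1: "0 < r1" "r1 < T" "\<And>r. r \<in> {0..r1} \<Longrightarrow> \<bar>u1 r - u1 0\<bar> \<le> e"
    using continuous_on_Icc_eventually_close[OF forcedD(1)[OF 1], of 0 e] T e by auto
  obtain r2 where r2: "0 < r2" "r2 < T" "\<And>r. r \<in> {0..r2} \<Longrightarrow> \<bar>u2 r - u2 0\<bar> \<le> e"
    using continuous_on_Icc_eventually_close[OF forcedD(1)[OF 2], of 0 e] T e by auto
  \<comment> \<open>The Lipschitz constant \<open>p * \<psi> (ymax B 1) / ymax m r\<close> of
    \<open>\<psi>\<close> times \<open>ymax (L * D) r\<close> equals \<open>K * D\<close> for every
    r > 0.\<close>
  define K where "K = p * \<psi> (ymax B 1) * L / m"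
  have K: "K \<ge> 0" unfolding K_def ymax_def
    using p_pos L mB(1) B lam_pos gamma_nonneg by (intro divide_nonneg_pos mult_nonneg_nonneg) auto
  \<comment> \<open>The bound 1 gives \<open>ymax B r \<le> ymax B 1\<close>; the last entry gives
    \<open>K * \<rho> \<le> 1 / 2\<close>.\<close>
  define \<rho> where "\<rho> = min (min r1 r2) (min 1 (1 / (2 * (K + 1))))"
  have rho: "0 < \<rho>" "\<rho> < T" "\<rho> \<le> 1" "\<rho> \<le> r1" "\<rho> \<le> r2" "\<rho> \<le> 1 / (2 * (K + 1))"
    using r1 r2 K by (auto simp: \<rho>_def intro: min.coboundedI2)
  have "K * \<rho> \<le> (K + 1) * (1 / (2 * (K + 1)))"
    using K rho by (intro mult_mono) auto
  also have "(K + 1) * (1 / (2 * (K + 1))) = 1 / 2" using K by (simp add: field_simps)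
  finally have Krho: "K * \<rho> \<le> 1 / 2" .
  have near: "\<bar>u1 r - d\<bar> \<le> e" "\<bar>u2 r - d\<bar> \<le> e" if "r \<in> {0..\<rho>}" for r
    using r1(3)[of r] r2(3)[of r] forcedD(3)[OF 1] forcedD(3)[OF 2] that rho by auto
  note s1 = forced_subinterval[OF 1, of \<rho>] and s2 = forced_subinterval[OF 2, of \<rho>]
  have f1: "m \<le> f (u1 r)" "\<bar>f (u1 r)\<bar> \<le> B" and f2: "m \<le> f (u2 r)" "\<bar>f (u2 r)\<bar> \<le> B" if "r \<in> {0..\<rho>}" for r
    using mB(2)[OF near(1)[OF that]] mB(2)[OF near(2)[OF that]] d by (auto simp: zero_less_mult_iff)
  have "continuous_on {0..\<rho>} (\<lambda>r. \<bar>u1 r - u2 r\<bar>)"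
    using rho by (intro continuous_intros forced_cont(1)[OF 1] forced_cont(1)[OF 2]) auto
  then obtain x where x: "x \<in> {0..\<rho>}" "\<And>r. r \<in> {0..\<rho>} \<Longrightarrow> \<bar>u1 r - u2 r\<bar> \<le> \<bar>u1 x - u2 x\<bar>"
    using continuous_attains_sup[of "{0..\<rho>}" "\<lambda>r. \<bar>u1 r - u2 r\<bar>"] rho by force
  define D where "D = \<bar>u1 x - u2 x\<bar>"
  have fD: "\<bar>f (u1 r) - f (u2 r)\<bar> \<le> L * D" if "r \<in> {0..\<rho>}" for r
  proof -
    have "\<bar>f (u1 r) - f (u2 r)\<bar> \<le> L * \<bar>u1 r - u2 r\<bar>" by (rule lip[OF near[OF that]])
    also have "\<dots> \<le> L * D" using x(2)[OF that] L unfolding D_def by (intro mult_left_mono) auto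
    finally show ?thesis .
  qed
  have "\<bar>(\<lambda>r. u1 r - u2 r) x - (\<lambda>r. u1 r - u2 r) 0\<bar> \<le> K * D * (x - 0)"
  proof (rule abs_diff_le_of_deriv_le[where f' = "\<lambda>r. \<psi> (rflux w1 r) - \<psi> (rflux w2 r)"])
    fix r assume r: "0 < r" "r < x"
    let ?y1 = "rflux w1 r" and ?y2 = "rflux w2 r"
    show "((\<lambda>r. u1 r - u2 r) has_real_derivative \<psi> ?y1 - \<psi> ?y2) (at r)"
      by (rule DERIV_diff[OF forcedD(5)[OF 1] forcedD(5)[OF 2]]) (use r x rho in auto)
    have rr: "r \<in> {0..\<rho>}" using r x by auto
    have low: "ymax m r \<le> - ?y1" "ymax m r \<le> - ?y2"
      using flux_ge(2)[OF s1, of m r] flux_ge(2)[OF s2, of m r] f1 f2 rr rho by auto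
    have "\<bar>?y1\<bar> \<le> ymax B r" "\<bar>?y2\<bar> \<le> ymax B r"
      using forced_y_le(1)[OF s1, of B r] forced_y_le(1)[OF s2, of B r] f1 f2 rr rho B by auto
    moreover have "ymax B r \<le> ymax B 1" using B rr rho by (intro ymax_mono) auto
    ultimately have up: "\<bar>?y1\<bar> \<le> ymax B 1" "\<bar>?y2\<bar> \<le> ymax B 1" by auto
    have pos: "0 < ymax m r" unfolding ymax_def using mB(1) lam_pos gamma_nonneg r by simp
    have diff: "\<bar>?y1 - ?y2\<bar> \<le> ymax (L * D) r"
      unfolding ymax_def
      by (rule flux_diff_le(2)[of \<rho> w1 "\<lambda>r. f (u1 r)" w2 "\<lambda>r. f (u2 r)"])
        (use forcedD[OF s1] forcedD[OF s2] fD rr rho in auto)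
    have "\<bar>\<psi> ?y1 - \<psi> ?y2\<bar> \<le> p * \<psi> (ymax B 1) / ymax m r * \<bar>?y1 - ?y2\<bar>"
      by (rule psi_lipschitz_same_sign) (use low up pos in \<open>auto intro!: mult_neg_neg\<close>)
    also have "\<dots> \<le> p * \<psi> (ymax B 1) / ymax m r * ymax (L * D) r"
      using diff p_pos pos up by (intro mult_left_mono divide_nonneg_pos mult_nonneg_nonneg) auto
    also have "\<dots> = K * D"
      using pos mB(1) lam_pos gamma_nonneg r by (simp add: K_def ymax_def[of m r] ymax_def[of "L * D" r])
    finally show "\<bar>\<psi> ?y1 - \<psi> ?y2\<bar> \<le> K * D" .
  qed (use x rho in \<open>auto intro!: continuous_intros forced_cont(1)[OF 1] forced_cont(1)[OF 2]\<close>)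
  then have "D \<le> K * D * x" using forcedD(3)[OF 1] forcedD(3)[OF 2] by (simp add: D_def)
  also have "K * D * x = D * (K * x)" by (simp only: mult_ac)
  also have "\<dots> \<le> D * (K * \<rho>)" using x(1) K by (intro mult_left_mono) (auto simp: D_def)
  also have "\<dots> \<le> D * (1 / 2)" by (intro mult_left_mono Krho) (simp add: D_def)
  finally have "D = 0" by (simp add: D_def)
  then show thesis using x(2) rho by (intro that[of \<rho>]) (auto simp: D_def)
qed

text \<open>
  After the start, uniqueness follows from Gronwall's inequality although neither \<open>f\<close> nor \<open>\<psi>\<close> is
  Lipschitz at \<open>0\<close>: the energy has a Lipschitz derivative and can replace the flux \<open>w\<close> as an unknown
  where \<open>w \<noteq> 0\<close>, and the solution \<open>u\<close> where \<open>u \<noteq> 0\<close>.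
\<close>

lemma gronwall_with_energy:
  fixes x x' :: "real \<Rightarrow> real"
  defines "e \<equiv> \<lambda>u1 w1 u2 w2 r. energy r (u1 r) (w1 r) - energy r (u2 r) (w2 r)"
  assumes 1: "sol T d u1 w1" and 2: "sol T d u2 w2" and r0: "0 < r0" "r1 < T"
    and eq: "u1 r0 = u2 r0" "w1 r0 = w2 r0"
    and x: "continuous_on {r0..r1} x" "x r0 = 0"
      "\<And>r. r0 < r \<Longrightarrow> r < r1 \<Longrightarrow> (x has_real_derivative x' r) (at r)"
    and Y: "\<And>r. r \<in> {r0..r1} \<Longrightarrow> \<bar>rflux w1 r\<bar> \<le> Y \<and> \<bar>rflux w2 r\<bar> \<le> Y"
    and bx: "\<And>r. r \<in> {r0..r1} \<Longrightarrow> \<bar>x' r\<bar> \<le> Cx * (\<bar>x r\<bar> + \<bar>e u1 w1 u2 w2 r\<bar>)"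
    and bw: "\<And>r. r \<in> {r0..r1} \<Longrightarrow>
      \<bar>rflux w1 r - rflux w2 r\<bar> \<le> Cy * (\<bar>x r\<bar> + \<bar>e u1 w1 u2 w2 r\<bar>)"
    and r: "r \<in> {r0..r1}"
  shows "x r = 0 \<and> e u1 w1 u2 w2 r = 0"
proof -
  let ?y1 = "rflux w1" and ?y2 = "rflux w2" and ?e = "e u1 w1 u2 w2"
  obtain P where P: "P > 0" "\<And>r. r \<in> {r0..T} \<Longrightarrow> r powr (\<alpha> - \<gamma> - 1) \<le> P"
    using powr_bounded_above[OF r0(1)] by blast
  define C where "C = max Cx (P * (decay_const * \<psi> Y) * Cy)"
  show ?thesis
  proof (rule gronwall_pair_zero[where a = r0 and b = r and C = C and x = x and y = ?e and x' = x'
        and y' = "\<lambda>r. r powr (\<alpha> - \<gamma> - 1) * decay (?y1 r) - r powr (\<alpha> - \<gamma> - 1) * decay (?y2 r)"])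
    show "continuous_on {r0..r} x" by (rule continuous_on_subset[OF x(1)]) (use r in auto)
    show "continuous_on {r0..r} ?e"
      unfolding e_def using r0 r by (intro continuous_intros energy_continuous_on[OF 1] energy_continuous_on[OF 2]) auto
    show "x r0 = 0" "?e r0 = 0" using x(2) eq by (auto simp: e_def)
    fix s assume s: "r0 < s" "s < r"
    then have sr: "s \<in> {r0..r1}" "s \<in> {r0..T}" "0 < s" "s < T" "s < r1" using r r0 by auto
    show "(x has_real_derivative x' s) (at s)" by (rule x(3)[OF s(1) sr(5)])
    show "(?e has_real_derivative s powr (\<alpha> - \<gamma> - 1) * decay (?y1 s) - s powr (\<alpha> - \<gamma> - 1) * decay (?y2 s)) (at s)"
      unfolding e_def by (rule DERIV_diff[OF energy_deriv[OF 1 sr(3,4)] energy_deriv[OF 2 sr(3,4)]])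
    have "Cx * (\<bar>x s\<bar> + \<bar>?e s\<bar>) \<le> C * (\<bar>x s\<bar> + \<bar>?e s\<bar>)" by (intro mult_right_mono) (auto simp: C_def)
    with bx[OF sr(1)] show "\<bar>x' s\<bar> \<le> C * (\<bar>x s\<bar> + \<bar>?e s\<bar>)" by linarith
    have "\<bar>s powr (\<alpha> - \<gamma> - 1) * decay (?y1 s) - s powr (\<alpha> - \<gamma> - 1) * decay (?y2 s)\<bar>
        = s powr (\<alpha> - \<gamma> - 1) * \<bar>decay (?y1 s) - decay (?y2 s)\<bar>"
      by (simp add: abs_mult flip: right_diff_distrib)
    also have "\<dots> \<le> P * (decay_const * \<psi> Y * \<bar>?y1 s - ?y2 s\<bar>)"
      using Y[OF sr(1)] by (intro mult_mono P sr decay_lipschitz) (use P in auto)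
    also have "\<dots> \<le> P * (decay_const * \<psi> Y * (Cy * (\<bar>x s\<bar> + \<bar>?e s\<bar>)))"
    proof -
      have "0 \<le> Y" using Y[OF sr(1)] by linarith
      then show ?thesis using bw[OF sr(1)] P decay_const_nonneg by (intro mult_left_mono) auto
    qed
    also have "\<dots> \<le> C * (\<bar>x s\<bar> + \<bar>?e s\<bar>)"
      unfolding mult.assoc[symmetric] by (intro mult_right_mono) (auto simp: C_def mult.assoc)
    finally show "\<bar>s powr (\<alpha> - \<gamma> - 1) * decay (?y1 s) - s powr (\<alpha> - \<gamma> - 1) * decay (?y2 s)\<bar>
      \<le> C * (\<bar>x s\<bar> + \<bar>?e s\<bar>)" .
  qed (use r in auto)
qed

text \<open>Near \<open>r0\<close> the fluxes keep one sign and stay away from 0, so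
  \<open>\<psi>\<close> is Lipschitz and \<open>G\<close> expands there. The unknowns are the
  differences of u and of the energy: the energy identity bounds the difference of
  \<open>G y\<close>, hence of y, through differences of \<open>F u\<close>. Only the primitive of f
  enters, so u may pass through 0.\<close>

lemma sol_agree_right_of_nonzero_flux:
  assumes 1: "sol T d u1 w1" and 2: "sol T d u2 w2" and r0: "0 < r0" "r0 < T"
    and eq: "u1 r0 = u2 r0" "w1 r0 = w2 r0" and nz: "w1 r0 \<noteq> 0"
  obtains r1 where "r0 < r1" "r1 < T" "\<And>r. r \<in> {r0..r1} \<Longrightarrow> u1 r = u2 r \<and> w1 r = w2 r"
proof -
  let ?y1 = "rflux w1" and ?y2 = "rflux w2"
  define y0 where "y0 = ?y1 r0"
  have y0: "y0 \<noteq> 0" "?y2 r0 = y0" using nz r0 eq by (auto simp: y0_def)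
  have cont: "continuous_on {r0..T} ?y1" "continuous_on {r0..T} ?y2"
    using r0 by (auto intro!: continuous_intros forced_cont(2)[OF 1] forced_cont(2)[OF 2])
  obtain ra where ra: "r0 < ra" "ra < T" "\<And>r. r \<in> {r0..ra} \<Longrightarrow> \<bar>?y1 r - ?y1 r0\<bar> \<le> \<bar>y0\<bar> / 2"
    using continuous_on_Icc_eventually_close[OF cont(1), of r0 "\<bar>y0\<bar> / 2"] r0 y0 by auto
  obtain rb where rb: "r0 < rb" "rb < T" "\<And>r. r \<in> {r0..rb} \<Longrightarrow> \<bar>?y2 r - ?y2 r0\<bar> \<le> \<bar>y0\<bar> / 2"
    using continuous_on_Icc_eventually_close[OF cont(2), of r0 "\<bar>y0\<bar> / 2"] r0 y0 by auto
  define r1 where "r1 = min ra rb"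
  have r1: "r0 < r1" "r1 < T" using ra rb by (auto simp: r1_def)
  have y: "\<bar>?y1 r - y0\<bar> \<le> \<bar>y0\<bar> / 2" "\<bar>?y2 r - y0\<bar> \<le> \<bar>y0\<bar> / 2" if "r \<in> {r0..r1}" for r
    using ra(3)[of r] rb(3)[of r] that y0 by (auto simp: r1_def y0_def)
  have ylow: "\<bar>y0\<bar> / 2 \<le> \<bar>?y1 r\<bar>" "\<bar>y0\<bar> / 2 \<le> \<bar>?y2 r\<bar>"
    and yup: "\<bar>?y1 r\<bar> \<le> 2 * \<bar>y0\<bar>" "\<bar>?y2 r\<bar> \<le> 2 * \<bar>y0\<bar>" if "r \<in> {r0..r1}" for r
    using y[OF that] by linarith+
  have ysgn: "0 < ?y1 r * ?y2 r" if "r \<in> {r0..r1}" for r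
  proof (cases "y0 > 0")
    case True
    then have "0 < ?y1 r" "0 < ?y2 r" using y[OF that] by linarith+
    then show ?thesis by (rule mult_pos_pos)
  next
    case False
    then have "?y1 r < 0" "?y2 r < 0" using y[OF that] y0 by linarith+
    then show ?thesis by (rule mult_neg_neg)
  qed
  have "bounded (u1 ` {0..T} \<union> u2 ` {0..T})"
    using forcedD(1)[OF 1] forcedD(1)[OF 2] by (auto intro!: compact_imp_bounded compact_continuous_image)
  then obtain X where X: "\<forall>x\<in>u1 ` {0..T} \<union> u2 ` {0..T}. \<bar>x\<bar> \<le> X" unfolding bounded_iff by auto
  have "bounded (f ` {- X..X})"
    by (auto intro!: compact_imp_bounded compact_continuous_image continuous_on_subset[OF f_cont])
  then obtain Bf where Bf: "\<forall>x\<in>{- X..X}. \<bar>f x\<bar> \<le> Bf" unfolding bounded_iff by auto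
  have FX: "\<bar>F a - F b\<bar> \<le> Bf * \<bar>a - b\<bar>" if "\<bar>a\<bar> \<le> X" "\<bar>b\<bar> \<le> X" for a b
    by (rule lipschitz_of_deriv_le[where x = "- X" and y = X and f' = f])
      (use that in \<open>auto intro!: continuous_intros F_deriv bspec[OF Bf]\<close>)
  have "0 \<le> X" using X r0 by force
  then have Bf0: "0 \<le> Bf" using Bf by force
  obtain P1 where P1: "P1 > 0" "\<And>r. r \<in> {r0..T} \<Longrightarrow> r powr (\<gamma> - \<alpha>) \<le> P1"
    using powr_bounded_above[OF r0(1)] by blast
  define m where "m = \<psi> (\<bar>y0\<bar> / 2)"
  have m: "m > 0" using y0 by (simp add: m_def)
  define C0 where "C0 = P1 * (1 + lam * Bf) / m"
  have C0: "C0 \<ge> 0" using P1 lam_pos Bf0 m by (simp add: C0_def)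
  have psi_diff: "\<bar>\<psi> (?y1 r) - \<psi> (?y2 r)\<bar> \<le> p * \<psi> (2 * \<bar>y0\<bar>) / (\<bar>y0\<bar> / 2) * \<bar>?y1 r - ?y2 r\<bar>"
    if "r \<in> {r0..r1}" for r
    by (rule psi_lipschitz_same_sign) (use y0 ylow[OF that] yup[OF that] ysgn[OF that] in auto)
  let ?a = "\<lambda>r. u1 r - u2 r"
  let ?e = "\<lambda>r. energy r (u1 r) (w1 r) - energy r (u2 r) (w2 r)"
  have yae: "\<bar>?y1 r - ?y2 r\<bar> \<le> C0 * (\<bar>?a r\<bar> + \<bar>?e r\<bar>)" if "r \<in> {r0..r1}" for r
  proof -
    have r: "r > 0" "r \<in> {r0..T}" "r \<in> {0..T}" using that r0 r1 by auto
    have "m * \<bar>?y1 r - ?y2 r\<bar> \<le> \<bar>G (?y1 r) - G (?y2 r)\<bar>"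
      unfolding m_def by (rule G_expanding_same_sign) (use ylow[OF that] ysgn[OF that] in auto)
    also have "\<dots> = r powr (\<gamma> - \<alpha>) * \<bar>?e r - lam * (F (u1 r) - F (u2 r))\<bar>"
    proof -
      have "G (?y1 r) - G (?y2 r) = (r powr (\<gamma> - \<alpha>) * r powr (\<alpha> - \<gamma>)) * (G (?y1 r) - G (?y2 r))"
        using r by (simp flip: powr_add)
      also have "\<dots> = r powr (\<gamma> - \<alpha>) * (?e r - lam * (F (u1 r) - F (u2 r)))"
        unfolding energy_def by (simp add: algebra_simps)
      finally show ?thesis by (simp add: abs_mult)
    qed
    also have "\<dots> \<le> P1 * (\<bar>?e r\<bar> + lam * (Bf * \<bar>?a r\<bar>))"
    proof (rule mult_mono)
      have "\<bar>F (u1 r) - F (u2 r)\<bar> \<le> Bf * \<bar>?a r\<bar>" using X r by (intro FX) auto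
      then have "lam * \<bar>F (u1 r) - F (u2 r)\<bar> \<le> lam * (Bf * \<bar>?a r\<bar>)" using lam_pos by simp
      moreover have "\<bar>?e r - lam * (F (u1 r) - F (u2 r))\<bar> \<le> \<bar>?e r\<bar> + lam * \<bar>F (u1 r) - F (u2 r)\<bar>"
        using abs_triangle_ineq4[of "?e r" "lam * (F (u1 r) - F (u2 r))"] lam_pos by (simp add: abs_mult)
      ultimately show "\<bar>?e r - lam * (F (u1 r) - F (u2 r))\<bar> \<le> \<bar>?e r\<bar> + lam * (Bf * \<bar>?a r\<bar>)" by linarith
    qed (use P1 r in auto)
    also have "\<dots> \<le> P1 * ((1 + lam * Bf) * (\<bar>?a r\<bar> + \<bar>?e r\<bar>))"
      using P1 lam_pos Bf0 by (intro mult_left_mono) (auto simp: algebra_simps)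
    finally show ?thesis using m by (simp add: C0_def field_simps)
  qed
  have "u1 r = u2 r \<and> w1 r = w2 r" if r: "r \<in> {r0..r1}" for r
  proof -
    have zero: "?a r = 0 \<and> ?e r = 0"
    proof (rule gronwall_with_energy[OF 1 2 r0(1) r1(2) eq _ _ _ _ _ yae r, where x' = "\<lambda>r. \<psi> (?y1 r) - \<psi> (?y2 r)"])
      show "continuous_on {r0..r1} ?a"
        using r0 r1 by (intro continuous_intros forced_cont(1)[OF 1] forced_cont(1)[OF 2]) auto
      show "(?a has_real_derivative \<psi> (?y1 s) - \<psi> (?y2 s)) (at s)" if "r0 < s" "s < r1" for s
        by (rule DERIV_diff[OF forcedD(5)[OF 1] forcedD(5)[OF 2]]) (use that r0 r1 in auto)
      fix s assume s: "s \<in> {r0..r1}"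
      show "\<bar>?y1 s\<bar> \<le> 2 * \<bar>y0\<bar> \<and> \<bar>?y2 s\<bar> \<le> 2 * \<bar>y0\<bar>" using yup[OF s] by blast
      have "\<bar>\<psi> (?y1 s) - \<psi> (?y2 s)\<bar> \<le> p * \<psi> (2 * \<bar>y0\<bar>) / (\<bar>y0\<bar> / 2) * (C0 * (\<bar>?a s\<bar> + \<bar>?e s\<bar>))"
        by (rule order_trans[OF psi_diff[OF s] mult_left_mono[OF yae[OF s]]]) (use p_pos y0 in auto)
      then show "\<bar>\<psi> (?y1 s) - \<psi> (?y2 s)\<bar> \<le> p * \<psi> (2 * \<bar>y0\<bar>) / (\<bar>y0\<bar> / 2) * C0 * (\<bar>?a s\<bar> + \<bar>?e s\<bar>)"
        by (simp only: mult.assoc)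
    qed (use eq in auto)
    have "\<bar>?y1 r - ?y2 r\<bar> \<le> 0"
      using yae[OF r] unfolding conjunct1[OF zero] conjunct2[OF zero] by simp
    then show ?thesis using zero r r0 by auto
  qed
  then show thesis using r1 that by blast
qed

text \<open>The mirror image of the previous case. Near \<open>r0\<close> the function f is
  Lipschitz and bounded away from 0, so \<open>F\<close> expands, and the difference of u is
  recovered from those of w and of the energy. Of the functions of y only \<open>G\<close> and
  \<open>decay\<close> are compared, so y may pass through 0.\<close>

lemma sol_agree_right_of_nonzero_value:
  assumes 1: "sol T d u1 w1" and 2: "sol T d u2 w2" and r0: "0 < r0" "r0 < T"
    and eq: "u1 r0 = u2 r0" "w1 r0 = w2 r0" and nz: "u1 r0 \<noteq> 0"
  obtains r1 where "r0 < r1" "r1 < T" "\<And>r. r \<in> {r0..r1} \<Longrightarrow> u1 r = u2 r \<and> w1 r = w2 r"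
proof -
  let ?y1 = "rflux w1" and ?y2 = "rflux w2"
  define x0 where "x0 = u1 r0"
  have x0: "x0 \<noteq> 0" "u2 r0 = x0" using nz eq by (auto simp: x0_def)
  obtain e L m B where L: "0 \<le> L" and e: "0 < e" and mB: "0 < m" "\<And>y. \<bar>y - x0\<bar> \<le> e \<Longrightarrow> m \<le> \<bar>f y\<bar> \<and> \<bar>f y\<bar> \<le> B \<and> 0 < x0 * f y"
    and lip: "\<And>y z. \<bar>y - x0\<bar> \<le> e \<Longrightarrow> \<bar>z - x0\<bar> \<le> e \<Longrightarrow> \<bar>f y - f z\<bar> \<le> L * \<bar>y - z\<bar>"
    using f_local_bounds[OF x0(1)] by metis
  have Fexp: "m * \<bar>a - b\<bar> \<le> \<bar>F a - F b\<bar>" if "\<bar>a - x0\<bar> \<le> e" "\<bar>b - x0\<bar> \<le> e" for a b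
  proof -
    have *: "m * (b - a) \<le> \<bar>F b - F a\<bar>" if "a \<le> b" "\<bar>a - x0\<bar> \<le> e" "\<bar>b - x0\<bar> \<le> e" for a b
    proof (cases "x0 > 0")
      case True
      have "m * (b - a) \<le> F b - F a"
      proof (rule le_diff_of_deriv_ge[where f' = f])
        fix x assume "a < x" "x < b"
        then have "\<bar>x - x0\<bar> \<le> e" using that by auto
        from mB(2)[OF this] show "m \<le> f x" using True by (auto simp: zero_less_mult_iff)
      qed (use that in \<open>auto intro!: continuous_intros F_deriv\<close>)
      then show ?thesis by simp
    next
      case False
      have "m * (b - a) \<le> (\<lambda>x. - F x) b - (\<lambda>x. - F x) a"
      proof (rule le_diff_of_deriv_ge[where f' = "\<lambda>x. - f x"])
        fix x assume "a < x" "x < b"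
        then have "\<bar>x - x0\<bar> \<le> e" using that by auto
        from mB(2)[OF this] show "m \<le> - f x" using False by (auto simp: zero_less_mult_iff)
      qed (use that in \<open>auto intro!: continuous_intros F_deriv DERIV_minus\<close>)
      then show ?thesis by simp
    qed
    show ?thesis using *[of a b] *[of b a] that by (cases "a \<le> b") (auto simp: abs_minus_commute)
  qed
  obtain ra where ra: "r0 < ra" "ra < T" "\<And>r. r \<in> {r0..ra} \<Longrightarrow> \<bar>u1 r - u1 r0\<bar> \<le> e"
    using continuous_on_Icc_eventually_close[OF forcedD(1)[OF 1], of r0 e] r0 e by auto
  obtain rb where rb: "r0 < rb" "rb < T" "\<And>r. r \<in> {r0..rb} \<Longrightarrow> \<bar>u2 r - u2 r0\<bar> \<le> e"
    using continuous_on_Icc_eventually_close[OF forcedD(1)[OF 2], of r0 e] r0 e by auto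
  define r1 where "r1 = min ra rb"
  have r1: "r0 < r1" "r1 < T" using ra rb by (auto simp: r1_def)
  have near: "\<bar>u1 r - x0\<bar> \<le> e" "\<bar>u2 r - x0\<bar> \<le> e" if "r \<in> {r0..r1}" for r
    using ra(3)[of r] rb(3)[of r] that x0 by (auto simp: r1_def x0_def)
  obtain B1 where B1: "B1 \<ge> 0" "\<And>r. r \<in> {0..T} \<Longrightarrow> \<bar>f (u1 r)\<bar> \<le> B1" using sol_bounded[OF 1] by blast
  obtain B2 where B2: "B2 \<ge> 0" "\<And>r. r \<in> {0..T} \<Longrightarrow> \<bar>f (u2 r)\<bar> \<le> B2" using sol_bounded[OF 2] by blast
  define Y where "Y = max (ymax B1 T) (ymax B2 T)"
  have yY: "\<bar>?y1 r\<bar> \<le> Y" "\<bar>?y2 r\<bar> \<le> Y" if "r \<in> {0..T}" for r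
    using forced_y_le(2)[OF 1, of B1 r] forced_y_le(2)[OF 2, of B2 r] B1 B2 that by (auto simp: Y_def)
  have Y: "0 \<le> Y" using yY(1)[of 0] r0 by simp
  obtain P3 where P3: "P3 > 0" "\<And>r. r \<in> {r0..T} \<Longrightarrow> r powr (- \<alpha>) \<le> P3"
    using powr_bounded_above[OF r0(1)] by blast
  obtain P4 where P4: "P4 > 0" "\<And>r. r \<in> {r0..T} \<Longrightarrow> r powr (\<alpha> - \<gamma>) \<le> P4"
    using powr_bounded_above[OF r0(1)] by blast
  obtain P5 where P5: "P5 > 0" "\<And>r. r \<in> {r0..T} \<Longrightarrow> r powr \<gamma> \<le> P5"
    using powr_bounded_above[OF r0(1)] by blast
  let ?b = "\<lambda>r. w1 r - w2 r"
  let ?e = "\<lambda>r. energy r (u1 r) (w1 r) - energy r (u2 r) (w2 r)"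
  have yb: "\<bar>?y1 r - ?y2 r\<bar> \<le> P3 * \<bar>?b r\<bar>" if "r \<in> {r0..T}" for r
  proof -
    have "\<bar>?y1 r - ?y2 r\<bar> = r powr - \<alpha> * \<bar>?b r\<bar>" by (simp add: abs_mult flip: right_diff_distrib)
    also have "\<dots> \<le> P3 * \<bar>?b r\<bar>" using P3(2)[OF that] by (intro mult_right_mono) auto
    finally show ?thesis .
  qed
  define C0 where "C0 = (1 + P4 * (\<psi> Y * P3)) / (lam * m)"
  have C0: "C0 \<ge> 0" using P3 P4 lam_pos mB Y by (simp add: C0_def)
  have ube: "\<bar>u1 r - u2 r\<bar> \<le> C0 * (\<bar>?b r\<bar> + \<bar>?e r\<bar>)" if "r \<in> {r0..r1}" for r
  proof -
    have r: "r > 0" "r \<in> {r0..T}" "r \<in> {0..T}" using that r0 r1 by auto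
    have "lam * (m * \<bar>u1 r - u2 r\<bar>) \<le> lam * \<bar>F (u1 r) - F (u2 r)\<bar>"
      using Fexp[OF near[OF that]] lam_pos by (intro mult_left_mono) auto
    also have "\<dots> = \<bar>lam * (F (u1 r) - F (u2 r))\<bar>" using lam_pos by (simp add: abs_mult)
    also have "lam * (F (u1 r) - F (u2 r)) = ?e r - r powr (\<alpha> - \<gamma>) * (G (?y1 r) - G (?y2 r))"
      unfolding energy_def by (simp add: algebra_simps)
    also have "\<bar>\<dots>\<bar> \<le> \<bar>?e r\<bar> + \<bar>r powr (\<alpha> - \<gamma>) * (G (?y1 r) - G (?y2 r))\<bar>" by (rule abs_triangle_ineq4)
    also have "\<dots> = \<bar>?e r\<bar> + r powr (\<alpha> - \<gamma>) * \<bar>G (?y1 r) - G (?y2 r)\<bar>" by (simp add: abs_mult)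
    also have "\<dots> \<le> \<bar>?e r\<bar> + P4 * (\<psi> Y * \<bar>?y1 r - ?y2 r\<bar>)"
      by (intro add_left_mono mult_mono P4 G_lipschitz yY r) (use P4 in auto)
    also have "\<dots> \<le> \<bar>?e r\<bar> + P4 * (\<psi> Y * (P3 * \<bar>?b r\<bar>))"
      using yb[OF r(2)] P4 Y by (intro add_left_mono mult_left_mono) auto
    also have "\<dots> \<le> (1 + P4 * (\<psi> Y * P3)) * (\<bar>?b r\<bar> + \<bar>?e r\<bar>)"
      using P3 P4 Y by (simp add: algebra_simps)
    finally show ?thesis using lam_pos mB(1) by (simp add: C0_def field_simps)
  qed
  have "u1 r = u2 r \<and> w1 r = w2 r" if r: "r \<in> {r0..r1}" for r
  proof -
    let ?b' = "\<lambda>r. - (lam * r powr \<gamma> * f (u1 r)) - (- (lam * r powr \<gamma> * f (u2 r)))"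
    have zero: "?b r = 0 \<and> ?e r = 0"
    proof (rule gronwall_with_energy[OF 1 2 r0(1) r1(2) eq _ _ _ _ _ _ r, where x' = ?b'])
      show "continuous_on {r0..r1} ?b"
        using r0 r1 by (intro continuous_intros forced_cont(2)[OF 1] forced_cont(2)[OF 2]) auto
      show "(?b has_real_derivative ?b' s) (at s)" if "r0 < s" "s < r1" for s
        by (rule DERIV_diff[OF forcedD(6)[OF 1] forcedD(6)[OF 2]]) (use that r0 r1 in auto)
      fix s assume s: "s \<in> {r0..r1}"
      then have sr: "s \<in> {r0..T}" "s \<in> {0..T}" using r0 r1 by auto
      show "\<bar>?y1 s\<bar> \<le> Y \<and> \<bar>?y2 s\<bar> \<le> Y" using yY[OF sr(2)] by blast
      have "P3 * \<bar>?b s\<bar> \<le> P3 * (\<bar>?b s\<bar> + \<bar>?e s\<bar>)" using P3 by simp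
      with yb[OF sr(1)] show "\<bar>?y1 s - ?y2 s\<bar> \<le> P3 * (\<bar>?b s\<bar> + \<bar>?e s\<bar>)" by linarith
      have "\<bar>?b' s\<bar> = lam * s powr \<gamma> * \<bar>f (u1 s) - f (u2 s)\<bar>"
        using lam_pos by (simp add: abs_mult abs_minus_commute flip: right_diff_distrib)
      also have "\<dots> \<le> lam * P5 * (L * \<bar>u1 s - u2 s\<bar>)"
        using P5 sr s lam_pos by (intro mult_mono lip near) auto
      also have "\<dots> \<le> lam * P5 * (L * (C0 * (\<bar>?b s\<bar> + \<bar>?e s\<bar>)))"
        using ube[OF s] L P5 lam_pos by (intro mult_left_mono) auto
      finally show "\<bar>?b' s\<bar> \<le> lam * P5 * L * C0 * (\<bar>?b s\<bar> + \<bar>?e s\<bar>)" by (simp only: mult.assoc)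
    qed (use eq in auto)
    have "\<bar>u1 r - u2 r\<bar> \<le> 0"
      using ube[OF r] unfolding conjunct1[OF zero] conjunct2[OF zero] by simp
    then show ?thesis using zero by simp
  qed
  then show thesis using r1 that by blast
qed

lemma sol_unique:
  assumes 1: "sol T d u1 w1" and 2: "sol T d u2 w2" and d: "d > 0" and r: "r \<in> {0..T}"
  shows "u1 r = u2 r" "w1 r = w2 r"
proof -
  have "u1 r = u2 r \<and> w1 r = w2 r"
  proof (cases "T > 0")
    case False
    then have "r = 0" using r by auto
    then show ?thesis using forcedD(3,4)[OF 1] forcedD(3,4)[OF 2] by auto
  next
    case True
    define S where "S = {s \<in> {0..T}. \<forall>r\<in>{0..s}. u1 r = u2 r \<and> w1 r = w2 r}"
    obtain \<rho> where rho: "0 < \<rho>" "\<rho> \<le> T" "\<And>r. r \<in> {0..\<rho>} \<Longrightarrow> u1 r = u2 r"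
      using sol_agree_near_0[OF 1 2 d True] by blast
    \<comment> \<open>Where u1 and u2 agree, both pairs are driven by the same forcing, hence the
      fluxes agree too.\<close>
    have "forced \<rho> d (\<lambda>r. f (u1 r)) u1 w1" using forced_subinterval[OF 1 rho(2)] .
    moreover have "forced \<rho> d (\<lambda>r. f (u1 r)) u2 w2"
      by (rule forced_cong_forcing[OF forced_subinterval[OF 2 rho(2)]]) (use rho in auto)
    ultimately have "\<rho> \<in> S" unfolding S_def using rho by (auto intro: forced_unique)
    have S_bdd: "bdd_above S" by (auto simp: S_def)
    define s where "s = Sup S"
    have "\<rho> \<le> s" unfolding s_def by (rule cSup_upper[OF \<open>\<rho> \<in> S\<close> S_bdd])
    moreover have "s \<le> T" unfolding s_def
      by (rule cSup_least) (use \<open>\<rho> \<in> S\<close> in \<open>auto simp: S_def\<close>)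
    ultimately have s: "\<rho> \<le> s" "s \<le> T" by auto
    have agree: "u1 r = u2 r \<and> w1 r = w2 r" if "r \<in> {0..<s}" for r
    proof -
      have "S \<noteq> {}" "r < Sup S" using that \<open>\<rho> \<in> S\<close> by (auto simp: s_def)
      then obtain x where "x \<in> S" "r < x" by (meson less_cSupD)
      then show ?thesis using that by (auto simp: S_def)
    qed
    have cl: "closure {0..<s} = {0..s}" using rho s by (intro closure_atLeastLessThan) auto
    have "u1 r - u2 r = 0" if "r \<in> {0..s}" for r
      by (rule continuous_constant_on_closure[of "{0..<s}" "\<lambda>r. u1 r - u2 r"])
        (use agree that s cl in \<open>auto intro!: continuous_intros forced_cont(1)[OF 1] forced_cont(1)[OF 2]\<close>)
    moreover have "w1 r - w2 r = 0" if "r \<in> {0..s}" for r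
      by (rule continuous_constant_on_closure[of "{0..<s}" "\<lambda>r. w1 r - w2 r"])
        (use agree that s cl in \<open>auto intro!: continuous_intros forced_cont(2)[OF 1] forced_cont(2)[OF 2]\<close>)
    ultimately have agree: "u1 r = u2 r \<and> w1 r = w2 r" if "r \<in> {0..s}" for r using that by force
    have "s = T"
    proof (rule ccontr)
      assume "s \<noteq> T"
      then have sT: "0 < s" "s < T" using s rho by auto
      have eq: "u1 s = u2 s" "w1 s = w2 s" using agree[of s] sT by auto
      \<comment> \<open>At \<open>s\<close> the value and the flux are not both 0, so one of the two
        local results extends the agreement beyond \<open>s\<close>.\<close>
      obtain x where x: "s < x" "x < T" "\<And>r. r \<in> {s..x} \<Longrightarrow> u1 r = u2 r \<and> w1 r = w2 r"
      proof (cases "u1 s = 0")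
        case True
        then have "w1 s \<noteq> 0" using sol_nonvanishing[OF 1 d] sT by auto
        then show thesis using sol_agree_right_of_nonzero_flux[OF 1 2 sT eq] that by blast
      next
        case False
        then show thesis using sol_agree_right_of_nonzero_value[OF 1 2 sT eq] that by blast
      qed
      have "u1 r = u2 r \<and> w1 r = w2 r" if "r \<in> {0..x}" for r
        using agree[of r] x(3)[of r] that by (cases "r \<le> s") auto
      then have "x \<in> S" using x sT by (auto simp: S_def)
      then show False using cSup_upper[OF _ S_bdd, of x] x by (auto simp: s_def)
    qed
    then show ?thesis using agree r by simp
  qed
  then show "u1 r = u2 r" "w1 r = w2 r" by auto
qed

end

section \<open>Existence, continuous dependence and oscillation\<close>

text \<open>These assumptions will be met by the truncation of the given nonlinearity.
  \<open>\<Psi>\<close> is only continuous at 0, where its derivative may be infinite; its existence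
  expresses condition \<open>(f\<^sub>3)\<close>.\<close>

locale bounded_ivp_system = ivp_system +
  fixes f_max :: real and \<Psi> :: "real \<Rightarrow> real"
  assumes f_le_max: "\<bar>f x\<bar> \<le> f_max"
    and f_mono: "mono f"
    and Psi_cont: "continuous_on UNIV \<Psi>"
    and Psi_0: "\<Psi> 0 = 0"
    and Psi_deriv: "x \<noteq> 0 \<Longrightarrow> (\<Psi> has_real_derivative \<bar>f x\<bar> powr (- p)) (at x)"
begin

lemma f_max_pos: "f_max > 0"
  using f_le_max[of 1] f_pos[of 1] by simp

lemma forced_cong:
  assumes "forced T d q u w" "\<And>r. r \<in> {0..T} \<Longrightarrow> u r = u' r" "\<And>r. r \<in> {0..T} \<Longrightarrow> w r = w' r" "0 \<le> T"
  shows "forced T d q u' w'"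
proof -
  have "continuous_on {0..T} u'" "continuous_on {0..T} w'"
    using forcedD(1,2)[OF assms(1)] assms(2,3) by (metis continuous_on_eq)+
  moreover have "u' 0 = d" "w' 0 = 0" using forcedD(3,4)[OF assms(1)] assms by auto
  moreover have "(u' has_real_derivative \<psi> (r powr - \<alpha> * w' r)) (at r)"
      "(w' has_real_derivative - (lam * r powr \<gamma> * q r)) (at r)" if "0 < r" "r < T" for r
  proof -
    have "(u' has_real_derivative \<psi> (rflux w r)) (at r)"
      by (rule has_field_derivative_transform_within_open[OF forcedD(5)[OF assms(1) that], of "{0<..<T}"])
        (use assms(2) that in auto)
    then show "(u' has_real_derivative \<psi> (r powr - \<alpha> * w' r)) (at r)" using assms(3)[of r] that by simp
    show "(w' has_real_derivative - (lam * r powr \<gamma> * q r)) (at r)"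
      by (rule has_field_derivative_transform_within_open[OF forcedD(6)[OF assms(1) that], of "{0<..<T}"])
        (use assms(3) that in auto)
  qed
  ultimately show ?thesis unfolding forced_def by blast
qed

text \<open>Tonelli's delayed equation can be solved by steps of length \<open>h\<close>.\<close>

lemma delayed_sol_exists:
  assumes h: "h > 0"
  shows "\<exists>u w. forced T d (\<lambda>r. f (u (max 0 (r - h)))) u w"
proof -
  have "\<exists>u w. forced (h * real n) d (\<lambda>r. f (u (max 0 (r - h)))) u w" for n
  proof (induction n)
    case 0
    show ?case by (rule exI[of _ "\<lambda>_. d"], rule exI[of _ "\<lambda>_. 0"]) (auto simp: forced_def)
  next
    case (Suc n)
    then obtain u w where uw: "forced (h * real n) d (\<lambda>r. f (u (max 0 (r - h)))) u w" by blast
    let ?q = "\<lambda>r. f (u (max 0 (r - h)))"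
    have "continuous_on {0..h * real (Suc n)} ?q"
      by (intro f_continuous_on continuous_on_compose2[OF forcedD(1)[OF uw]] continuous_intros)
        (use h in \<open>auto simp: algebra_simps\<close>)
    then obtain u' w' where u'w': "forced (h * real (Suc n)) d ?q u' w'"
      using forced_exists[of "h * real (Suc n)" ?q d] h by auto
    \<comment> \<open>On the earlier interval \<open>u'\<close> must coincide with \<open>u\<close>,
      because the delayed forcing is to be expressed through the new function itself.\<close>
    have "forced (h * real n) d ?q u' w'"
      using h by (intro forced_subinterval[OF u'w']) (auto simp: algebra_simps)
    then have eq: "u' r = u r" if "0 \<le> r" "r \<le> h * real n" for r
      using that by (intro forced_unique(2)[OF _ uw]) auto
    have "forced (h * real (Suc n)) d (\<lambda>r. f (u' (max 0 (r - h)))) u' w'"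
    proof (rule forced_cong_forcing[OF u'w'])
      fix r assume "0 < r" "r < h * real (Suc n)"
      then have "0 \<le> max 0 (r - h)" "max 0 (r - h) \<le> h * real n" using h by (auto simp: algebra_simps)
      then show "?q r = f (u' (max 0 (r - h)))" using eq by simp
    qed
    then show ?case by blast
  qed
  moreover obtain n where "T / h < real n" using reals_Archimedean2 by blast
  then have "T \<le> h * real n" using h by (simp add: field_simps)
  ultimately show ?thesis using forced_subinterval by blast
qed

text \<open>Initial values and delays vary together so that one compactness argument serves twice:
  delays tending to 0 with fixed d give existence, delay 0 with varying d gives continuous
  dependence. The bound \<open>f_max\<close> makes all u n Lipschitz with one constant.\<close>

lemma delayed_sols_subseq_converges:
  assumes T: "T > 0"
    and u: "\<And>n. forced T (d n) (\<lambda>r. f (u n (max 0 (r - h n)))) (u n) (w n)"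
    and d: "d \<longlonglongrightarrow> d0" and h: "h \<longlonglongrightarrow> 0" "\<And>n. 0 \<le> h n"
  shows "\<exists>k u0 w0. strict_mono (k :: nat \<Rightarrow> nat) \<and> sol T d0 u0 w0 \<and>
    (\<forall>e>0. \<exists>N. \<forall>n\<ge>N. \<forall>r\<in>{0..T}. \<bar>u (k n) r - u0 r\<bar> < e \<and> \<bar>w (k n) r - w0 r\<bar> < e)"
proof -
  define C where "C = \<psi> (ymax f_max T)"
  have C: "C \<ge> 0" unfolding C_def ymax_def using f_max_pos lam_pos gamma_nonneg by simp
  have lip: "\<bar>u n r - u n s\<bar> \<le> C * \<bar>r - s\<bar>" if "r \<in> {0..T}" "s \<in> {0..T}" for n r s
    unfolding C_def by (rule forced_lipschitz[OF u]) (use f_le_max f_max_pos that in auto)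
  have "Bseq d" using d by (intro convergent_imp_Bseq) (auto simp: convergent_def)
  then obtain D where D: "\<And>n. \<bar>d n\<bar> \<le> D" unfolding Bseq_def by auto
  have bdd: "\<bar>u n r\<bar> \<le> D + C * T" if "r \<in> {0..T}" for n r
  proof -
    have "\<bar>u n r - u n 0\<bar> \<le> C * \<bar>r - 0\<bar>" by (rule lip) (use that T in auto)
    also have "\<dots> \<le> C * T" using that C by (intro mult_left_mono) auto
    finally show ?thesis using D[of n] forcedD(3)[OF u, of n] by simp
  qed
  obtain g k where g: "continuous_on {0..T} g" "strict_mono (k :: nat \<Rightarrow> nat)"
    "\<And>e. 0 < e \<Longrightarrow> \<exists>N. \<forall>n r. n \<ge> N \<and> r \<in> {0..T} \<longrightarrow> norm (u (k n) r - g r) < e"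
  proof (rule Arzela_Ascoli[of "{0..T}" u "D + C * T"])
    fix x e :: real assume x: "x \<in> {0..T}" and e: "0 < e"
    show "\<exists>d>0. \<forall>n y. y \<in> {0..T} \<and> norm (x - y) < d \<longrightarrow> norm (u n x - u n y) < e"
    proof (intro exI conjI allI impI)
      show "0 < e / (C + 1)" using e C by simp
      fix n y assume y: "y \<in> {0..T} \<and> norm (x - y) < e / (C + 1)"
      have "norm (u n x - u n y) \<le> C * \<bar>x - y\<bar>" using lip x y by simp
      also have "\<dots> \<le> (C + 1) * \<bar>x - y\<bar>" by (intro mult_right_mono) auto
      also have "\<dots> < e" using y C by (simp add: field_simps)
      finally show "norm (u n x - u n y) < e" .
    qed
  qed (use bdd in auto)
  have "continuous_on {0..T} (\<lambda>r. f (g r))" using g(1) by (rule f_continuous_on)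
  \<comment> \<open>Instead of passing to the limit in the equations, solve the problem driven by
    f(g). By \<open>forced_close\<close> the subsequence also converges to this solution, so
    \<open>u0 = g\<close> and the forcing is f(u0).\<close>
  then obtain u0 w0 where uw0: "forced T d0 (\<lambda>r. f (g r)) u0 w0" using forced_exists T by blast
  have conv: "\<exists>N. \<forall>n\<ge>N. \<forall>r\<in>{0..T}. \<bar>u (k n) r - u0 r\<bar> < e \<and> \<bar>w (k n) r - w0 r\<bar> < e" if e: "e > 0" for e
  proof -
    obtain \<delta> where del: "\<delta> > 0" "\<And>d1 d2 q1 q2 u1 w1 u2 w2.
      forced T d1 q1 u1 w1 \<Longrightarrow> forced T d2 q2 u2 w2 \<Longrightarrow>
      (\<forall>r. 0 < r \<and> r < T \<longrightarrow> \<bar>q1 r\<bar> \<le> f_max \<and> \<bar>q2 r\<bar> \<le> f_max \<and> \<bar>q1 r - q2 r\<bar> \<le> \<delta>) \<Longrightarrow>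
      (\<forall>r\<in>{0..T}. \<bar>u1 r - u2 r\<bar> \<le> \<bar>d1 - d2\<bar> + e / 4 \<and> \<bar>w1 r - w2 r\<bar> \<le> e / 4)"
      using forced_close[of f_max T "e / 4"] f_max_pos T e by auto
    \<comment> \<open>All u n take values in [-X, X] on [0, T], and \<open>g\<close> is somewhere
      within 1 of one of them; uniform continuity of f is used on the enlarged interval.\<close>
    define X where "X = D + C * T"
    have gX: "\<bar>g r\<bar> \<le> X + 1" if r: "r \<in> {0..T}" for r
    proof -
      obtain n where "norm (u (k n) r - g r) < 1" using g(3)[of 1] r by auto
      then show ?thesis using bdd[OF r, of "k n"] by (simp add: X_def)
    qed
    have "uniformly_continuous_on {- (X + 1)..X + 1} f"
      by (rule compact_uniformly_continuous) (auto intro: continuous_on_subset[OF f_cont])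
    then obtain \<eta> where eta: "\<eta> > 0" "\<And>x y. x \<in> {- (X + 1)..X + 1} \<Longrightarrow> y \<in> {- (X + 1)..X + 1} \<Longrightarrow>
        \<bar>y - x\<bar> < \<eta> \<Longrightarrow> \<bar>f y - f x\<bar> < \<delta>"
      using del(1) unfolding uniformly_continuous_on_def dist_real_def by metis
    obtain N1 where N1: "\<And>n r. n \<ge> N1 \<Longrightarrow> r \<in> {0..T} \<Longrightarrow> \<bar>u (k n) r - g r\<bar> < \<eta> / 2"
      using g(3)[of "\<eta> / 2"] eta(1) by auto
    have hk: "(\<lambda>n. h (k n)) \<longlonglongrightarrow> 0" and dk: "(\<lambda>n. d (k n)) \<longlonglongrightarrow> d0"
      using LIMSEQ_subseq_LIMSEQ[OF h(1) g(2)] LIMSEQ_subseq_LIMSEQ[OF d g(2)] by (auto simp: o_def)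
    obtain N2 where N2: "\<And>n. n \<ge> N2 \<Longrightarrow> \<bar>h (k n)\<bar> < \<eta> / (2 * (C + 1))"
      using LIMSEQ_D[OF hk, of "\<eta> / (2 * (C + 1))"] eta(1) C by auto
    obtain N3 where N3: "\<And>n. n \<ge> N3 \<Longrightarrow> \<bar>d (k n) - d0\<bar> < e / 4"
      using LIMSEQ_D[OF dk, of "e / 4"] e by auto
    show ?thesis
    proof (intro exI[of _ "max N1 (max N2 N3)"] allI impI)
      fix n assume n: "n \<ge> max N1 (max N2 N3)"
      have "\<bar>f (u (k n) (max 0 (r - h (k n)))) - f (g r)\<bar> \<le> \<delta>" if r: "0 < r" "r < T" for r
      proof -
        let ?s = "max 0 (r - h (k n))"
        have s: "?s \<in> {0..T}" "\<bar>?s - r\<bar> \<le> \<bar>h (k n)\<bar>" using r h(2)[of "k n"] by auto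
        have "\<bar>u (k n) ?s - u (k n) r\<bar> \<le> C * \<bar>?s - r\<bar>" using lip[OF s(1), of r] r by simp
        also have "\<dots> \<le> (C + 1) * \<bar>h (k n)\<bar>" using s C by (intro mult_mono) auto
        also have "\<dots> < \<eta> / 2" using N2[of n] n C by (simp add: field_simps)
        finally have "\<bar>u (k n) ?s - u (k n) r\<bar> < \<eta> / 2" .
        moreover have "\<bar>u (k n) r - g r\<bar> < \<eta> / 2" using N1[of n r] n r by simp
        ultimately have "\<bar>u (k n) ?s - g r\<bar> < \<eta>" by linarith
        then show ?thesis
          using bdd[OF s(1), of "k n"] gX[of r] r
          by (intro less_imp_le eta(2)) (auto simp: X_def abs_le_iff)
      qed
      then have "\<forall>r. 0 < r \<and> r < T \<longrightarrow> \<bar>f (u (k n) (max 0 (r - h (k n))))\<bar> \<le> f_max \<and> \<bar>f (g r)\<bar> \<le> f_max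
          \<and> \<bar>f (u (k n) (max 0 (r - h (k n)))) - f (g r)\<bar> \<le> \<delta>"
        using f_le_max by blast
      from del(2)[OF u uw0 this]
      show "\<forall>r\<in>{0..T}. \<bar>u (k n) r - u0 r\<bar> < e \<and> \<bar>w (k n) r - w0 r\<bar> < e"
        using N3[of n] n e by fastforce
    qed
  qed
  have "g r = u0 r" if r: "r \<in> {0..T}" for r
  proof (rule ccontr)
    assume "g r \<noteq> u0 r"
    then have e: "\<bar>g r - u0 r\<bar> / 2 > 0" by simp
    obtain N1 where "\<And>n. n \<ge> N1 \<Longrightarrow> \<bar>u (k n) r - g r\<bar> < \<bar>g r - u0 r\<bar> / 2"
      using g(3)[OF e] r by auto
    moreover obtain N2 where "\<And>n. n \<ge> N2 \<Longrightarrow> \<bar>u (k n) r - u0 r\<bar> < \<bar>g r - u0 r\<bar> / 2"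
      using conv[OF e] r by blast
    ultimately have "\<bar>u (k (max N1 N2)) r - g r\<bar> < \<bar>g r - u0 r\<bar> / 2"
      "\<bar>u (k (max N1 N2)) r - u0 r\<bar> < \<bar>g r - u0 r\<bar> / 2" by auto
    then show False by (smt (verit) field_sum_of_halves)
  qed
  then have "sol T d0 u0 w0" by (intro forced_cong_forcing[OF uw0]) auto
  then show ?thesis using g(2) conv by blast
qed

lemma sol_exists:
  assumes "T > 0"
  shows "\<exists>u w. sol T d u w"
proof -
  let ?h = "\<lambda>n. inverse (real (Suc n))"
  have "\<forall>n. \<exists>u w. forced T d (\<lambda>r. f (u (max 0 (r - ?h n)))) u w"
    by (intro allI delayed_sol_exists) simp
  then obtain u w where "\<And>n. forced T d (\<lambda>r. f (u n (max 0 (r - ?h n)))) (u n) (w n)" by metis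
  from delayed_sols_subseq_converges[OF assms this tendsto_const LIMSEQ_inverse_real_of_nat]
  show ?thesis by auto
qed

text \<open>Otherwise there are solutions with initial values tending to \<open>d0\<close> that stay
  \<open>e\<close>-far from \<open>u0\<close> or \<open>w0\<close>. A subsequence converges to a
  solution starting at \<open>d0\<close>, which by uniqueness is the given one.\<close>

lemma sol_continuous_dependence:
  assumes T: "T > 0" and d0: "d0 > 0" and e: "e > 0" and 0: "sol T d0 u0 w0"
  obtains \<delta> where "\<delta> > 0"
    "\<And>d u w r. \<bar>d - d0\<bar> < \<delta> \<Longrightarrow> sol T d u w \<Longrightarrow> r \<in> {0..T} \<Longrightarrow> \<bar>u r - u0 r\<bar> < e \<and> \<bar>w r - w0 r\<bar> < e"
proof -
  let ?close = "\<lambda>\<delta> d u w r. \<bar>d - d0\<bar> < \<delta> \<longrightarrow> sol T d u w \<longrightarrow> r \<in> {0..T} \<longrightarrow> \<bar>u r - u0 r\<bar> < e \<and> \<bar>w r - w0 r\<bar> < e"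
  have "\<exists>\<delta>>0. \<forall>d u w r. ?close \<delta> d u w r"
  proof (rule ccontr)
    assume neg: "\<not> ?thesis"
    have "\<forall>n. \<exists>d u w r. \<not> ?close (inverse (real (Suc n))) d u w r"
    proof
      fix n
      have "inverse (real (Suc n)) > 0" by simp
      then show "\<exists>d u w r. \<not> ?close (inverse (real (Suc n))) d u w r" using neg by blast
    qed
    then obtain d u w r where *: "\<And>n. \<bar>d n - d0\<bar> < inverse (real (Suc n))" "\<And>n. sol T (d n) (u n) (w n)"
      "\<And>n. r n \<in> {0..T}" "\<And>n. \<not> (\<bar>u n (r n) - u0 (r n)\<bar> < e \<and> \<bar>w n (r n) - w0 (r n)\<bar> < e)"
      by metis
    have "(\<lambda>n. d n - d0) \<longlonglongrightarrow> 0"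
      by (rule Lim_null_comparison[OF _ LIMSEQ_inverse_real_of_nat]) (use *(1) in \<open>auto intro!: always_eventually less_imp_le\<close>)
    then have d: "d \<longlonglongrightarrow> d0" by (simp add: LIM_zero_iff)
    have "forced T (d n) (\<lambda>r. f (u n (max 0 (r - (\<lambda>_. 0) n)))) (u n) (w n)" for n
      by (rule forced_cong_forcing[OF *(2)]) auto
    from delayed_sols_subseq_converges[OF T this d tendsto_const order_refl]
    obtain k :: "nat \<Rightarrow> nat" and u1 w1 where k: "sol T d0 u1 w1"
      "\<And>e. e > 0 \<Longrightarrow> \<exists>N. \<forall>n\<ge>N. \<forall>r\<in>{0..T}. \<bar>u (k n) r - u1 r\<bar> < e \<and> \<bar>w (k n) r - w1 r\<bar> < e"
      by blast
    then obtain N where "\<forall>r\<in>{0..T}. \<bar>u (k N) r - u1 r\<bar> < e \<and> \<bar>w (k N) r - w1 r\<bar> < e"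
      using e by blast
    then show False using *(3,4)[of "k N"] sol_unique[OF k(1) 0 d0] by fastforce
  qed
  then show thesis using that by blast
qed

lemma global_sol_exists:
  assumes d: "d > 0"
  shows "\<exists>u w. \<forall>T>0. sol T d u w"
proof -
  have "\<forall>n. \<exists>u w. sol (real (Suc n)) d u w" by (intro allI sol_exists) simp
  then obtain U W where UW: "\<And>n. sol (real (Suc n)) d (U n) (W n)" by metis
  \<comment> \<open>The index depends on the point r; by uniqueness the choice among the solutions
    defined up to r is immaterial.\<close>
  define N where "N = (\<lambda>r::real. nat \<lceil>r\<rceil>)"
  have N: "r \<le> real (Suc (N r))" for r unfolding N_def by linarith
  have "sol T d (\<lambda>r. U (N r) r) (\<lambda>r. W (N r) r)" if T: "T > 0" for T
  proof -
    have *: "sol T d (U (N T)) (W (N T))" by (rule forced_subinterval[OF UW N])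
    have eq: "U (N T) r = U (N r) r \<and> W (N T) r = W (N r) r" if r: "r \<in> {0..T}" for r
      using sol_unique[OF forced_subinterval[OF * , of r] forced_subinterval[OF UW N, of r] d, of r] r by auto
    show ?thesis
      by (rule forced_cong[OF forced_cong_forcing[OF *]]) (use eq T in auto)
  qed
  then show ?thesis by (intro exI allI impI)
qed

section \<open>Oscillation\<close>

lemma Psi_continuous_on [continuous_intros]:
  "continuous_on S g \<Longrightarrow> continuous_on S (\<lambda>x. \<Psi> (g x))"
  using continuous_on_compose2[OF Psi_cont] by blast

lemma Psi_mono:
  assumes "0 \<le> x" "x \<le> y"
  shows "\<Psi> x \<le> \<Psi> y"
proof -
  have "0 * (y - x) \<le> \<Psi> y - \<Psi> x"
    by (rule le_diff_of_deriv_ge[where f' = "\<lambda>x. \<bar>f x\<bar> powr (- p)"])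
      (use assms in \<open>auto intro!: continuous_intros Psi_deriv\<close>)
  then show ?thesis by simp
qed

text \<open>The factor that \<open>psi_lower\<close> gives between \<open>\<psi> (k * y)\<close> and
  \<open>y powr p\<close> when y ranges up to \<open>f_max\<close>.\<close>

definition "osc_const k = \<psi> (k * f_max) / f_max powr p"

lemma osc_const_pos: "k > 0 \<Longrightarrow> osc_const k > 0"
  using f_max_pos by (simp add: osc_const_def)

lemma psi_mult_f_ge:
  assumes "k > 0" "x > 0"
  shows "osc_const k * f x powr p \<le> \<psi> (k * f x)"
proof -
  have "0 < f x" "f x \<le> f_max" using f_pos[OF assms(2)] f_le_max[of x] by auto
  then have "\<psi> (k * f_max) * (k * f x / (k * f_max)) powr p \<le> \<psi> (k * f x)"
    using assms by (intro psi_lower) auto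
  then show ?thesis
    using assms \<open>0 < f x\<close> f_max_pos by (simp add: osc_const_def powr_divide)
qed

text \<open>The quotient r / a lies in [1, 2]; its power with exponent - \<alpha> is least at 2 or
  at 1, according to the sign of \<open>\<alpha>\<close>.\<close>

lemma dyadic_powr_ge:
  assumes "0 < a" "a \<le> r" "r \<le> 2 * a"
  shows "a powr - \<alpha> * min 1 (2 powr - \<alpha>) \<le> r powr - \<alpha>"
proof -
  have "min 1 (2 powr - \<alpha>) \<le> (r / a) powr - \<alpha>"
  proof (cases "\<alpha> \<ge> 0")
    case True
    have "2 powr - \<alpha> \<le> (r / a) powr - \<alpha>" using assms True by (intro powr_mono2') (auto simp: field_simps)
    then show ?thesis by simp
  next
    case False
    have "1 \<le> (r / a) powr - \<alpha>" using assms False by (intro ge_one_powr_ge_zero) (auto simp: field_simps)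
    then show ?thesis by simp
  qed
  then have "a powr - \<alpha> * min 1 (2 powr - \<alpha>) \<le> a powr - \<alpha> * (r / a) powr - \<alpha>"
    by (intro mult_left_mono) auto
  then show ?thesis using assms by (simp add: powr_divide)
qed

text \<open>
  On the half of \<open>[a, 2a]\<close> on which \<open>u\<close> moves away from the midpoint, \<open>\<bar>u'\<bar> \<ge> \<psi> (k f(u))\<close> holds at
  distance at least \<open>a / 4\<close> from the midpoint, so that \<open>\<Psi> \<circ> u\<close> changes at a definite rate.
\<close>

lemma positive_on_dyadic_imp_Psi_ge:
  assumes s: "sol T d u w" and a: "0 < a" "2 * a < T"
    and u: "\<And>r. r \<in> {a..2 * a} \<Longrightarrow> 0 < u r \<and> u r \<le> M"
    and k: "0 < k" "k \<le> lam * a powr (\<gamma> - \<alpha>) * min 1 (2 powr - \<alpha>) * (a / 4)"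
  shows "osc_const k * (a / 4) \<le> \<Psi> M"
proof -
  define c where "c = 3 * a / 2"
  have fu: "0 < f (u r)" if "r \<in> {a..2 * a}" for r using u[OF that] f_pos by auto
  have ucont: "continuous_on {x..y} u" and wcont: "continuous_on {x..y} w" if "a \<le> x" "y \<le> 2 * a" for x y
    using that a by (auto intro: forced_cont(1)[OF s] forced_cont(2)[OF s])
  have du: "(u has_real_derivative \<psi> (rflux w r)) (at r)"
    and dw: "(w has_real_derivative - (lam * r powr \<gamma> * f (u r))) (at r)" if "r \<in> {a..2 * a}" for r
    using forcedD(5,6)[OF s, of r] that a by auto
  \<comment> \<open>\<open>sg\<close> is the sign of w, hence of u', on the quarter starting at
    \<open>x\<close>, and \<open>v\<close> is a lower bound of the modulus of w there.\<close>
  have quarter: "osc_const k * (a / 4) \<le> \<Psi> M"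
    if x: "a \<le> x" "x \<le> 7 * a / 4" and sg: "sg = 1 \<or> sg = - 1"
      and v: "\<And>r. x < r \<Longrightarrow> r < x + a / 4 \<Longrightarrow> lam * a powr \<gamma> * f (u r) * (a / 4) \<le> sg * w r" for x sg
  proof -
    have "osc_const k * (x + a / 4 - x) \<le> (\<lambda>r. sg * \<Psi> (u r)) (x + a / 4) - (\<lambda>r. sg * \<Psi> (u r)) x"
    proof (rule le_diff_of_deriv_ge[where f' = "\<lambda>r. sg * (\<bar>f (u r)\<bar> powr (- p) * \<psi> (rflux w r))"])
      fix r assume xr: "x < r" "r < x + a / 4"
      then have r: "r \<in> {a..2 * a}" using x a by auto
      show "((\<lambda>r. sg * \<Psi> (u r)) has_real_derivative sg * (\<bar>f (u r)\<bar> powr (- p) * \<psi> (rflux w r))) (at r)"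
        by (rule DERIV_cmult[OF DERIV_chain2[OF Psi_deriv du[OF r]]]) (use u[OF r] in auto)
      have "k * f (u r) \<le> (lam * a powr (\<gamma> - \<alpha>) * min 1 (2 powr - \<alpha>) * (a / 4)) * f (u r)"
        using k fu[OF r] by (intro mult_right_mono) auto
      also have "\<dots> = (a powr - \<alpha> * min 1 (2 powr - \<alpha>)) * (lam * a powr \<gamma> * f (u r) * (a / 4))"
        by (simp add: powr_diff powr_minus field_simps)
      also have "\<dots> \<le> r powr - \<alpha> * (sg * w r)"
        using r a fu[OF r] lam_pos by (intro mult_mono dyadic_powr_ge v xr) auto
      finally have rate: "k * f (u r) \<le> r powr - \<alpha> * (sg * w r)" .
      have "osc_const k * f (u r) powr p \<le> \<psi> (k * f (u r))" using psi_mult_f_ge[OF k(1)] u[OF r] by blast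
      also have "\<dots> \<le> \<psi> (r powr - \<alpha> * (sg * w r))" using rate by simp
      also have "\<dots> = sg * \<psi> (rflux w r)" using sg psi_odd[of "rflux w r"] by auto
      \<comment> \<open>The derivative of \<open>\<Psi>\<close> contributes exactly the power of f
        that cancels \<open>f (u r) powr p\<close>, leaving a rate independent of u.\<close>
      finally have "f (u r) powr (- p) * (osc_const k * f (u r) powr p) \<le> f (u r) powr (- p) * (sg * \<psi> (rflux w r))"
        by (intro mult_left_mono) auto
      moreover have "f (u r) powr (- p) * (osc_const k * f (u r) powr p) = osc_const k"
        using fu[OF r] by (simp add: powr_minus)
      ultimately have "osc_const k \<le> f (u r) powr (- p) * (sg * \<psi> (rflux w r))" by linarith
      then show "osc_const k \<le> sg * (\<bar>f (u r)\<bar> powr (- p) * \<psi> (rflux w r))"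
        using fu[OF r] by (simp add: mult.left_commute)
    qed (use x a in \<open>auto intro!: continuous_intros ucont\<close>)
    \<comment> \<open>Both values of \<open>\<Psi>\<close> lie between 0 and
      \<open>\<Psi> M\<close>, so their difference is at most \<open>\<Psi> M\<close> for either
      sign \<open>sg\<close>.\<close>
    also have "\<dots> \<le> \<Psi> M"
      using Psi_mono[of "u x" M] Psi_mono[of "u (x + a / 4)" M] Psi_mono[of 0 "u x"] Psi_mono[of 0 "u (x + a / 4)"]
        u[of x] u[of "x + a / 4"] x a Psi_0 sg by auto
    finally show ?thesis by simp
  qed
  have wdecr: "w y \<le> w x" if "a \<le> x" "x \<le> y" "y \<le> 2 * a" for x y
  proof (rule DERIV_nonpos_imp_nonincreasing[OF that(2)])
    fix r assume "x \<le> r" "r \<le> y"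
    then have r: "r \<in> {a..2 * a}" using that by auto
    show "\<exists>D. (w has_real_derivative D) (at r) \<and> D \<le> 0"
      by (intro exI conjI, rule dw[OF r]) (use fu[OF r] lam_pos in simp)
  qed
  \<comment> \<open>\<open>z\<close> will be the end of the interval where u is least; monotonicity
    of f then bounds the rate of change of w by the value at \<open>z\<close>.\<close>
  have wgain: "lam * a powr \<gamma> * f (u z) * (y - x) \<le> w x - w y"
    if xy: "a \<le> x" "x \<le> y" "y \<le> 2 * a" and z: "z \<in> {a..2 * a}" and uz: "\<And>r. x < r \<Longrightarrow> r < y \<Longrightarrow> u z \<le> u r" for x y z
  proof -
    have "lam * a powr \<gamma> * f (u z) * (y - x) \<le> (\<lambda>r. - w r) y - (\<lambda>r. - w r) x"
    proof (rule le_diff_of_deriv_ge[where f' = "\<lambda>r. - (- (lam * r powr \<gamma> * f (u r)))"])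
      fix r assume xr: "x < r" "r < y"
      then have r: "r \<in> {a..2 * a}" using xy by auto
      show "((\<lambda>r. - w r) has_real_derivative - (- (lam * r powr \<gamma> * f (u r)))) (at r)"
        by (rule DERIV_minus[OF dw[OF r]])
      have "a powr \<gamma> \<le> r powr \<gamma>" using r a gamma_nonneg by (intro powr_mono2) auto
      moreover have "f (u z) \<le> f (u r)" by (rule monoD[OF f_mono uz[OF xr]])
      ultimately show "lam * a powr \<gamma> * f (u z) \<le> - (- (lam * r powr \<gamma> * f (u r)))"
        using fu[OF z] lam_pos by (auto intro!: mult_mono)
    qed (use xy wcont in \<open>auto intro!: continuous_intros\<close>)
    then show ?thesis by simp
  qed
  show ?thesis
  \<comment> \<open>w is nonincreasing because f(u) > 0. If it is nonnegative at the midpoint, u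
    increases up to \<open>c\<close> and the first quarter is used; otherwise u decreases after
    \<open>c\<close> and the last quarter is used. Both quarters are at distance a / 4 from
    \<open>c\<close>, which gives the factor in \<open>v\<close>.\<close>
  proof (cases "w c \<ge> 0")
    case True
    have uincr: "u x \<le> u y" if "a \<le> x" "x \<le> y" "y \<le> c" for x y
    proof (rule DERIV_nonneg_imp_nondecreasing[OF that(2)])
      fix r assume "x \<le> r" "r \<le> y"
      then have r: "r \<in> {a..2 * a}" "w c \<le> w r" using that a by (auto simp: c_def intro!: wdecr)
      show "\<exists>D. (u has_real_derivative D) (at r) \<and> 0 \<le> D"
        by (intro exI conjI, rule du[OF r(1)]) (use r(2) True in simp)
    qed
    show ?thesis
    proof (rule quarter[of a 1])
      fix r assume r: "a < r" "r < a + a / 4"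
      then have rr: "r \<in> {a..2 * a}" using a by auto
      have "lam * a powr \<gamma> * f (u r) * (a / 4) \<le> lam * a powr \<gamma> * f (u r) * (c - r)"
        using r fu[OF rr] lam_pos by (intro mult_left_mono) (auto simp: c_def)
      also have "\<dots> \<le> w r - w c"
        by (rule wgain) (use r a rr uincr in \<open>auto simp: c_def\<close>)
      finally show "lam * a powr \<gamma> * f (u r) * (a / 4) \<le> 1 * w r" using True by simp
    qed (use a in auto)
  next
    case False
    have udecr: "u y \<le> u x" if "c \<le> x" "x \<le> y" "y \<le> 2 * a" for x y
    proof (rule DERIV_nonpos_imp_nonincreasing[OF that(2)])
      fix r assume "x \<le> r" "r \<le> y"
      then have r: "r \<in> {a..2 * a}" "w r \<le> w c" using that a by (auto simp: c_def intro!: wdecr)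
      show "\<exists>D. (u has_real_derivative D) (at r) \<and> D \<le> 0"
        by (intro exI conjI, rule du[OF r(1)]) (use r(2) False in \<open>simp add: mult_nonneg_nonpos\<close>)
    qed
    show ?thesis
    proof (rule quarter[of "7 * a / 4" "- 1"])
      fix r assume r: "7 * a / 4 < r" "r < 7 * a / 4 + a / 4"
      then have rr: "r \<in> {a..2 * a}" using a by auto
      have "lam * a powr \<gamma> * f (u r) * (a / 4) \<le> lam * a powr \<gamma> * f (u r) * (r - c)"
        using r fu[OF rr] lam_pos by (intro mult_left_mono) (auto simp: c_def)
      also have "\<dots> \<le> w c - w r"
        by (rule wgain) (use r a rr udecr in \<open>auto simp: c_def\<close>)
      finally show "lam * a powr \<gamma> * f (u r) * (a / 4) \<le> - 1 * w r" using False by simp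
    qed (use a in auto)
  qed
qed

end

text \<open>If (u, w) solves the system for f, then (-u, -w) solves it for the reflected
  nonlinearity; negative arcs thus reduce to positive ones.\<close>

lemma (in bounded_ivp_system) reflected:
  "bounded_ivp_system \<psi> \<psi>' p (\<lambda>x. - f (- x)) \<alpha> \<gamma> lam f_max (\<lambda>x. - \<Psi> (- x))"
proof unfold_locales
  show "continuous_on UNIV (\<lambda>x. - f (- x))" "continuous_on UNIV (\<lambda>x. - \<Psi> (- x))"
    by (intro continuous_intros)+
  show "0 < x * - f (- x)" if "x \<noteq> 0" for x using f_sign[of "- x"] that by simp
  show "mono (\<lambda>x. - f (- x))" using f_mono by (auto simp: mono_def)
  show "((\<lambda>x. - \<Psi> (- x)) has_real_derivative \<bar>- f (- x)\<bar> powr - p) (at x)" if "x \<noteq> 0" for x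
  proof -
    have "((\<lambda>x. \<Psi> (- x)) has_real_derivative \<bar>f (- x)\<bar> powr - p * - 1) (at x)"
      by (rule DERIV_chain2[where f = \<Psi>]) (use that in \<open>auto intro!: Psi_deriv derivative_eq_intros\<close>)
    from DERIV_minus[OF this] show ?thesis by simp
  qed
  fix x :: real assume "x \<noteq> 0"
  then obtain L e where L: "e > 0" "\<And>y z. \<bar>y - (- x)\<bar> \<le> e \<Longrightarrow> \<bar>z - (- x)\<bar> \<le> e \<Longrightarrow> \<bar>f y - f z\<bar> \<le> L * \<bar>y - z\<bar>"
    using f_locally_lipschitz[of "- x"] by auto
  show "\<exists>L e. e > 0 \<and> (\<forall>y z. \<bar>y - x\<bar> \<le> e \<longrightarrow> \<bar>z - x\<bar> \<le> e \<longrightarrow> \<bar>- f (- y) - - f (- z)\<bar> \<le> L * \<bar>y - z\<bar>)"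
  proof (intro exI conjI allI impI)
    fix y z assume "\<bar>y - x\<bar> \<le> e" "\<bar>z - x\<bar> \<le> e"
    then have "\<bar>f (- y) - f (- z)\<bar> \<le> L * \<bar>- y - - z\<bar>" by (intro L(2)) auto
    then show "\<bar>- f (- y) - - f (- z)\<bar> \<le> L * \<bar>y - z\<bar>" by (simp add: abs_minus_commute)
  qed (fact L(1))
qed (use lam_pos alpha_le minus_alpha_le f_le_max Psi_0 in auto)

context bounded_ivp_system
begin

lemma sol_zero_in_dyadic:
  assumes s: "sol T d u w" and a: "0 < a" "2 * a < T"
    and M: "\<And>r. r \<in> {a..2 * a} \<Longrightarrow> \<bar>u r\<bar> \<le> M"
    and k: "0 < k" "k \<le> lam * a powr (\<gamma> - \<alpha>) * min 1 (2 powr - \<alpha>) * (a / 4)"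
    and small: "max (\<Psi> M) (- \<Psi> (- M)) < osc_const k * (a / 4)"
  shows "\<exists>r\<in>{a..2 * a}. u r = 0"
proof (rule ccontr)
  assume nz: "\<not> ?thesis"
  have cont: "continuous_on {a..2 * a} u"
    using a by (auto intro: forced_cont(1)[OF s])
  have same: "0 < u a * u r" if "r \<in> {a..2 * a}" for r
  proof (rule ccontr)
    assume "\<not> 0 < u a * u r"
    then have "(u a \<le> 0 \<and> 0 \<le> u r) \<or> (0 \<le> u a \<and> u r \<le> 0)" by (auto simp: zero_less_mult_iff)
    then have "\<exists>x\<ge>a. x \<le> r \<and> u x = 0"
      using that continuous_on_subset[OF cont, of "{a..r}"] IVT'[of u a 0 r] IVT2'[of u r 0 a] by auto
    then show False using nz that by auto
  qed
  show False
  proof (cases "u a > 0")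
    case True
    have "osc_const k * (a / 4) \<le> \<Psi> M"
      by (rule positive_on_dyadic_imp_Psi_ge[OF s a _ k])
        (use same M True in \<open>force simp: zero_less_mult_iff\<close>)
    then show False using small by simp
  next
    case False
    then have neg: "u r < 0" if "r \<in> {a..2 * a}" for r using same[OF that] by (auto simp: zero_less_mult_iff)
    interpret neg: bounded_ivp_system \<psi> \<psi>' p "\<lambda>x. - f (- x)" \<alpha> \<gamma> lam f_max "\<lambda>x. - \<Psi> (- x)"
      by (rule reflected)
    have "forced T (- d) (\<lambda>r. - f (- (- u r))) (\<lambda>r. - u r) (\<lambda>r. - w r)"
      using s by (auto simp: forced_def psi_odd intro!: continuous_intros derivative_eq_intros)
    then have "osc_const k * (a / 4) \<le> - \<Psi> (- M)"
      by (rule neg.positive_on_dyadic_imp_Psi_ge[OF _ a _ k]) (use neg M in \<open>force simp: abs_le_iff\<close>)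
    then show False using small by simp
  qed
qed

lemma sol_has_large_zero:
  assumes d: "d > 0" and s: "\<And>T. T > 0 \<Longrightarrow> sol T d u w"
  shows "\<exists>r>b. u r = 0"
proof -
  have "f (- 1) < 0" by (rule f_neg) simp
  then obtain M0 where M0: "M0 > 0" "F d \<le> F (- M0)"
    by (rule primitive_unbounded_below[OF f_cont _ monoD[OF f_mono]])
  define M where "M = max M0 d"
  have M: "\<bar>u r\<bar> \<le> M" if "0 \<le> r" for r
    using sol_range[OF s[of "r + 1"] that _ d M0] that d by (auto simp: M_def)
  \<comment> \<open>For a \<ge> 1 the product \<open>a powr (\<gamma> - \<alpha>) * a\<close> is at
    least 1, so this k is admissible on every such [a, 2a]. Being independent of \<open>a\<close>,
    it lets \<open>osc_const k * (a / 4)\<close> outgrow the bound on \<open>\<Psi>\<close>.\<close>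
  define k where "k = lam * min 1 (2 powr - \<alpha>) / 4"
  have k: "k > 0" using lam_pos by (simp add: k_def)
  define a where "a = max (max 1 (b + 1)) (4 * (max (\<Psi> M) (- \<Psi> (- M)) + 1) / osc_const k)"
  have a: "1 \<le> a" "b < a" by (auto simp: a_def)
  have "4 * (max (\<Psi> M) (- \<Psi> (- M)) + 1) / osc_const k \<le> a" by (simp add: a_def)
  then have small: "max (\<Psi> M) (- \<Psi> (- M)) < osc_const k * (a / 4)"
    using osc_const_pos[OF k] by (simp add: field_simps)
  have "1 \<le> a powr (\<gamma> - \<alpha>) * a"
    using ge_one_powr_ge_zero[of a "\<gamma> - \<alpha>"] a(1) alpha_le mult_mono[of 1 "a powr (\<gamma> - \<alpha>)" 1 a] by simp
  then have "k * 1 \<le> k * (a powr (\<gamma> - \<alpha>) * a)" using k by (intro mult_left_mono) auto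
  then have "k \<le> lam * a powr (\<gamma> - \<alpha>) * min 1 (2 powr - \<alpha>) * (a / 4)" by (simp add: k_def field_simps)
  then have "\<exists>r\<in>{a..2 * a}. u r = 0"
    using a M k small by (intro sol_zero_in_dyadic[OF s[of "2 * a + 1"], where M = M and k = k]) auto
  then obtain r where "r \<in> {a..2 * a}" "u r = 0" by blast
  then show ?thesis using a by (intro exI[of _ r]) auto
qed

text \<open>For fixed a the required change of \<open>\<Psi>\<close> is a fixed positive number,
  whereas \<open>\<Psi>\<close> is small near 0. The energy bound keeps u within [-M, M] once F(d)
  \<le> F(-M) and d < M.\<close>

lemma sol_has_small_zero:
  assumes a: "a > 0"
  obtains \<delta> where "\<delta> > 0" "\<And>d T u w. 0 < d \<Longrightarrow> d < \<delta> \<Longrightarrow> 2 * a < T \<Longrightarrow> sol T d u w \<Longrightarrow> \<exists>r\<in>{a..2 * a}. u r = 0"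
proof -
  define k where "k = lam * a powr (\<gamma> - \<alpha>) * min 1 (2 powr - \<alpha>) * (a / 4)"
  have k: "k > 0" using lam_pos a by (simp add: k_def)
  let ?c = "osc_const k * (a / 4)"
  have c: "?c > 0" using osc_const_pos[OF k] a by simp
  have "continuous_on UNIV (\<lambda>M. max (\<Psi> M) (- \<Psi> (- M)))" by (intro continuous_intros)
  then have "isCont (\<lambda>M. max (\<Psi> M) (- \<Psi> (- M))) 0" by (simp add: continuous_on_eq_continuous_at)
  then have "(\<lambda>M. max (\<Psi> M) (- \<Psi> (- M))) \<midarrow>0\<rightarrow> 0" by (simp add: isCont_def Psi_0)
  then obtain M0 where M0: "M0 > 0" "\<And>M. M \<noteq> 0 \<Longrightarrow> \<bar>M\<bar> < M0 \<Longrightarrow> \<bar>max (\<Psi> M) (- \<Psi> (- M))\<bar> < ?c"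
    using LIM_D[of "\<lambda>M. max (\<Psi> M) (- \<Psi> (- M))" 0 0 ?c] c by auto
  define M where "M = M0 / 2"
  have M: "M > 0" "max (\<Psi> M) (- \<Psi> (- M)) < ?c" using M0(1) M0(2)[of M] by (auto simp: M_def)
  have "F \<midarrow>0\<rightarrow> 0"
    using DERIV_isCont[OF F_deriv, of 0] by (simp add: isCont_def)
  moreover have "0 < F (- M)" using F_pos[of "- M"] M(1) by simp
  ultimately obtain d0 where d0: "d0 > 0" "\<And>d. d \<noteq> 0 \<Longrightarrow> \<bar>d\<bar> < d0 \<Longrightarrow> \<bar>F d\<bar> < F (- M)"
    using LIM_D[of F 0 0 "F (- M)"] by auto
  show thesis
  proof (rule that[of "min d0 M"])
    fix d T u w assume d: "0 < d" "d < min d0 M" and T: "2 * a < T" and s: "sol T d u w"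
    have "F d \<le> F (- M)" using d0(2)[of d] d by auto
    then have "\<bar>u r\<bar> \<le> M" if "r \<in> {0..T}" for r
      using sol_range[OF s, of r M] that d M by auto
    then show "\<exists>r\<in>{a..2 * a}. u r = 0"
      using a T k M by (intro sol_zero_in_dyadic[OF s, where M = M and k = k]) (auto simp: k_def)
  qed (use d0 M in auto)
qed

end

section \<open>Zeros\<close>

locale ivp_family = bounded_ivp_system +
  fixes u w :: "real \<Rightarrow> real \<Rightarrow> real"
  assumes family_sol: "d > 0 \<Longrightarrow> T > 0 \<Longrightarrow> sol T d (u d) (w d)"
begin

lemma u_deriv:
  assumes "d > 0" "r > 0"
  shows "(u d has_real_derivative \<psi> (rflux (w d) r)) (at r)"
  using forcedD(5)[OF family_sol[of d "r + 1"], of r] assms by simp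

lemma w_deriv:
  assumes "d > 0" "r > 0"
  shows "(w d has_real_derivative - (lam * r powr \<gamma> * f (u d r))) (at r)"
  using forcedD(6)[OF family_sol[of d "r + 1"], of r] assms by simp

lemma family_continuous_on:
  assumes "d > 0" "S \<subseteq> {0..T}"
  shows "continuous_on S (u d)" "continuous_on S (w d)"
proof -
  have S: "S \<subseteq> {0..\<bar>T\<bar> + 1}" using assms(2) by auto
  have sol: "sol (\<bar>T\<bar> + 1) d (u d) (w d)" by (rule family_sol[OF assms(1)]) simp
  show "continuous_on S (u d)" "continuous_on S (w d)"
    using continuous_on_subset[OF forcedD(1)[OF sol] S] continuous_on_subset[OF forcedD(2)[OF sol] S] by auto
qed

lemma u_0: "d > 0 \<Longrightarrow> u d 0 = d" and w_0: "d > 0 \<Longrightarrow> w d 0 = 0"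
  using forcedD(3,4)[OF family_sol[of d 1]] by auto

lemma w_nonzero: "d > 0 \<Longrightarrow> r > 0 \<Longrightarrow> u d r = 0 \<Longrightarrow> w d r \<noteq> 0"
  using sol_nonvanishing[OF family_sol[of d r]] by auto

text \<open>The flux does not vanish at a zero of u, so neither does the slope; \<open>s\<close> has
  the sign of the slope.\<close>

lemma u_changes_sign_at_zero:
  assumes d: "d > 0" and y: "y > 0" "u d y = 0"
  obtains \<delta> s where "\<delta> > 0" "s \<noteq> 0" "\<And>h. 0 < h \<Longrightarrow> h < \<delta> \<Longrightarrow> s * u d (y - h) < 0 \<and> 0 < s * u d (y + h)"
proof -
  define D where "D = \<psi> (rflux (w d) y)"
  have D: "(u d has_real_derivative D) (at y)" unfolding D_def by (rule u_deriv[OF d y(1)])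
  have "rflux (w d) y \<noteq> 0" using w_nonzero[OF d y] y by simp
  then consider "D > 0" | "D < 0" unfolding D_def by (meson linorder_neqE psi_neg_iff psi_pos_iff)
  then show thesis
  proof cases
    case 1
    obtain d1 where d1: "d1 > 0" "\<And>h. 0 < h \<Longrightarrow> h < d1 \<Longrightarrow> u d y < u d (y + h)" using DERIV_pos_inc_right[OF D 1] by auto
    obtain d2 where d2: "d2 > 0" "\<And>h. 0 < h \<Longrightarrow> h < d2 \<Longrightarrow> u d (y - h) < u d y" using DERIV_pos_inc_left[OF D 1] by auto
    show thesis by (rule that[of "min d1 d2" 1]) (use d1 d2 y in auto)
  next
    case 2
    obtain d1 where d1: "d1 > 0" "\<And>h. 0 < h \<Longrightarrow> h < d1 \<Longrightarrow> u d (y + h) < u d y" using DERIV_neg_dec_right[OF D 2] by auto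
    obtain d2 where d2: "d2 > 0" "\<And>h. 0 < h \<Longrightarrow> h < d2 \<Longrightarrow> u d y < u d (y - h)" using DERIV_neg_dec_left[OF D 2] by auto
    show thesis by (rule that[of "min d1 d2" "-1"]) (use d1 d2 y in auto)
  qed
qed

lemma u_zero_isolated_right:
  assumes d: "d > 0" and x: "x = 0 \<or> 0 < x \<and> u d x = 0"
  obtains e where "e > 0" "\<And>r. x < r \<Longrightarrow> r < x + e \<Longrightarrow> u d r \<noteq> 0"
  using x
proof
  assume "x = 0"
  obtain r1 where r1: "0 < r1" "r1 < 1" "\<And>r. r \<in> {0..r1} \<Longrightarrow> \<bar>u d r - u d 0\<bar> \<le> d / 2"
    using continuous_on_Icc_eventually_close[OF family_continuous_on(1)[OF d order_refl]
        order_refl zero_less_one half_gt_zero[OF d]] by blast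
  have "u d r \<noteq> 0" if "x < r" "r < x + r1" for r
    using r1(3)[of r] that \<open>x = 0\<close> u_0[OF d] d by auto
  then show thesis using that r1(1) by blast
next
  assume "0 < x \<and> u d x = 0"
  then obtain \<delta> s where \<delta>: "\<delta> > 0" "s \<noteq> 0" "\<And>h. 0 < h \<Longrightarrow> h < \<delta> \<Longrightarrow> s * u d (x - h) < 0 \<and> 0 < s * u d (x + h)"
    using u_changes_sign_at_zero[OF d, of x] by blast
  have "u d r \<noteq> 0" if "x < r" "r < x + \<delta>" for r using \<delta>(3)[of "r - x"] that by auto
  then show thesis using that \<delta>(1) by blast
qed

text \<open>With the immediate right neighbourhood of \<open>x\<close> excluded, the zeros up to
  some later zero \<open>b\<close> form a nonempty compact set, which has a least element.\<close>

lemma next_zero_exists: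
  assumes d: "d > 0" and x: "x = 0 \<or> 0 < x \<and> u d x = 0"
  shows "\<exists>z>x. u d z = 0 \<and> (\<forall>r. x < r \<and> r < z \<longrightarrow> u d r \<noteq> 0)"
proof -
  obtain e where e: "e > 0" "\<And>r. x < r \<Longrightarrow> r < x + e \<Longrightarrow> u d r \<noteq> 0"
    using u_zero_isolated_right[OF d x] by blast
  obtain b where b: "b > x" "u d b = 0" using sol_has_large_zero[OF d family_sol[OF d]] by blast
  let ?A = "{r \<in> {x + e..b}. u d r = 0}"
  have "closed ?A"
    using x e(1) by (intro continuous_closed_preimage_constant family_continuous_on(1)[OF d, of _ b]) auto
  then have "compact ?A" by (rule compact_eq_bounded_closed[THEN iffD2, OF conjI, rotated])
    (auto intro: bounded_subset[of "{x + e..b}"])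
  moreover have "b \<in> ?A" using b e(2)[of b] by force
  ultimately obtain z where z: "z \<in> ?A" "\<And>r. r \<in> ?A \<Longrightarrow> z \<le> r"
    using compact_attains_inf[of ?A] by blast
  have "u d r \<noteq> 0" if "x < r" "r < z" for r
    using e(2)[of r] z(2)[of r] that z(1) by force
  then show ?thesis using z(1) e(1) by (intro exI[of _ z]) auto
qed

text \<open>The zeros are numbered from \<open>1\<close>; \<open>zero 0 d = 0\<close> is only the start of the recursion.\<close>

primrec zero :: "nat \<Rightarrow> real \<Rightarrow> real" where
  "zero 0 d = 0"
| "zero (Suc n) d = (SOME z. z > zero n d \<and> u d z = 0 \<and> (\<forall>r. zero n d < r \<and> r < z \<longrightarrow> u d r \<noteq> 0))"

declare zero.simps(2) [simp del]

text \<open>\<open>?P n\<close> is the premise under which the choice in the next step of the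
  recursion has a witness, and \<open>?Q n\<close> yields \<open>?P\<close> at the
  successor.\<close>

lemma zero_is_zero:
  assumes "d > 0"
  shows "zero n d = 0 \<or> 0 < zero n d \<and> u d (zero n d) = 0" (is "?P n")
    and "zero n d < zero (Suc n) d \<and> u d (zero (Suc n) d) = 0 \<and>
      (\<forall>r. zero n d < r \<and> r < zero (Suc n) d \<longrightarrow> u d r \<noteq> 0)" (is "?Q n")
proof -
  have next': "?Q n" if "?P n" for n
    unfolding zero.simps by (rule someI_ex[OF next_zero_exists[OF assms that]])
  have *: "?P n" for n
  proof (induction n)
    case (Suc n)
    then show ?case using next'[OF Suc.IH] by auto
  qed simp
  show "?P n" by (rule *)
  show "?Q n" by (rule next'[OF *])
qed

lemma zero_less_Suc: "d > 0 \<Longrightarrow> zero n d < zero (Suc n) d"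
  using zero_is_zero(2) by blast

lemma u_zero_Suc: "d > 0 \<Longrightarrow> u d (zero (Suc n) d) = 0"
  using zero_is_zero(2) by blast

lemma u_nonzero_between: "d > 0 \<Longrightarrow> zero n d < r \<Longrightarrow> r < zero (Suc n) d \<Longrightarrow> u d r \<noteq> 0"
  using zero_is_zero(2) by blast

lemma zero_nonneg: "d > 0 \<Longrightarrow> 0 \<le> zero n d"
  using zero_is_zero(1)[of d n] by auto

lemma zero_Suc_pos: "d > 0 \<Longrightarrow> 0 < zero (Suc n) d"
  using zero_less_Suc[of d n] zero_nonneg[of d n] by simp

lemma zero_strict_mono: "d > 0 \<Longrightarrow> strict_mono (\<lambda>n. zero n d)"
  by (rule strict_monoI_Suc) (rule zero_less_Suc)

lemma zero_Suc_le:
  assumes "d > 0" "zero n d < r" "u d r = 0"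
  shows "zero (Suc n) d \<le> r"
  using u_nonzero_between[of d n r] assms by force

text \<open>The enumeration omits no zero: each one lies in some interval between consecutive
  \<open>zero n d\<close>, and the interior of such an interval contains none. This is what counting
  requires.\<close>

lemma zeros_below:
  assumes "d > 0" "0 < r" "r < zero n d" "u d r = 0"
  shows "r \<in> (\<lambda>l. zero l d) ` {1..<n}"
  using assms(3)
proof (induction n)
  case 0
  then show ?case using assms by simp
next
  case (Suc n)
  have "\<not> zero n d < r" using u_nonzero_between[OF assms(1)] Suc.prems assms(4) by blast
  then consider "r < zero n d" | "r = zero n d" by linarith
  then show ?case
  proof cases
    case 1
    then show ?thesis using Suc.IH by force
  next
    case 2
    then have "n \<noteq> 0" using assms(2) by (intro notI) simp
    then show ?thesis using 2 by force
  qed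
qed

lemma u_pos_before_first_zero:
  assumes d: "d > 0" and r: "0 \<le> r" "r < zero 1 d"
  shows "0 < u d r"
proof (rule ccontr)
  assume neg: "\<not> 0 < u d r"
  have "\<exists>x\<ge>0. x \<le> r \<and> u d x = 0"
    by (rule IVT2') (use neg r d in \<open>auto simp: u_0 intro!: family_continuous_on[where T = r]\<close>)
  then obtain x where x: "0 \<le> x" "x \<le> r" "u d x = 0" by blast
  then have "0 < x" using u_0[OF d] d by (cases "x = 0") auto
  then show False using u_nonzero_between[OF d, of 0 x] x r by simp
qed

lemma w_neg_until_first_zero:
  assumes d: "d > 0" and r: "0 < r" "r \<le> zero 1 d"
  shows "w d r < 0"
proof -
  have "w d r < w d 0"
  proof (rule DERIV_neg_imp_decreasing_open[OF r(1)])
    fix x assume x: "0 < x" "x < r"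
    have "0 < f (u d x)" using u_pos_before_first_zero[OF d, of x] x r f_pos by simp
    then show "\<exists>y. (w d has_real_derivative y) (at x) \<and> y < 0"
      using w_deriv[OF d x(1)] lam_pos x by (intro exI[of _ "- (lam * x powr \<gamma> * f (u d x))"]) auto
  qed (rule family_continuous_on(2)[OF d order_refl])
  then show ?thesis using w_0[OF d] by simp
qed

section \<open>Dependence of the zeros on the initial value\<close>

lemma family_continuous_dependence:
  assumes "T > 0" "d0 > 0" "e > 0"
  obtains \<delta> where "\<delta> > 0" "\<And>d r. d > 0 \<Longrightarrow> \<bar>d - d0\<bar> < \<delta> \<Longrightarrow> r \<in> {0..T} \<Longrightarrow>
    \<bar>u d r - u d0 r\<bar> < e \<and> \<bar>w d r - w d0 r\<bar> < e"
  using sol_continuous_dependence[OF assms family_sol[OF assms(2,1)]] family_sol[OF _ assms(1)] by metis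

text \<open>Excludes that a new zero of u d appears just behind \<open>zero l d\<close> when d
  moves. By Rolle, two zeros close together enclose a critical point near \<open>zero l d0\<close>,
  but w is bounded away from 0 there, uniformly for d near \<open>d0\<close>. For l = 0 the solution
  is still close to \<open>d0\<close>.\<close>

lemma no_zero_right_of_zero_uniform:
  assumes d0: "d0 > 0" and IH: "\<And>e. e > 0 \<Longrightarrow> \<exists>\<delta>>0. \<forall>d>0. \<bar>d - d0\<bar> < \<delta> \<longrightarrow> \<bar>zero l d - zero l d0\<bar> < e"
    and b: "b > 0"
  obtains s \<delta> where "0 < s" "s < b" "\<delta> > 0"
    "\<And>d r. d > 0 \<Longrightarrow> \<bar>d - d0\<bar> < \<delta> \<Longrightarrow> zero l d < r \<Longrightarrow> r \<le> zero l d0 + s \<Longrightarrow> u d r \<noteq> 0"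
proof (cases l)
  case 0
  obtain r1 where r1: "0 < r1" "r1 < b" "\<And>r. r \<in> {0..r1} \<Longrightarrow> \<bar>u d0 r - u d0 0\<bar> \<le> d0 / 2"
    using continuous_on_Icc_eventually_close[OF family_continuous_on(1)[OF d0 order_refl]
        order_refl b half_gt_zero[OF d0]] by blast
  obtain \<delta> where del: "\<delta> > 0" "\<And>d r. d > 0 \<Longrightarrow> \<bar>d - d0\<bar> < \<delta> \<Longrightarrow> r \<in> {0..r1} \<Longrightarrow> \<bar>u d r - u d0 r\<bar> < d0 / 2"
    using family_continuous_dependence[OF r1(1) d0 half_gt_zero[OF d0]] by metis
  show thesis
  proof (rule that[OF r1(1,2) del(1)])
    fix d r assume d: "d > 0" "\<bar>d - d0\<bar> < \<delta>" and "zero l d < r" "r \<le> zero l d0 + r1"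
    then have r: "r \<in> {0..r1}" using 0 by auto
    have "\<bar>u d r - u d0 r\<bar> < d0 / 2" by (rule del(2)[OF d r])
    then show "u d r \<noteq> 0" using r1(3)[OF r] u_0[OF d0] by auto
  qed
next
  case (Suc n)
  define x where "x = zero l d0"
  have x: "x > 0" "u d0 x = 0" using zero_Suc_pos[OF d0, of n] u_zero_Suc[OF d0, of n] by (auto simp: x_def Suc)
  define m where "m = \<bar>w d0 x\<bar>"
  have m: "m > 0" using w_nonzero[OF d0 x] by (simp add: m_def)
  have "isCont (w d0) x" using DERIV_isCont[OF w_deriv[OF d0 x(1)]] .
  then obtain s0 where s0: "s0 > 0" "\<And>r. \<bar>r - x\<bar> < s0 \<Longrightarrow> \<bar>w d0 r - w d0 x\<bar> < m / 4"
    using m unfolding continuous_at_eps_delta dist_real_def by (metis zero_less_divide_iff zero_less_numeral)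
  define s where "s = min (min s0 b) x / 2"
  have s: "0 < s" "s < b" "s < s0" "s < x" using s0 b x by (auto simp: s_def)
  have T: "x + s > 0" using x s by simp
  obtain \<delta>1 where del1: "\<delta>1 > 0" "\<And>d r. d > 0 \<Longrightarrow> \<bar>d - d0\<bar> < \<delta>1 \<Longrightarrow> r \<in> {0..x + s} \<Longrightarrow> \<bar>w d r - w d0 r\<bar> < m / 4"
    using family_continuous_dependence[OF T d0, of "m / 4"] m by (metis zero_less_divide_iff zero_less_numeral)
  obtain \<delta>2 where del2: "\<delta>2 > 0" "\<And>d. d > 0 \<Longrightarrow> \<bar>d - d0\<bar> < \<delta>2 \<Longrightarrow> \<bar>zero l d - x\<bar> < s"
    using IH[OF s(1)] unfolding x_def by blast
  show thesis
  proof (rule that[OF s(1,2), of "min \<delta>1 \<delta>2"])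
    fix d r assume d: "d > 0" "\<bar>d - d0\<bar> < min \<delta>1 \<delta>2" and r: "zero l d < r" "r \<le> zero l d0 + s"
    let ?x' = "zero l d"
    have x': "\<bar>?x' - x\<bar> < s" using del2 d by auto
    have ux': "u d ?x' = 0" using u_zero_Suc[OF d(1)] Suc by blast
    show "u d r \<noteq> 0"
    proof
      assume "u d r = 0"
      have "\<exists>z. ?x' < z \<and> z < r \<and> (u d has_real_derivative 0) (at z)"
      proof (rule Rolle)
        show "continuous_on {?x'..r} (u d)"
          using zero_nonneg[OF d(1), of l] by (intro family_continuous_on(1)[OF d(1), of _ r]) auto
        fix z assume "?x' < z" "z < r"
        then show "u d differentiable (at z)"
          using u_deriv[OF d(1), of z] zero_nonneg[OF d(1), of l] by (auto simp: real_differentiable_def)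
      qed (use r ux' \<open>u d r = 0\<close> in auto)
      then obtain z where z: "?x' < z" "z < r" "(u d has_real_derivative 0) (at z)" by blast
      have zx: "\<bar>z - x\<bar> < s" using z r x' by (auto simp: x_def)
      have z0: "z > 0" using z(1) zero_nonneg[OF d(1), of l] by simp
      have "\<bar>w d z - w d0 z\<bar> < m / 4"
        using del1(2)[OF d(1), of z] d(2) zx z0 by auto
      moreover have "\<bar>w d0 z - w d0 x\<bar> < m / 4" using s0(2)[of z] zx s by simp
      ultimately have "w d z \<noteq> 0" using m unfolding m_def by linarith
      then have "rflux (w d) z \<noteq> 0" using z0 by simp
      then have "\<psi> (rflux (w d) z) \<noteq> 0" by (metis linorder_neqE psi_neg_iff psi_pos_iff order_less_irrefl)
      then show False using DERIV_unique[OF z(3) u_deriv[OF d(1) z0]] by simp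
    qed
  qed (use del1 del2 in auto)
qed

text \<open>Two bounds for the next zero. From above: u d0 changes sign between \<open>y1\<close>
  and \<open>y2\<close>, hence so does u d. From below: u d has no zero in (zero l d, y1], near the
  left end by the previous lemma and on [x + s, y1] because u d0 is bounded away from 0
  there.\<close>

lemma zero_continuous:
  assumes d0: "d0 > 0" and e: "e > 0"
  shows "\<exists>\<delta>>0. \<forall>d>0. \<bar>d - d0\<bar> < \<delta> \<longrightarrow> \<bar>zero l d - zero l d0\<bar> < e"
  using e
proof (induction l arbitrary: e)
  case 0
  then show ?case by (intro exI[of _ 1]) auto
next
  case (Suc l)
  define x where "x = zero l d0"
  define y where "y = zero (Suc l) d0"
  have xy: "0 \<le> x" "x < y" "u d0 y = 0"
    using zero_nonneg[OF d0] zero_less_Suc[OF d0] u_zero_Suc[OF d0] by (auto simp: x_def y_def)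
  \<comment> \<open>\<open>y1\<close> is kept in the right half of (x, y) and \<open>x + s\<close>
    will lie in the left half, so that [x + s, y1] is a proper interval.\<close>
  define e1 where "e1 = min e ((y - x) / 2)"
  have e1: "e1 > 0" "e1 \<le> e" "y - e1 \<ge> (x + y) / 2" using Suc.prems xy by (auto simp: e1_def min_def field_simps)
  obtain h0 sg where h0: "h0 > 0" "sg \<noteq> 0" "\<And>h. 0 < h \<Longrightarrow> h < h0 \<Longrightarrow> sg * u d0 (y - h) < 0 \<and> 0 < sg * u d0 (y + h)"
    using u_changes_sign_at_zero[OF d0, of y] xy by auto
  define h where "h = min h0 e1 / 2"
  have h: "0 < h" "h < h0" "h < e1" using h0 e1 by (auto simp: h_def)
  define y1 where "y1 = y - h"
  define y2 where "y2 = y + h"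
  have y12: "(x + y) / 2 < y1" "y1 < y" "y < y2" "y - e < y1" "y2 < y + e"
    using h e1 by (auto simp: y1_def y2_def)
  have sgn: "sg * u d0 y1 < 0" "0 < sg * u d0 y2" using h0(3)[OF h(1,2)] by (auto simp: y1_def y2_def)
  obtain s \<delta>1 where s: "0 < s" "s < (y - x) / 2" "\<delta>1 > 0"
    "\<And>d r. d > 0 \<Longrightarrow> \<bar>d - d0\<bar> < \<delta>1 \<Longrightarrow> zero l d < r \<Longrightarrow> r \<le> x + s \<Longrightarrow> u d r \<noteq> 0"
    using no_zero_right_of_zero_uniform[OF d0 Suc.IH, of "(y - x) / 2"] xy unfolding x_def by auto
  have xs: "x + s < y1" using s y12 by (simp add: field_simps)
  obtain z0 where z0: "z0 \<in> {x + s..y1}" "\<And>r. r \<in> {x + s..y1} \<Longrightarrow> \<bar>u d0 z0\<bar> \<le> \<bar>u d0 r\<bar>"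
  proof -
    have "continuous_on {x + s..y1} (\<lambda>r. \<bar>u d0 r\<bar>)"
      using xy s by (intro continuous_intros family_continuous_on(1)[OF d0, of _ y1]) auto
    then show thesis using continuous_attains_inf[of "{x + s..y1}" "\<lambda>r. \<bar>u d0 r\<bar>"] xs that by force
  qed
  have "u d0 z0 \<noteq> 0"
    using z0(1) s y12 by (intro u_nonzero_between[OF d0, of l]) (auto simp: x_def y_def)
  \<comment> \<open>A perturbation smaller than this changes neither the sign of u d0 on [x + s, y1]
    nor its sign at \<open>y2\<close>.\<close>
  define \<eta> where "\<eta> = min \<bar>u d0 z0\<bar> \<bar>u d0 y2\<bar>"
  have eta: "\<eta> > 0" using \<open>u d0 z0 \<noteq> 0\<close> sgn by (auto simp: \<eta>_def)
  have T: "y2 > 0" using xy y12 by simp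
  obtain \<delta>2 where del2: "\<delta>2 > 0" "\<And>d r. d > 0 \<Longrightarrow> \<bar>d - d0\<bar> < \<delta>2 \<Longrightarrow> r \<in> {0..y2} \<Longrightarrow> \<bar>u d r - u d0 r\<bar> < \<eta>"
    using family_continuous_dependence[OF T d0 eta] by metis
  obtain \<delta>3 where del3: "\<delta>3 > 0" "\<And>d. d > 0 \<Longrightarrow> \<bar>d - d0\<bar> < \<delta>3 \<Longrightarrow> \<bar>zero l d - x\<bar> < s"
    using Suc.IH[OF s(1)] unfolding x_def by blast
  show ?case
  proof (intro exI[of _ "min \<delta>1 (min \<delta>2 \<delta>3)"] conjI allI impI)
    fix d assume d: "d > 0" "\<bar>d - d0\<bar> < min \<delta>1 (min \<delta>2 \<delta>3)"
    have zl: "zero l d < y1" using del3(2)[OF d(1)] d(2) xs by auto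
    have close: "\<bar>u d r - u d0 r\<bar> < \<eta>" if "r \<in> {0..y2}" for r
      using del2(2)[OF d(1) _ that] d(2) by auto
    have nz: "u d r \<noteq> 0" if "zero l d < r" "r \<le> y1" for r
    proof (cases "r \<le> x + s")
      case True
      then show ?thesis using s(4)[OF d(1) _ that(1)] d(2) by auto
    next
      case False
      then have "\<eta> \<le> \<bar>u d0 r\<bar>" using z0(2)[of r] that by (auto simp: \<eta>_def)
      then show ?thesis using close[of r] False that xy s y12 by force
    qed
    have same: "0 < t * u d r" if "\<bar>u d r - u d0 r\<bar> < \<bar>u d0 r\<bar>" "0 < t * u d0 r" for t r
      using that by (auto simp: zero_less_mult_iff)
    have "\<bar>u d y1 - u d0 y1\<bar> < \<bar>u d0 y1\<bar>"
      using close[of y1] z0(2)[of y1] xs xy s y12 by (auto simp: \<eta>_def)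
    then have s1: "0 < - sg * u d y1" using same[of y1 "- sg"] sgn by simp
    have "\<bar>u d y2 - u d0 y2\<bar> < \<bar>u d0 y2\<bar>"
      using close[of y2] T by (auto simp: \<eta>_def)
    then have s2: "0 < sg * u d y2" using same[of y2 sg] sgn by simp
    have "\<exists>r\<ge>y1. r \<le> y2 \<and> sg * u d r = 0"
      by (rule IVT')
        (use s1 s2 y12 xy s xs in \<open>auto intro!: continuous_intros family_continuous_on(1)[OF d(1), of _ y2]\<close>)
    then obtain r where r: "y1 \<le> r" "r \<le> y2" "u d r = 0" using h0(2) by auto
    have "zero (Suc l) d \<le> r" by (rule zero_Suc_le[OF d(1)]) (use r zl in auto)
    moreover have "y1 < zero (Suc l) d"
      using nz[of "zero (Suc l) d"] zero_less_Suc[OF d(1), of l] u_zero_Suc[OF d(1), of l] by force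
    ultimately show "\<bar>zero (Suc l) d - zero (Suc l) d0\<bar> < e"
      using r y12 unfolding y_def[symmetric] by linarith
  qed (use s del2 del3 in auto)
qed

text \<open>For small d the previous zero lies before e / 3, and by
  \<open>sol_has_small_zero\<close> there is a zero in [e / 3, 2 e / 3], which bounds the next
  one.\<close>

lemma zero_tendsto_0:
  assumes e: "e > 0"
  shows "\<exists>\<delta>>0. \<forall>d>0. d < \<delta> \<longrightarrow> zero l d < e"
  using e
proof (induction l arbitrary: e)
  case 0
  then show ?case by (intro exI[of _ 1]) auto
next
  case (Suc l)
  obtain \<delta>1 where d1: "\<delta>1 > 0" "\<And>d. d > 0 \<Longrightarrow> d < \<delta>1 \<Longrightarrow> zero l d < e / 3"
    using Suc.IH[of "e / 3"] Suc.prems by auto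
  obtain \<delta>2 where d2: "\<delta>2 > 0" "\<And>d T u w. 0 < d \<Longrightarrow> d < \<delta>2 \<Longrightarrow> 2 * (e / 3) < T \<Longrightarrow> sol T d u w \<Longrightarrow>
      \<exists>r\<in>{e / 3..2 * (e / 3)}. u r = 0"
    using sol_has_small_zero[of "e / 3"] Suc.prems by (metis divide_pos_pos zero_less_numeral)
  show ?case
  proof (intro exI[of _ "min \<delta>1 \<delta>2"] conjI allI impI)
    fix d assume d: "d > 0" "d < min \<delta>1 \<delta>2"
    obtain r where r: "r \<in> {e / 3..2 * (e / 3)}" "u d r = 0"
      using d2(2)[OF d(1) _ _ family_sol[OF d(1), of e]] d Suc.prems by auto
    have "zero (Suc l) d \<le> r"
      using d1(2)[OF d(1)] d r by (intro zero_Suc_le[OF d(1)]) auto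
    then show "zero (Suc l) d < e" using r Suc.prems by simp
  qed (use d1 d2 in auto)
qed

text \<open>If u d0 has k zeros in (0, R), the zero with index k + 1 is at least R and the one with
  index k + 2 is strictly beyond R, where it remains for d near \<open>d0\<close>. The additional 1
  allows for a zero exactly at R that moves inside.\<close>

lemma zero_count_upper_semicontinuous:
  assumes d0: "d0 > 0" and fin: "finite {r \<in> {0<..<R}. u d0 r = 0}"
  shows "\<exists>\<delta>>0. \<forall>d>0. \<bar>d - d0\<bar> < \<delta> \<longrightarrow> finite {r \<in> {0<..<R}. u d r = 0} \<and>
    card {r \<in> {0<..<R}. u d r = 0} \<le> card {r \<in> {0<..<R}. u d0 r = 0} + 1"
proof -
  let ?S = "\<lambda>d. {r \<in> {0<..<R}. u d r = 0}"
  define k where "k = card (?S d0)"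
  have "R \<le> zero (Suc k) d0"
  proof (rule ccontr)
    assume R: "\<not> R \<le> zero (Suc k) d0"
    have "(\<lambda>l. zero l d0) ` {1..Suc k} \<subseteq> ?S d0"
    proof
      fix r assume "r \<in> (\<lambda>l. zero l d0) ` {1..Suc k}"
      then obtain l where l: "l \<in> {1..Suc k}" "r = zero l d0" by blast
      then obtain n where n: "l = Suc n" by (cases l) auto
      have "zero l d0 \<le> zero (Suc k) d0"
        using l strict_mono_less_eq[OF zero_strict_mono[OF d0]] by simp
      then show "r \<in> ?S d0"
        using R zero_Suc_pos[OF d0, of n] u_zero_Suc[OF d0, of n] l n by auto
    qed
    then have "card ((\<lambda>l. zero l d0) ` {1..Suc k}) \<le> k" unfolding k_def by (intro card_mono fin) auto
    moreover have "inj_on (\<lambda>l. zero l d0) {1..Suc k}"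
      using strict_mono_imp_inj_on[OF zero_strict_mono[OF d0]] by (rule inj_on_subset) auto
    ultimately show False by (simp add: card_image)
  qed
  then have "0 < zero (Suc (Suc k)) d0 - R" using zero_less_Suc[OF d0, of "Suc k"] by linarith
  then obtain \<delta> where del: "\<delta> > 0"
    "\<And>d. d > 0 \<Longrightarrow> \<bar>d - d0\<bar> < \<delta> \<Longrightarrow> \<bar>zero (Suc (Suc k)) d - zero (Suc (Suc k)) d0\<bar> < zero (Suc (Suc k)) d0 - R"
    using zero_continuous[OF d0] by blast
  show ?thesis
  proof (intro exI[of _ \<delta>] conjI allI impI)
    fix d assume d: "d > 0" "\<bar>d - d0\<bar> < \<delta>"
    have "R < zero (Suc (Suc k)) d" using del(2)[OF d] by linarith
    then have sub: "?S d \<subseteq> (\<lambda>l. zero l d) ` {1..<Suc (Suc k)}"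
      using zeros_below[OF d(1)] by auto
    then show "finite (?S d)" by (rule finite_subset) auto
    have "card (?S d) \<le> card ((\<lambda>l. zero l d) ` {1..<Suc (Suc k)})" using sub by (intro card_mono) auto
    also have "\<dots> \<le> card {1..<Suc (Suc k)}" by (rule card_image_le) simp
    finally show "card (?S d) \<le> card (?S d0) + 1" by (simp add: k_def)
  qed (fact del(1))
qed

text \<open>The slope of u is at most \<open>\<psi> (ymax f_max R)\<close> in modulus on [0, R], so
  u cannot lose the whole height d there.\<close>

lemma zero_1_ge:
  assumes d: "d > 0" and R: "R > 0" and small: "\<psi> (ymax f_max R) * R < d"
  shows "R \<le> zero 1 d"
proof (rule ccontr)
  assume "\<not> R \<le> zero 1 d"
  then have z: "0 < zero 1 d" "zero 1 d < R" using zero_Suc_pos[OF d, of 0] by auto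
  have "\<bar>u d (zero 1 d) - u d 0\<bar> \<le> \<psi> (ymax f_max R) * \<bar>zero 1 d - 0\<bar>"
    by (rule forced_lipschitz[OF family_sol[OF d R]]) (use f_le_max f_max_pos z in auto)
  also have "\<dots> \<le> \<psi> (ymax f_max R) * R"
  proof (rule mult_left_mono)
    show "0 \<le> \<psi> (ymax f_max R)" unfolding ymax_def using f_max_pos lam_pos gamma_nonneg by simp
  qed (use z in auto)
  finally show False using small u_zero_Suc[OF d, of 0] u_0[OF d] d by simp
qed

end

section \<open>Reduction to the first-order system\<close>

context ivp_system
begin

text \<open>Inside the half-line the two formulations agree by algebra; the one-sided derivatives of
  u and of the flux at 0 are obtained as limits of the interior derivatives.\<close>

lemma sol_imp_ivp_solution:
  assumes s: "\<And>T. T > 0 \<Longrightarrow> sol T d u w" and inv: "\<And>y. \<phi> \<bar>\<psi> y\<bar> * \<psi> y = y"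
  shows "ivp_solution \<phi> f \<alpha> \<gamma> lam d u"
    and "\<And>r. 0 \<le> r \<Longrightarrow> deriv_ge0 u r = \<psi> (rflux w r)"
proof -
  let ?y = "rflux w"
  have s1: "sol 1 d u w" by (rule s) simp
  have at0: "at 0 within {0..T} = at_right (0::real)" if "T > 0" for T
    using that by (metis at_within_Icc_at_right)
  have y_cont: "continuous_on {0..T} ?y" if T: "T > 0" for T
  proof -
    obtain B where B: "B \<ge> 0" "\<And>r. r \<in> {0..T} \<Longrightarrow> \<bar>f (u r)\<bar> \<le> B" using sol_bounded[OF s[OF T]] by blast
    show ?thesis
      by (rule y_continuous_on[OF forcedD(2,4,6)[OF s[OF T]], where B = B]) (use B T in auto)
  qed
  have "(?y \<longlongrightarrow> ?y 0) (at 0 within {0..1})"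
    by (rule continuous_on_def[THEN iffD1, rule_format, OF y_cont]) auto
  then have "(?y \<longlongrightarrow> 0) (at_right 0)" using at0[of 1] by simp
  then have "((\<lambda>r. \<psi> (?y r)) \<longlongrightarrow> \<psi> 0) (at_right 0)"
    by (rule continuous_on_tendsto_compose[OF psi_cont]) auto
  then have du0: "(u has_real_derivative 0) (at 0 within {0..})"
    using has_real_derivative_at_0_of_limit[OF forcedD(1)[OF s1] zero_less_one forcedD(5)[OF s1]] by simp
  have within: "at r within {0..} = at r" if "r > 0" for r :: real
    using that by (intro at_within_interior) auto
  have du: "(u has_real_derivative \<psi> (?y r)) (at r within {0..})" if "0 \<le> r" for r
  proof (cases "r = 0")
    case True
    then show ?thesis using du0 by simp
  next
    case False
    then show ?thesis using forcedD(5)[OF s[of "r + 1"], of r] that within by simp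
  qed
  show deriv: "deriv_ge0 u r = \<psi> (?y r)" if "0 \<le> r" for r
    unfolding deriv_ge0_def
  proof (rule vector_derivative_within)
    show "at r within {0..} \<noteq> bot"
      using that within[of r] by (cases "r = 0") (auto simp: at_within_Ici_at_right)
    show "(u has_vector_derivative \<psi> (?y r)) (at r within {0..})"
      using du[OF that] by (simp add: has_real_derivative_iff_has_vector_derivative)
  qed
  \<comment> \<open>The limit of w' at 0: it vanishes for \<open>\<gamma> > 0\<close> and is
    \<open>- lam * f d\<close> for \<open>\<gamma> = 0\<close>, where \<open>r powr \<gamma>\<close>
    is 1 for r > 0 but 0 at r = 0.\<close>
  define L where "L = - (lam * (if \<gamma> = 0 then 1 else 0) * f d)"
  have "((\<lambda>r. f (u r)) \<longlongrightarrow> f (u 0)) (at 0 within {0..1})"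
    using f_continuous_on[OF forcedD(1)[OF s1]] by (simp add: continuous_on_def)
  then have fu: "((\<lambda>r. f (u r)) \<longlongrightarrow> f d) (at_right 0)" using at0[of 1] forcedD(3)[OF s1] by simp
  have "((\<lambda>r. r powr \<gamma>) \<longlongrightarrow> (if \<gamma> = 0 then 1 else 0)) (at_right (0::real))"
  proof (cases "\<gamma> = 0")
    case True
    have "\<forall>\<^sub>F r in at_right (0::real). r powr \<gamma> = 1"
      unfolding eventually_at_right_field using True by (intro exI[of _ 1]) auto
    from tendsto_eventually[OF this] show ?thesis using True by simp
  next
    case False
    have "((\<lambda>r. r powr \<gamma>) \<longlongrightarrow> 0 powr \<gamma>) (at 0 within {0..1::real})"
      using continuous_on_powr_nonneg[of \<gamma> "{0..1}"] False gamma_nonneg by (force simp: continuous_on_def)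
    then show ?thesis using False at0[of 1] by simp
  qed
  then have "((\<lambda>r. - (lam * r powr \<gamma> * f (u r))) \<longlongrightarrow> L) (at_right 0)"
    unfolding L_def by (intro tendsto_intros fu)
  then have dw0: "(w has_real_derivative L) (at 0 within {0..})"
    using has_real_derivative_at_0_of_limit[OF forcedD(2)[OF s1] zero_less_one forcedD(6)[OF s1]] by simp
  have dw: "(w has_real_derivative - (lam * r powr \<gamma> * f (u r))) (at r)" if "0 < r" for r
    using forcedD(6)[OF s[of "r + 1"], of r] that by simp
  let ?flux = "\<lambda>r. r powr \<alpha> * (\<phi> \<bar>deriv_ge0 u r\<bar> * deriv_ge0 u r)"
  have flux: "?flux r = w r" if "0 \<le> r" for r
  proof -
    have "?flux r = r powr \<alpha> * ?y r" using deriv[OF that] inv by simp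
    also have "\<dots> = w r"
    proof (cases "r = 0")
      case True
      then show ?thesis using forcedD(4)[OF s1] by simp
    next
      case False
      then show ?thesis using that by (simp add: powr_minus)
    qed
    finally show ?thesis .
  qed
  show "ivp_solution \<phi> f \<alpha> \<gamma> lam d u"
    unfolding ivp_solution_def
  proof (intro conjI allI impI)
    show "u differentiable_on {0..}"
      unfolding differentiable_on_def using du by (auto simp: real_differentiable_def)
    show "continuous_on {0..} (deriv_ge0 u)"
      unfolding continuous_on_eq_continuous_within
    proof
      fix r :: real assume r: "r \<in> {0..}"
      have "continuous_on {0..r + 1} (deriv_ge0 u)"
        by (rule continuous_on_eq[OF psi_continuous_on[OF y_cont]]) (use r deriv in auto)
      then have "continuous (at r within {0..r + 1}) (deriv_ge0 u)"
        using r by (simp add: continuous_on_eq_continuous_within)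
      moreover have "at r within {0..} = at r within {0..r + 1}"
        by (rule at_within_nhd[of _ "{..<r + 1}"]) (use r in auto)
      ultimately show "continuous (at r within {0..}) (deriv_ge0 u)" by simp
    qed
    show "?flux differentiable_on {0..}"
      unfolding differentiable_on_def
    proof
      fix r :: real assume r: "r \<in> {0..}"
      have "\<exists>D. (w has_real_derivative D) (at r within {0..})"
      proof (cases "r = 0")
        case True
        then show ?thesis using dw0 by blast
      next
        case False
        then show ?thesis using dw[of r] within[of r] r by auto
      qed
      then obtain D where D: "(w has_real_derivative D) (at r within {0..})" by blast
      have "(?flux has_real_derivative D) (at r within {0..})"
        by (rule has_field_derivative_transform_within[OF D zero_less_one]) (use r flux in auto)
      then show "?flux differentiable (at r within {0..})" by (auto simp: real_differentiable_def)
    qed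
    fix r :: real assume r: "0 < r"
    have "(?flux has_real_derivative - (lam * r powr \<gamma> * f (u r))) (at r)"
      by (rule has_field_derivative_transform_within_open[OF dw[OF r], of "{0<..}"]) (use r flux in auto)
    then have "deriv ?flux r = - (lam * r powr \<gamma> * f (u r))" by (rule DERIV_imp_deriv)
    then show "- deriv ?flux r = lam * r powr \<gamma> * f (u r)" by simp
  qed (use forcedD(3)[OF s1] deriv[of 0] in auto)
qed

text \<open>The flux is the required w. Its differentiability at 0, which is part of the notion of
  solution, gives the continuity of w there, with value 0; all uniqueness arguments start from
  this.\<close>

lemma ivp_solution_imp_sol:
  assumes v: "ivp_solution \<phi> f \<alpha> \<gamma> lam d v" and inv: "\<And>s. \<psi> (\<phi> \<bar>s\<bar> * s) = s"
  shows "\<exists>w. \<forall>T. sol T d v w"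
proof -
  define w where "w = (\<lambda>r. r powr \<alpha> * (\<phi> \<bar>deriv_ge0 v r\<bar> * deriv_ge0 v r))"
  have v_diff: "v differentiable_on {0..}" and w_diff: "w differentiable_on {0..}"
    and eq: "\<And>r. r > 0 \<Longrightarrow> - deriv w r = lam * r powr \<gamma> * f (v r)"
    and v0: "v 0 = d" "deriv_ge0 v 0 = 0"
    using v unfolding ivp_solution_def w_def by auto
  have within: "at r within {0..} = at r" if "r > 0" for r :: real
    using that by (intro at_within_interior) auto
  have "sol T d v w" for T
    unfolding forced_def
  proof (intro conjI allI impI)
    show "continuous_on {0..T} v" "continuous_on {0..T} w"
      using differentiable_imp_continuous_on[OF v_diff] differentiable_imp_continuous_on[OF w_diff]
      by (auto intro: continuous_on_subset)
    fix r assume "0 < r \<and> r < T"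
    then have r: "0 < r" by simp
    have "v differentiable (at r within {0..})" using v_diff r by (simp add: differentiable_on_def)
    then have "(v has_vector_derivative deriv_ge0 v r) (at r within {0..})"
      unfolding deriv_ge0_def by (simp add: vector_derivative_works)
    moreover have "deriv_ge0 v r = \<psi> (rflux w r)"
      using r inv[of "deriv_ge0 v r"] by (simp add: w_def powr_minus field_simps)
    ultimately show "(v has_real_derivative \<psi> (rflux w r)) (at r)"
      using within[OF r] by (simp add: has_real_derivative_iff_has_vector_derivative)
    have "w differentiable (at r within {0..})" using w_diff r by (simp add: differentiable_on_def)
    then have "w differentiable (at r)" unfolding within[OF r] .
    then have "(w has_real_derivative deriv w r) (at r)"
      by (simp add: DERIV_deriv_iff_real_differentiable)
    moreover have "deriv w r = - (lam * r powr \<gamma> * f (v r))" using eq[OF r] by linarith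
    ultimately show "(w has_real_derivative - (lam * r powr \<gamma> * f (v r))) (at r)" by simp
  qed (use v0 in \<open>auto simp: w_def\<close>)
  then show ?thesis by blast
qed

end

text \<open>The two limits in \<open>phi1\<close> make the odd extension of the flux surjective.
  With t = \<psi>(y) and y = t \<phi>(t), the lower bound in \<open>phi3\<close>, multiplied by t,
  becomes the bound on \<open>y * \<psi>' y\<close>.\<close>

lemma flux_inverse_exists:
  fixes \<phi> :: "real \<Rightarrow> real"
  assumes phi_pos: "\<And>t. t > 0 \<Longrightarrow> \<phi> t > 0"
    and phi_C1: "\<phi> C1_differentiable_on {0<..}"
    and g: "\<gamma>1 > 1"
    and phi1: "((\<lambda>t. t * \<phi> t) \<longlongrightarrow> 0) (at_right 0)" "filterlim (\<lambda>t. t * \<phi> t) at_top at_top"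
    and phi2: "strict_mono_on {0<..} (\<lambda>t. t * \<phi> t)"
    and phi3: "\<And>t. t > 0 \<Longrightarrow> \<gamma>1 - 1 \<le> deriv (\<lambda>t. t * \<phi> t) t / \<phi> t"
  obtains \<psi> \<psi>' where "flux_inverse \<psi> \<psi>' (1 / (\<gamma>1 - 1))"
    "\<And>s. \<psi> (\<phi> \<bar>s\<bar> * s) = s" "\<And>y. \<phi> \<bar>\<psi> y\<bar> * \<psi> y = y"
proof -
  define \<Phi> where "\<Phi> = (\<lambda>s. \<phi> \<bar>s\<bar> * s)"
  have odd: "\<Phi> (- s) = - \<Phi> s" for s by (simp add: \<Phi>_def)
  have pos: "\<Phi> s > 0" if "s > 0" for s using that phi_pos by (simp add: \<Phi>_def)
  have dphi: "((\<lambda>t. t * \<phi> t) has_real_derivative deriv (\<lambda>t. t * \<phi> t) t) (at t)" if "t > 0" for t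
  proof -
    have "\<phi> differentiable (at t)" using C1_differentiable_on_eq[of \<phi> "{0<..}"] phi_C1 that by auto
    then have "(\<lambda>t. t * \<phi> t) differentiable (at t)" by (intro derivative_intros) auto
    then show ?thesis by (simp add: DERIV_deriv_iff_real_differentiable)
  qed
  have dPhi: "(\<Phi> has_real_derivative deriv (\<lambda>t. t * \<phi> t) t) (at t)" if "t > 0" for t
    by (rule has_field_derivative_transform_within_open[OF dphi[OF that], of "{0<..}"])
      (use that in \<open>auto simp: \<Phi>_def mult.commute\<close>)
  have mono_pos: "\<Phi> s < \<Phi> t" if "0 < s" "s < t" for s t
    using strict_mono_onD[OF phi2, of s t] that by (simp add: \<Phi>_def mult.commute)
  have "strict_mono \<Phi>"
  proof (rule strict_monoI)
    fix s t :: real assume "s < t"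
    consider "0 < s" | "s = 0" | "s < 0" "t > 0" | "t = 0" | "t < 0" using \<open>s < t\<close> by linarith
    then show "\<Phi> s < \<Phi> t"
    proof cases
      case 1 then show ?thesis using mono_pos \<open>s < t\<close> by simp
    next
      case 2 then show ?thesis using pos[of t] \<open>s < t\<close> by (simp add: \<Phi>_def)
    next
      case 3 then show ?thesis using pos[of t] pos[of "- s"] odd[of s] by simp
    next
      case 4 then show ?thesis using pos[of "- s"] odd[of s] \<open>s < t\<close> by (simp add: \<Phi>_def)
    next
      case 5 then show ?thesis using mono_pos[of "- t" "- s"] odd[of s] odd[of t] \<open>s < t\<close> by simp
    qed
  qed
  have surj_pos: "\<exists>s. \<Phi> s = y" if "y > 0" for y
  proof -
    have "\<forall>\<^sub>F t in at_right 0. t * \<phi> t < y" by (rule order_tendstoD(2)[OF phi1(1) that])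
    then obtain b where b: "b > 0" "\<And>t. 0 < t \<Longrightarrow> t < b \<Longrightarrow> t * \<phi> t < y"
      unfolding eventually_at_right_field by auto
    have "\<forall>\<^sub>F t in at_top. y \<le> t * \<phi> t" using phi1(2) by (simp add: filterlim_at_top)
    then obtain N where N: "\<And>t. t \<ge> N \<Longrightarrow> y \<le> t * \<phi> t" unfolding eventually_at_top_linorder by auto
    have "\<exists>t\<ge>b / 2. t \<le> max N b \<and> t * \<phi> t = y"
    proof (rule IVT')
      show "continuous_on {b / 2..max N b} (\<lambda>t. t * \<phi> t)"
        using b(1) by (intro DERIV_continuous_on[OF has_field_derivative_at_within[OF dphi]]) auto
    qed (use b(1) b(2)[of "b / 2"] N[of "max N b"] in auto)
    then obtain t where "t \<ge> b / 2" "t * \<phi> t = y" by blast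
    then show ?thesis using b(1) by (intro exI[of _ t]) (simp add: \<Phi>_def mult.commute)
  qed
  have "surj \<Phi>"
    unfolding surj_def
  proof
    fix y :: real
    consider "y > 0" | "y = 0" | "y < 0" by linarith
    then show "\<exists>s. y = \<Phi> s"
    proof cases
      case 1 then show ?thesis using surj_pos by metis
    next
      case 2 then show ?thesis by (intro exI[of _ 0]) (simp add: \<Phi>_def)
    next
      case 3
      then obtain s where "\<Phi> s = - y" using surj_pos[of "- y"] by auto
      then show ?thesis using odd[of s] by (intro exI[of _ "- s"]) simp
    qed
  qed
  define \<psi> where "\<psi> = inv \<Phi>"
  have left: "\<psi> (\<Phi> s) = s" for s
    unfolding \<psi>_def by (rule inv_f_f[OF strict_mono_imp_inj_on[OF \<open>strict_mono \<Phi>\<close>]])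
  have right: "\<Phi> (\<psi> y) = y" for y
    unfolding \<psi>_def by (rule surj_f_inv_f[OF \<open>surj \<Phi>\<close>])
  have mono: "strict_mono \<psi>"
    using right strict_mono_less[OF \<open>strict_mono \<Phi>\<close>] by (intro strict_monoI) metis
  \<comment> \<open>A monotone function with open range is continuous.\<close>
  have cont: "continuous_on UNIV \<psi>"
  proof (rule continuous_onI_mono)
    have "range \<psi> = UNIV" using left by (metis surjI)
    then show "open (range \<psi>)" by simp
  qed (use mono in \<open>auto simp: strict_mono_less_eq\<close>)
  define \<psi>' where "\<psi>' = (\<lambda>y. inverse (deriv (\<lambda>t. t * \<phi> t) (\<psi> y)))"
  have psi_pos: "\<psi> y > 0" if "y > 0" for y
    using that strict_mono_less[OF mono, of 0 y] left[of 0] by (simp add: \<Phi>_def)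
  have D: "(\<gamma>1 - 1) * \<phi> t \<le> deriv (\<lambda>t. t * \<phi> t) t" "0 < deriv (\<lambda>t. t * \<phi> t) t" if "t > 0" for t
  proof -
    show *: "(\<gamma>1 - 1) * \<phi> t \<le> deriv (\<lambda>t. t * \<phi> t) t"
      using phi3[OF that] phi_pos[OF that] by (simp add: field_simps)
    have "0 < (\<gamma>1 - 1) * \<phi> t" using g phi_pos[OF that] by simp
    then show "0 < deriv (\<lambda>t. t * \<phi> t) t" using * by linarith
  qed
  have "flux_inverse \<psi> \<psi>' (1 / (\<gamma>1 - 1))"
  proof
    show "\<psi> (- y) = - \<psi> y" for y
      using left[of "- \<psi> y"] odd[of "\<psi> y"] right[of y] by simp
    fix y :: real assume y: "y > 0"
    note s = psi_pos[OF y]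
    show "(\<psi> has_real_derivative \<psi>' y) (at y)"
      unfolding \<psi>'_def
    proof (rule DERIV_inverse_function[where f = \<Phi> and a = "y - 1" and b = "y + 1"])
      show "(\<Phi> has_real_derivative deriv (\<lambda>t. t * \<phi> t) (\<psi> y)) (at (\<psi> y))" by (rule dPhi[OF s])
      show "isCont \<psi> y" using cont by (simp add: continuous_on_eq_continuous_at)
    qed (use D(2)[OF s] right in auto)
    have "y = \<phi> (\<psi> y) * \<psi> y" using right[of y] s by (simp add: \<Phi>_def)
    then have "(\<gamma>1 - 1) * y = (\<gamma>1 - 1) * \<phi> (\<psi> y) * \<psi> y" by (metis mult.assoc)
    also have "\<dots> \<le> deriv (\<lambda>t. t * \<phi> t) (\<psi> y) * \<psi> y"
      using D(1)[OF s] s by (intro mult_right_mono) auto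
    finally show "y * \<psi>' y \<le> 1 / (\<gamma>1 - 1) * \<psi> y"
      unfolding \<psi>'_def using g D(2)[OF s] by (simp add: field_simps)
  qed (use cont mono g in auto)
  then show thesis using that left right unfolding \<Phi>_def by blast
qed

section \<open>Regularity of the nonlinearity and integrability near 0\<close>

lemma C1_imp_locally_lipschitz:
  fixes f :: "real \<Rightarrow> real"
  assumes "f C1_differentiable_on (UNIV - {0})" "x \<noteq> 0"
  shows "\<exists>L e. e > 0 \<and> (\<forall>y z. \<bar>y - x\<bar> \<le> e \<longrightarrow> \<bar>z - x\<bar> \<le> e \<longrightarrow> \<bar>f y - f z\<bar> \<le> L * \<bar>y - z\<bar>)"
proof -
  obtain D where D: "\<And>t. t \<in> UNIV - {0} \<Longrightarrow> (f has_vector_derivative D t) (at t)"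
      "continuous_on (UNIV - {0}) D"
    using assms(1) unfolding C1_differentiable_on_def by blast
  let ?S = "{x - \<bar>x\<bar> / 2..x + \<bar>x\<bar> / 2}"
  have S: "?S \<subseteq> UNIV - {0}" using assms(2) by (auto simp: abs_if)
  have "bounded (D ` ?S)"
    by (intro compact_imp_bounded compact_continuous_image continuous_on_subset[OF D(2) S]) simp
  then obtain L where L: "\<forall>t\<in>?S. \<bar>D t\<bar> \<le> L" unfolding bounded_iff by auto
  have der: "(f has_real_derivative D t) (at t)" if "t \<in> ?S" for t
  proof -
    have "t \<in> UNIV - {0}" using S that by blast
    then show ?thesis using D(1)[of t] by (simp add: has_real_derivative_iff_has_vector_derivative)
  qed
  show ?thesis
  proof (rule exI[of _ L], rule exI[of _ "\<bar>x\<bar> / 2"], intro conjI allI impI)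
    fix y z assume "\<bar>y - x\<bar> \<le> \<bar>x\<bar> / 2" "\<bar>z - x\<bar> \<le> \<bar>x\<bar> / 2"
    then have yz: "y \<in> ?S" "z \<in> ?S" unfolding atLeastAtMost_iff by (intro conjI; linarith)+
    show "\<bar>f y - f z\<bar> \<le> L * \<bar>y - z\<bar>"
      by (rule lipschitz_of_deriv_le[OF yz DERIV_continuous_on[OF has_field_derivative_at_within[OF der]] der])
        (use L in auto)
  qed (use assms(2) in auto)
qed

lemma integrable_on_of_nn_integral_finite:
  fixes h :: "real \<Rightarrow> real"
  assumes "h \<in> borel_measurable borel" "\<And>t. 0 \<le> h t" "(\<integral>\<^sup>+t\<in>{c..d}. ennreal (h t) \<partial>lborel) < \<infinity>"
  shows "h integrable_on {c..d}"
proof -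
  have "set_integrable lborel {c..d} h"
    unfolding set_integrable_def
  proof (rule integrableI_bounded)
    show "(\<lambda>x. indicator {c..d} x *\<^sub>R h x) \<in> borel_measurable lborel" using assms(1) by simp
    have "(\<integral>\<^sup>+x. ennreal (norm (indicator {c..d} x *\<^sub>R h x)) \<partial>lborel) = (\<integral>\<^sup>+t\<in>{c..d}. ennreal (h t) \<partial>lborel)"
      by (rule nn_integral_cong) (use assms(2) in \<open>auto simp: indicator_def\<close>)
    then show "(\<integral>\<^sup>+x. ennreal (norm (indicator {c..d} x *\<^sub>R h x)) \<partial>lborel) < \<infinity>" using assms(3) by simp
  qed
  then show ?thesis by (rule set_borel_integral_eq_integral(1))
qed

text \<open>For b < 0 the sign from the orientation and the sign of \<open>k\<close> cancel, so on
  either side the extended integral is that of the nonnegative \<open>h\<close>.\<close>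

lemma integrable_on_of_ext_integral_less_top:
  fixes h k :: "real \<Rightarrow> real"
  assumes h: "h \<in> borel_measurable borel" "\<And>t. 0 \<le> h t" and fin: "ext_integral 0 b k < \<infinity>"
    and k: "\<And>t. 0 \<le> t \<Longrightarrow> k t = h t" "\<And>t. t \<le> 0 \<Longrightarrow> k t = - h t"
  shows "h integrable_on {min 0 b..max 0 b}"
proof -
  let ?S = "{min 0 b..max 0 b}" and ?I = "\<lambda>k S. \<integral>\<^sup>+t\<in>S. ennreal (k t) \<partial>(lborel :: real measure)"
  have "enn2ereal (?I h ?S) = ext_integral 0 b k"
  proof (cases "0 \<le> b")
    case True
    then have "?I k {0..b} = ?I h {0..b}" "?I (\<lambda>t. - k t) {0..b} = (\<integral>\<^sup>+(t::real). 0 \<partial>lborel)"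
      by (intro nn_integral_cong; use h(2) in \<open>auto simp: indicator_def k(1) ennreal_neg\<close>)+
    then show ?thesis using True by (simp add: ext_integral_def zero_ennreal.rep_eq)
  next
    case False
    then have "?I (\<lambda>t. - k t) {b..0} = ?I h {b..0}" "?I k {b..0} = (\<integral>\<^sup>+(t::real). 0 \<partial>lborel)"
      by (intro nn_integral_cong; use h(2) in \<open>auto simp: indicator_def k(2) ennreal_neg\<close>)+
    then show ?thesis using False by (simp add: ext_integral_def zero_ennreal.rep_eq)
  qed
  then have "?I h ?S < \<infinity>" using fin by (simp add: less_ennreal.rep_eq)
  then show ?thesis by (rule integrable_on_of_nn_integral_finite[OF h])
qed

lemma Liminf_less_top_imp_frequently:
  fixes X :: "'a \<Rightarrow> ereal"
  assumes "Liminf F X < \<infinity>"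
  shows "\<exists>\<^sub>F x in F. X x < \<infinity>"
proof (rule ccontr)
  assume "\<not> ?thesis"
  then have "\<forall>\<^sub>F x in F. X x = \<infinity>" by (simp add: not_frequently)
  then have "\<forall>\<^sub>F x in F. \<infinity> \<le> X x" by (auto elim: eventually_mono)
  from Liminf_bounded[OF this] show False using assms by simp
qed

text \<open>A finite lower limit yields, on each side of 0, at least one point up to which the
  integral is finite. Joining the two intervals gives integrability across 0.\<close>

lemma integrable_near_0:
  fixes f :: "real \<Rightarrow> real"
  assumes f_cont: "continuous_on UNIV f" and f1: "\<And>t. t \<noteq> 0 \<Longrightarrow> t * f t > 0"
    and f3: "Liminf (at_right 0) (\<lambda>\<nu>. ext_integral 0 \<nu> (\<lambda>t. \<bar>f t\<bar> powr q * sgn (f t))) < \<infinity>"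
            "Liminf (at_left 0) (\<lambda>\<nu>. ext_integral 0 \<nu> (\<lambda>t. \<bar>f t\<bar> powr q * sgn (f t))) < \<infinity>"
  obtains a b where "a < 0" "0 < b" "(\<lambda>t. \<bar>f t\<bar> powr q) integrable_on {a..b}"
proof -
  let ?h = "\<lambda>t. \<bar>f t\<bar> powr q" and ?k = "\<lambda>t. \<bar>f t\<bar> powr q * sgn (f t)"
  have f_meas: "f \<in> borel_measurable borel" by (rule borel_measurable_continuous_onI[OF f_cont])
  have meas: "?h \<in> borel_measurable borel" using f_meas by measurable
  have fpos: "f t > 0" if "t > 0" for t using f1[of t] that by (simp add: zero_less_mult_iff)
  have fneg: "f t < 0" if "t < 0" for t using f1[of t] that by (simp add: zero_less_mult_iff)
  \<comment> \<open>With \<open>0 powr q = 0\<close> this makes the signed and the unsigned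
    integrand agree at 0 for both choices of the sign.\<close>
  have f0: "f 0 = 0"
  proof -
    have lim: "(f \<longlongrightarrow> f 0) (at 0)" using f_cont by (simp add: continuous_on_def)
    have "0 \<le> f 0"
      by (rule tendsto_lowerbound[OF tendsto_mono[OF at_le lim], of "{0<..}"])
        (use fpos in \<open>auto simp: eventually_at_filter intro!: always_eventually less_imp_le\<close>)
    moreover have "f 0 \<le> 0"
      by (rule tendsto_upperbound[OF tendsto_mono[OF at_le lim], of "{..<0}"])
        (use fneg in \<open>auto simp: eventually_at_filter intro!: always_eventually less_imp_le\<close>)
    ultimately show ?thesis by simp
  qed
  have "\<exists>\<^sub>F \<nu> in at_right 0. ext_integral 0 \<nu> ?k < \<infinity>" by (rule Liminf_less_top_imp_frequently[OF f3(1)])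
  moreover have "\<forall>\<^sub>F \<nu> in at_right (0::real). \<nu> > 0" by (auto simp: eventually_at_filter)
  ultimately have "\<exists>\<^sub>F \<nu> in at_right 0. ext_integral 0 \<nu> ?k < \<infinity> \<and> \<nu> > 0" by (rule frequently_eventually_frequently)
  then obtain b where b: "ext_integral 0 b ?k < \<infinity>" "b > 0" by (auto dest: frequently_ex)
  have k: "?k t = ?h t" if "0 \<le> t" for t using fpos[of t] f0 that by (cases "t = 0") auto
  have k': "?k t = - ?h t" if "t \<le> 0" for t using fneg[of t] f0 that by (cases "t = 0") auto
  have ib: "?h integrable_on {0..b}"
    using integrable_on_of_ext_integral_less_top[OF meas _ b(1) k k'] b(2) by simp
  have "\<exists>\<^sub>F \<nu> in at_left 0. ext_integral 0 \<nu> ?k < \<infinity>" by (rule Liminf_less_top_imp_frequently[OF f3(2)])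
  moreover have "\<forall>\<^sub>F \<nu> in at_left (0::real). \<nu> < 0" by (auto simp: eventually_at_filter)
  ultimately have "\<exists>\<^sub>F \<nu> in at_left 0. ext_integral 0 \<nu> ?k < \<infinity> \<and> \<nu> < 0" by (rule frequently_eventually_frequently)
  then obtain a where a: "ext_integral 0 a ?k < \<infinity>" "a < 0" by (auto dest: frequently_ex)
  have "?h integrable_on {a..0}"
    using integrable_on_of_ext_integral_less_top[OF meas _ a(1) k k'] a(2) by simp
  then have "?h integrable_on {a..b}"
    by (rule Henstock_Kurzweil_Integration.integrable_combine[where c = 0, rotated 2]) (use ib a(2) b(2) in auto)
  then show thesis using that a(2) b(2) by blast
qed

text \<open>Away from 0 the integrand is continuous, so integrability on one neighbourhood of 0
  extends to all bounded intervals.\<close>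

lemma primitive_of_integrable_at_0:
  fixes h :: "real \<Rightarrow> real"
  assumes int: "h integrable_on {a..b}" and ab: "a < 0" "0 < b"
    and cont: "continuous_on (UNIV - {0}) h"
  shows "continuous_on UNIV (primitive h)"
    and "x \<noteq> 0 \<Longrightarrow> (primitive h has_real_derivative h x) (at x)"
proof -
  have int': "h integrable_on {- X..X}" if X: "\<bar>a\<bar> + b \<le> X" for X
  proof -
    have 1: "h integrable_on {- X..a}" "h integrable_on {b..X}"
      by (rule integrable_continuous_real; rule continuous_on_subset[OF cont]; use ab in auto)+
    have "h integrable_on {- X..b}"
      by (rule Henstock_Kurzweil_Integration.integrable_combine[where c = a]) (use 1 int ab X in auto)
    then show ?thesis by (rule Henstock_Kurzweil_Integration.integrable_combine[where c = b, rotated 2]) (use 1 ab X in auto)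
  qed
  have nhd: "at x within {- X..X} = at x" if "\<bar>x\<bar> < X" for x X :: real
    using that by (intro at_within_interior) auto
  have c: "isCont (primitive h) x" for x
  proof -
    define X where "X = \<bar>a\<bar> + b + \<bar>x\<bar> + 1"
    have "continuous_on {- X..X} (primitive h)"
      by (rule primitive_continuous_on_Icc[OF int']) (use ab in \<open>auto simp: X_def\<close>)
    moreover have "x \<in> {- X..X}" using ab by (auto simp: X_def)
    ultimately have "continuous (at x within {- X..X}) (primitive h)"
      unfolding continuous_on_eq_continuous_within by blast
    then show ?thesis using nhd[of x X] ab by (simp add: X_def)
  qed
  then show "continuous_on UNIV (primitive h)" by (simp add: continuous_at_imp_continuous_on)
  assume x: "x \<noteq> 0"
  define X where "X = \<bar>a\<bar> + b + \<bar>x\<bar> + 1"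
  have "isCont h x" using cont x by (simp add: continuous_on_eq_continuous_at open_delete)
  have "(primitive h has_real_derivative h x) (at x within {- X..X})"
    by (rule primitive_deriv_within[OF int' _ _ _ continuous_at_imp_continuous_within[OF \<open>isCont h x\<close>]])
      (use ab in \<open>auto simp: X_def\<close>)
  then show "(primitive h has_real_derivative h x) (at x)" using nhd[of x X] ab by (simp add: X_def)
qed

theorem theorem1p2:
  fixes R \<alpha> \<gamma> \<gamma>1 \<gamma>2 d_inf :: real and \<phi> f :: "real \<Rightarrow> real"
  assumes R: "R > 0"
    and phi_pos: "\<And>t. t > 0 \<Longrightarrow> \<phi> t > 0"
    and phi_C1: "\<phi> C1_differentiable_on {0<..}"
    and phi_diff2: "deriv \<phi> differentiable_on {0<..}"
    and gammas: "\<gamma>1 > 1" "\<gamma>2 > 1"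
    and phi1: "((\<lambda>t. t * \<phi> t) \<longlongrightarrow> 0) (at_right 0)"
              "filterlim (\<lambda>t. t * \<phi> t) at_top at_top"
    and phi2: "strict_mono_on {0<..} (\<lambda>t. t * \<phi> t)"
    and phi3: "\<And>t. t > 0 \<Longrightarrow> \<gamma>1 - 1 \<le> deriv (\<lambda>t. t * \<phi> t) t / \<phi> t"
              "\<And>t. t > 0 \<Longrightarrow> deriv (\<lambda>t. t * \<phi> t) t / \<phi> t \<le> \<gamma>2 - 1"
    and f_cont: "continuous_on UNIV f"
    and f_C1: "f C1_differentiable_on (UNIV - {0})"
    and f1: "\<And>t. t \<noteq> 0 \<Longrightarrow> t * f t > 0"
    and d_inf: "d_inf > 0"
    and f2: "mono_on {..d_inf} f"
    and f3: "Liminf (at_right 0)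
               (\<lambda>\<nu>. ext_integral 0 \<nu> (\<lambda>t. \<bar>f t\<bar> powr (- 1 / (\<gamma>1 - 1)) * sgn (f t))) < \<infinity>"
            "Liminf (at_left 0)
               (\<lambda>\<nu>. ext_integral 0 \<nu> (\<lambda>t. \<bar>f t\<bar> powr (- 1 / (\<gamma>1 - 1)) * sgn (f t))) < \<infinity>"
    and gamma: "\<gamma> \<ge> max \<alpha> (- \<alpha> / (\<gamma>1 - 1))"
  shows "\<exists>\<Lambda>>0. \<forall>lam\<in>{0<..\<Lambda>}. \<exists>u :: real \<Rightarrow> real \<Rightarrow> real.
     (\<forall>d\<in>{0<..d_inf}.
        ivp_solution \<phi> f \<alpha> \<gamma> lam d (u d) \<and>
        (\<forall>v. ivp_solution \<phi> f \<alpha> \<gamma> lam d v \<longrightarrow> (\<forall>r\<ge>0. v r = u d r))) \<and>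
     (\<exists>z :: nat \<Rightarrow> real \<Rightarrow> real.
        (\<forall>d\<in>{0<..d_inf}. \<forall>l\<ge>1. z l d > 0 \<and> u d (z l d) = 0) \<and>
        z 1 d_inf \<ge> R \<and>
        (\<forall>d\<in>{0<..d_inf}.
           (\<forall>r. 0 < r \<and> r < z 1 d \<longrightarrow> u d r > 0) \<and>
           (\<forall>l\<ge>1. z l d < z (Suc l) d) \<and>
           (\<forall>r. 0 < r \<and> r \<le> z 1 d \<longrightarrow> deriv_ge0 (u d) r < 0) \<and>
           (\<forall>l\<ge>1. (\<forall>r. z l d < r \<and> r < z (Suc l) d \<longrightarrow> u d r \<noteq> 0) \<and>
                   deriv_ge0 (u d) (z l d) \<noteq> 0)) \<and>
        (\<forall>l\<ge>1. (z l \<longlongrightarrow> 0) (at 0 within {0<..d_inf}) \<and>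
           (\<forall>d0\<in>{0<..d_inf}. (z l \<longlongrightarrow> z l d0) (at d0 within {0<..d_inf}))) \<and>
        (\<forall>d0\<in>{0<..d_inf}. \<forall>k.
           finite {r \<in> {0<..<R}. u d0 r = 0} \<and> card {r \<in> {0<..<R}. u d0 r = 0} = k \<longrightarrow>
           (\<forall>\<^sub>F d in at d0 within {0<..<d0}.
              finite {r \<in> {0<..<R}. u d r = 0} \<and> card {r \<in> {0<..<R}. u d r = 0} \<le> k + 1)))"
proof -
  let ?p = "1 / (\<gamma>1 - 1)"
  obtain \<psi> \<psi>' where fi: "flux_inverse \<psi> \<psi>' ?p"
    and left: "\<And>s. \<psi> (\<phi> \<bar>s\<bar> * s) = s" and right: "\<And>y. \<phi> \<bar>\<psi> y\<bar> * \<psi> y = y"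
    using flux_inverse_exists[OF phi_pos phi_C1 gammas(1) phi1 phi2 phi3(1)] by blast
  interpret fi: flux_inverse \<psi> \<psi>' ?p by (rule fi)
  have al: "\<alpha> \<le> \<gamma>" "- \<alpha> * ?p \<le> \<gamma>" using gamma by auto
  have neg1: "f (- 1) < 0" using f1[of "- 1"] by simp
  have f_mono_on: "f x \<le> f y" if "x \<le> y" "y \<le> d_inf" for x y
    using mono_onD[OF f2, of x y] that by simp
  \<comment> \<open>The energy bound will confine every solution with d \<le> \<open>d_inf\<close>
    to [-M, d_inf].\<close>
  obtain M where M: "M > 0" "primitive f d_inf \<le> primitive f (- M)"
    by (rule primitive_unbounded_below[OF f_cont neg1 f_mono_on]) (use d_inf in auto)
  \<comment> \<open>Composition with the projection onto [-M, d_inf] preserves sign, monotonicity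
    and local Lipschitz continuity off 0: 0 is an interior point of the interval, and the projection
    is monotone and 1-Lipschitz.\<close>
  define clamp where "clamp = (\<lambda>x. max (- M) (min d_inf x))"
  define g where "g = (\<lambda>x. f (clamp x))"
  have g_eq: "g x = f x" if "- M \<le> x" "x \<le> d_inf" for x using that by (simp add: g_def clamp_def)
  have clamp_mono: "clamp x \<le> clamp y" if "x \<le> y" for x y using that by (auto simp: clamp_def)
  have clamp_range: "- M \<le> clamp x" "clamp x \<le> d_inf" for x using M d_inf by (auto simp: clamp_def)
  have clamp_lip: "\<bar>clamp x - clamp y\<bar> \<le> \<bar>x - y\<bar>" for x y by (auto simp: clamp_def)
  have clamp_sign: "0 < x * clamp x" if "x \<noteq> 0" for x
    using that M d_inf by (auto simp: clamp_def zero_less_mult_iff)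
  have g_cont: "continuous_on UNIV g"
    unfolding g_def clamp_def by (intro continuous_on_compose2[OF f_cont] continuous_intros) auto
  have g_mono: "mono g"
    unfolding g_def by (intro monoI f_mono_on clamp_mono clamp_range)
  have g_sign: "0 < x * g x" if "x \<noteq> 0" for x
    using clamp_sign[OF that] f1[of "clamp x"] by (auto simp: g_def zero_less_mult_iff)
  have f_lip: "\<exists>L e. e > 0 \<and> (\<forall>y z. \<bar>y - x\<bar> \<le> e \<longrightarrow> \<bar>z - x\<bar> \<le> e \<longrightarrow> \<bar>f y - f z\<bar> \<le> L * \<bar>y - z\<bar>)"
    if "x \<noteq> 0" for x
    by (rule C1_imp_locally_lipschitz[OF f_C1 that])
  have g_lip: "\<exists>L e. e > 0 \<and> (\<forall>y z. \<bar>y - x\<bar> \<le> e \<longrightarrow> \<bar>z - x\<bar> \<le> e \<longrightarrow> \<bar>g y - g z\<bar> \<le> L * \<bar>y - z\<bar>)"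
    if "x \<noteq> 0" for x
  proof -
    have "clamp x \<noteq> 0" using clamp_sign[OF that] by auto
    then obtain L e where L: "e > 0"
      "\<And>y z. \<bar>y - clamp x\<bar> \<le> e \<Longrightarrow> \<bar>z - clamp x\<bar> \<le> e \<Longrightarrow> \<bar>f y - f z\<bar> \<le> L * \<bar>y - z\<bar>"
      using f_lip by blast
    have "\<bar>g y - g z\<bar> \<le> max L 0 * \<bar>y - z\<bar>" if "\<bar>y - x\<bar> \<le> e" "\<bar>z - x\<bar> \<le> e" for y z
    proof -
      have "\<bar>g y - g z\<bar> \<le> L * \<bar>clamp y - clamp z\<bar>"
        unfolding g_def using clamp_lip[of y x] clamp_lip[of z x] that by (intro L(2)) auto
      also have "\<dots> \<le> max L 0 * \<bar>y - z\<bar>" by (intro mult_mono clamp_lip) auto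
      finally show ?thesis .
    qed
    then show ?thesis using L(1) by blast
  qed
  define f_max where "f_max = max (g d_inf) (- g (- M))"
  have g_max: "\<bar>g x\<bar> \<le> f_max" for x
  proof -
    have "g x = f (clamp x)" "g d_inf = f d_inf" "g (- M) = f (- M)"
      using M d_inf by (auto simp: g_def clamp_def)
    then have "g (- M) \<le> g x" "g x \<le> g d_inf"
      using f_mono_on[OF clamp_range(1) clamp_range(2), of x] f_mono_on[OF clamp_range(2) order_refl, of x] by auto
    then show ?thesis unfolding f_max_def by linarith
  qed
  define h where "h = (\<lambda>x. \<bar>g x\<bar> powr - ?p)"
  obtain a0 b0 where ab0: "a0 < 0" "0 < b0" "(\<lambda>t. \<bar>f t\<bar> powr - ?p) integrable_on {a0..b0}"
    using integrable_near_0[OF f_cont f1, of "- ?p"] f3 by auto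
  \<comment> \<open>On [a, b] the truncation coincides with f, so the integrability at 0 carries
    over to it.\<close>
  define a where "a = max a0 (- M)"
  define b where "b = min b0 d_inf"
  have ab: "a < 0" "0 < b" using ab0 M d_inf by (auto simp: a_def b_def)
  have "(\<lambda>t. \<bar>f t\<bar> powr - ?p) integrable_on {a..b}"
    by (rule integrable_subinterval_real[OF ab0(3)]) (auto simp: a_def b_def)
  then have h_int: "h integrable_on {a..b}"
    by (rule integrable_eq) (auto simp: h_def g_eq a_def b_def)
  have h_cont: "continuous_on (UNIV - {0}) h"
    unfolding h_def using g_sign by (intro continuous_intros continuous_on_subset[OF g_cont]) force+
  define \<Psi> where "\<Psi> = primitive h"
  have Psi: "continuous_on UNIV \<Psi>" "\<And>x. x \<noteq> 0 \<Longrightarrow> (\<Psi> has_real_derivative \<bar>g x\<bar> powr - ?p) (at x)"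
    using primitive_of_integrable_at_0[OF h_int ab h_cont] by (auto simp: \<Psi>_def h_def)
  have Fg: "primitive g x = primitive f x" if "- M \<le> x" "x \<le> d_inf" for x
    unfolding primitive_def using that M d_inf
    by (intro arg_cong2[where f = minus] Henstock_Kurzweil_Integration.integral_cong) (auto intro!: g_eq)
  have f_sys: "ivp_system \<psi> \<psi>' ?p f \<alpha> \<gamma> lam" if "lam > 0" for lam
    by unfold_locales (use f_cont f1 f_lip that al in auto)
  have g_sys: "bounded_ivp_system \<psi> \<psi>' ?p g \<alpha> \<gamma> lam f_max \<Psi>" if "lam > 0" for lam
    by unfold_locales (use g_cont g_sign g_lip that al g_max g_mono Psi in \<open>auto simp: \<Psi>_def\<close>)
  \<comment> \<open>This is \<open>ymax f_max R\<close> for \<open>lam = 1\<close>; in general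
    \<open>ymax f_max R\<close> is \<open>lam * C\<close>. The following interpretations with
    parameter 1 provide facts that do not depend on \<open>lam\<close>.\<close>
  define C where "C = f_max * (R powr (\<gamma> + 1 - \<alpha>) / (\<gamma> + 1))"
  interpret g1: bounded_ivp_system \<psi> \<psi>' ?p g \<alpha> \<gamma> 1 f_max \<Psi> by (rule g_sys) simp
  interpret f1: ivp_system \<psi> \<psi>' ?p f \<alpha> \<gamma> 1 by (rule f_sys) simp
  have C: "C > 0" using g1.f_max_pos g1.gamma_nonneg R by (simp add: C_def)
  \<comment> \<open>The flux that belongs to the slope \<open>d_inf / (2 * R)\<close>. As long as
    \<open>lam * C \<le> Y\<close>, the solution starting at \<open>d_inf\<close> loses at most half
    its height on [0, R].\<close>
  define Y where "Y = \<phi> (d_inf / (2 * R)) * (d_inf / (2 * R))"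
  have Y: "Y > 0" "\<psi> Y = d_inf / (2 * R)"
    using d_inf R phi_pos[of "d_inf / (2 * R)"] left[of "d_inf / (2 * R)"] by (auto simp: Y_def)
  have FM: "primitive f d \<le> primitive f (- M)" if "0 < d" "d \<le> d_inf" for d
    using f1.F_strict_mono[of d d_inf] M(2) that by (cases "d = d_inf") auto
  show ?thesis
  proof (intro exI[of _ "Y / C"] conjI ballI, goal_cases)
    case 1
    show ?case using Y C by simp
  next
    case (2 lam)
    then have lam: "lam > 0" "lam * C \<le> Y" using C by (auto simp: field_simps)
    interpret f: ivp_system \<psi> \<psi>' ?p f \<alpha> \<gamma> lam by (rule f_sys[OF lam(1)])
    interpret g: bounded_ivp_system \<psi> \<psi>' ?p g \<alpha> \<gamma> lam f_max \<Psi> by (rule g_sys[OF lam(1)])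
    have "\<forall>d. \<exists>u w. d > 0 \<longrightarrow> (\<forall>T>0. g.sol T d u w)" using g.global_sol_exists by blast
    then obtain u w where uw: "\<And>d T. d > 0 \<Longrightarrow> T > 0 \<Longrightarrow> g.sol T d (u d) (w d)" by metis
    interpret fam: ivp_family \<psi> \<psi>' ?p g \<alpha> \<gamma> lam f_max \<Psi> u w
      by unfold_locales (rule uw)
    \<comment> \<open>The energy of the truncated problem already confines u to [-M, d_inf], where
      both nonlinearities and both primitives coincide.\<close>
    have f_sol: "f.sol T d (u d) (w d)" if d: "d \<in> {0<..d_inf}" and T: "T > 0" for d T
    proof (rule g.forced_cong_forcing[OF uw])
      fix r assume r: "0 < r" "r < T"
      have "- M \<le> u d r" "u d r \<le> d"
        using g.sol_range[OF uw[of d T], of r M] d T r M(1) FM[of d] Fg[of d] Fg[of "- M"] d_inf by auto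
      then show "g (u d r) = f (u d r)" using d by (intro g_eq) auto
    qed (use d T in auto)
    have sol: "ivp_solution \<phi> f \<alpha> \<gamma> lam d (u d)"
      and deriv_u: "\<And>r. 0 \<le> r \<Longrightarrow> deriv_ge0 (u d) r = \<psi> (r powr - \<alpha> * w d r)" if d: "d \<in> {0<..d_inf}" for d
      using f.sol_imp_ivp_solution[OF f_sol[OF d] right] by auto
    \<comment> \<open>A competitor \<open>v\<close> solves the problem with the original f, so the
      uniqueness result is applied to f and not to its truncation.\<close>
    have uniq: "v r = u d r" if d: "d \<in> {0<..d_inf}" and v: "ivp_solution \<phi> f \<alpha> \<gamma> lam d v" and r: "0 \<le> r" for d v r
    proof -
      obtain w' where "f.sol (r + 1) d v w'" using f.ivp_solution_imp_sol[OF v left] by blast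
      then show ?thesis using f.sol_unique(1)[OF _ f_sol[OF d], of "r + 1" v w' r] d r by auto
    qed
    have Suc: "\<exists>n. l = Suc n" if "1 \<le> l" for l using that by (cases l) auto
    show ?case
    proof (rule exI[of _ u], rule conjI, goal_cases)
      case 1
      show ?case using sol uniq by blast
    next
      case 2
      show ?case
      proof (rule exI[of _ fam.zero], intro conjI ballI allI impI)
        fix d and l :: nat assume d: "d \<in> {0<..d_inf}" and l: "1 \<le> l"
        obtain n where n: "l = Suc n" using Suc[OF l] by blast
        show pos: "0 < fam.zero l d" and zero: "u d (fam.zero l d) = 0"
          unfolding n using d fam.zero_Suc_pos[of d n] fam.u_zero_Suc[of d n] by auto
        show "fam.zero l d < fam.zero (Suc l) d" using d by (intro fam.zero_less_Suc) auto
        have "w d (fam.zero l d) \<noteq> 0" using fam.w_nonzero[OF _ pos zero] d by auto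
        then have "fam.zero l d powr - \<alpha> * w d (fam.zero l d) \<noteq> 0" using pos by simp
        then have "\<psi> (fam.zero l d powr - \<alpha> * w d (fam.zero l d)) \<noteq> 0"
          by (metis linorder_neqE fi.psi_neg_iff fi.psi_pos_iff order_less_irrefl)
        then show "deriv_ge0 (u d) (fam.zero l d) \<noteq> 0" using deriv_u[OF d] pos by simp
        fix r assume "fam.zero l d < r \<and> r < fam.zero (Suc l) d"
        then show "u d r \<noteq> 0" using d fam.u_nonzero_between[of d l r] by auto
      next
        have "g.ymax f_max R = lam * C" by (simp add: g.ymax_def C_def)
        then have "\<psi> (g.ymax f_max R) \<le> d_inf / (2 * R)"
          using lam(2) fi.psi_le_iff[of "lam * C" Y] Y(2) by simp
        then have "\<psi> (g.ymax f_max R) * R \<le> d_inf / (2 * R) * R" using R by (intro mult_right_mono) auto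
        also have "\<dots> < d_inf" using R d_inf by simp
        finally show "R \<le> fam.zero 1 d_inf" by (intro fam.zero_1_ge d_inf R)
      next
        fix d r assume d: "d \<in> {0<..d_inf}" and r: "0 < r \<and> r < fam.zero 1 d"
        then show "0 < u d r" using fam.u_pos_before_first_zero[of d r] by auto
      next
        fix d r assume d: "d \<in> {0<..d_inf}" and r: "0 < r \<and> r \<le> fam.zero 1 d"
        then have "w d r < 0" using fam.w_neg_until_first_zero[of d r] by auto
        then have "r powr - \<alpha> * w d r < 0" using r by (simp add: mult_pos_neg)
        then show "deriv_ge0 (u d) r < 0" using deriv_u[OF d, of r] r by simp
      next
        fix l :: nat assume "1 \<le> l"
        show "(fam.zero l \<longlongrightarrow> 0) (at 0 within {0<..d_inf})"
        proof (rule tendstoI)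
          fix e :: real assume "e > 0"
          then obtain \<delta> where "\<delta> > 0" "\<And>d. d > 0 \<Longrightarrow> d < \<delta> \<Longrightarrow> fam.zero l d < e"
            using fam.zero_tendsto_0[of e l] by blast
          then show "\<forall>\<^sub>F d in at 0 within {0<..d_inf}. dist (fam.zero l d) 0 < e"
            unfolding eventually_at using fam.zero_nonneg[of _ l]
            by (intro exI[of _ \<delta>]) (auto simp: dist_real_def)
        qed
        fix d0 assume d0: "d0 \<in> {0<..d_inf}"
        show "(fam.zero l \<longlongrightarrow> fam.zero l d0) (at d0 within {0<..d_inf})"
        proof (rule tendstoI)
          fix e :: real assume "e > 0"
          then obtain \<delta> where "\<delta> > 0" "\<And>d. d > 0 \<Longrightarrow> \<bar>d - d0\<bar> < \<delta> \<Longrightarrow> \<bar>fam.zero l d - fam.zero l d0\<bar> < e"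
            using fam.zero_continuous[of d0 e l] d0 by auto
          then show "\<forall>\<^sub>F d in at d0 within {0<..d_inf}. dist (fam.zero l d) (fam.zero l d0) < e"
            unfolding eventually_at by (intro exI[of _ \<delta>]) (auto simp: dist_real_def)
        qed
      next
        fix d0 k assume d0: "d0 \<in> {0<..d_inf}"
          and k: "finite {r \<in> {0<..<R}. u d0 r = 0} \<and> card {r \<in> {0<..<R}. u d0 r = 0} = k"
        then obtain \<delta> where "\<delta> > 0" "\<And>d. d > 0 \<Longrightarrow> \<bar>d - d0\<bar> < \<delta> \<Longrightarrow>
            finite {r \<in> {0<..<R}. u d r = 0} \<and> card {r \<in> {0<..<R}. u d r = 0} \<le> k + 1"
          using fam.zero_count_upper_semicontinuous[of d0 R] by auto
        then show "\<forall>\<^sub>F d in at d0 within {0<..<d0}.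
            finite {r \<in> {0<..<R}. u d r = 0} \<and> card {r \<in> {0<..<R}. u d r = 0} \<le> k + 1"
          unfolding eventually_at by (intro exI[of _ \<delta>]) (auto simp: dist_real_def)
      qed
    qed
  qed
qed

end
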